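(* Assume that $\alpha>-1$ and $\alpha+\beta>-1/2$, and let $1<p<\infty$. Then $$M^{\alpha,\beta}_t f(x) \to f(x) \quad \text{for almost all } x \in \mathbb{R}_+ \text{ as } t \to 0^+$$ for any locally integrable function $f$ on $\mathbb{R}_+$ in case $\alpha+\beta \ge 1/2$, or for any $f$ locally in $L^p(\mathbb{R}_+,dx)$ with $p$ satisfying $\frac1p<\alpha+\beta+\frac12$ in case $\alpha+\beta < 1/2$.
   Context: $\mathbb{R}_+=(0,\infty)$; $\alpha,\beta$ are real. Let $d\mu_\alpha(x)=x^{2\alpha+1}dx$ on $\mathbb{R}_+$, and let $J_\nu$ be the Bessel function of the first kind and order $\nu$. For $\alpha>-1$, $\alpha+\beta>-1/2$ and $t,x,z>0$ with $t\ne|x-z|$, $t\ne x+z$, put $$K_t^{\alpha,\beta}(x,z) = \frac{2^{\alpha+\beta}\Gamma(\alpha+\beta+1)}{t^{\alpha+\beta}(xz)^{\alpha}} \int_0^{\infty} J_{\alpha+\beta}(ty)J_{\alpha}(xy) J_{\alpha}(zy) y^{1-\alpha-\beta}\, dy,$$ where the integral converges absolutely if $\alpha+\beta>1/2$ and otherwise is understood as a conditionally convergent (at $\infty$) improper Riemann integral. Define $$M_t^{\alpha,\beta}f(x)=\int_0^{\infty}K^{\alpha,\beta}_t(x,z)f(z)\, d\mu_{\alpha}(z),\qquad x\in\mathbb{R}_+.$$ "Locally" refers to compact subsets of $\mathbb{R}_+=(0,\infty)$. *)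

theory Defs
  imports "HOL-Analysis.Analysis"
begin

(* Only used for x > 0. Since rGamma vanishes at the poles of Gamma, the power series
   is the standard one for every real order. *)
definition bessel_J :: "real \<Rightarrow> real \<Rightarrow> real" where
  "bessel_J \<nu> x =
     (\<Sum>k. (- 1) ^ k * rGamma (real k + \<nu> + 1) / fact k * (x / 2) powr (2 * real k + \<nu>))"

definition mu :: "real \<Rightarrow> real measure" where
  "mu \<alpha> = density (lebesgue_on {0<..}) (\<lambda>x. ennreal (x powr (2 * \<alpha> + 1)))"

(* The integrand is O(y powr (2 * \<alpha> + 1)) at 0, hence absolutely integrable there when
   \<alpha> > -1; the improper integral is therefore a limit at the upper endpoint only.
   The value is meaningful for t \<noteq> \<bar>x - z\<bar> and t \<noteq> x + z; for fixed t and x this leaves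
   out finitely many z, which does not affect the integral operator below. *)
definition kernel :: "real \<Rightarrow> real \<Rightarrow> real \<Rightarrow> real \<Rightarrow> real \<Rightarrow> real" where
  "kernel \<alpha> \<beta> t x z =
     (let g = (\<lambda>y. bessel_J (\<alpha> + \<beta>) (t * y) * bessel_J \<alpha> (x * y) * bessel_J \<alpha> (z * y)
                   * y powr (1 - \<alpha> - \<beta>))
      in 2 powr (\<alpha> + \<beta>) * Gamma (\<alpha> + \<beta> + 1) / (t powr (\<alpha> + \<beta>) * (x * z) powr \<alpha>)
         * (if \<alpha> + \<beta> > 1 / 2 then (LBINT y:{0<..}. g y)
            else Lim at_top (\<lambda>R. LBINT y:{0<..R}. g y)))"

definition M_op :: "real \<Rightarrow> real \<Rightarrow> real \<Rightarrow> (real \<Rightarrow> complex) \<Rightarrow> real \<Rightarrow> complex" where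
  "M_op \<alpha> \<beta> t f x = (LINT z|mu \<alpha>. of_real (kernel \<alpha> \<beta> t x z) * f z)"

definition locally_integrable :: "(real \<Rightarrow> complex) \<Rightarrow> bool" where
  "locally_integrable f \<longleftrightarrow>
     (\<forall>K. compact K \<and> K \<subseteq> {0<..} \<longrightarrow> set_integrable lebesgue K f)"

definition locally_Lp :: "real \<Rightarrow> (real \<Rightarrow> complex) \<Rightarrow> bool" where
  "locally_Lp p f \<longleftrightarrow>
     (\<forall>K. compact K \<and> K \<subseteq> {0<..} \<longrightarrow>
        set_borel_measurable lebesgue K f \<and>
        set_integrable lebesgue K (\<lambda>x. norm (f x) powr p))"

end

theory Submission
  imports Defs
begin

text \<open>
  Put \<open>\<mu> = \<alpha> + \<beta>\<close>, \<open>m = \<mu> - 1/2\<close>, \<open>q = \<alpha>\<^sup>2 - 1/4\<close>. The function \<open>psi \<alpha> s = sqrt s * J\<^sub>\<alpha>(s)\<close> solves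
  \<open>psi'' = (q / s\<^sup>2 - 1) psi\<close>. Solving the wave equation for \<open>\<partial>\<^sup>2/\<partial>x\<^sup>2 - q / x\<^sup>2\<close> by Riemann's method
  writes \<open>psi (x y) cos (y \<tau>)\<close>, for \<open>\<bar>\<tau>\<bar> < x / 2\<close>, as the mean of \<open>psi (y (x + \<tau>))\<close> and \<open>psi (y (x - \<tau>))\<close>
  plus an integral of \<open>psi (y z)\<close> over \<open>\<bar>z - x\<bar> < \<bar>\<tau>\<bar>\<close>. Averaging over \<open>\<tau> = t \<sigma>\<close> with weight
  \<open>(1 - \<sigma>\<^sup>2) powr m\<close> turns the cosine into \<open>J\<^sub>\<mu>(t y) / (t y) powr \<mu>\<close> by Poisson's integral, so
  the Hankel transform of an explicit kernel supported in \<open>\<bar>z - x\<bar> \<le> t\<close> is known, and Hankel inversion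
  identifies that kernel with \<open>K\<^sub>t\<close> up to powers of \<open>x z\<close>. It is a dilation of
  \<open>(1 - \<sigma>\<^sup>2) powr m\<close>, normalised to mass one, plus a correction of size \<open>O(t)\<close>. Hence \<open>M\<^sub>t f (x)\<close>
  converges at every \<open>L\<^sup>p\<close> Lebesgue point \<open>x > 0\<close> of \<open>z powr (\<alpha> + 1/2) * f z\<close>; the weight is bounded for \<open>m \<ge> 0\<close> and lies
  in the dual exponent space when \<open>1 / p < m + 1\<close>.
\<close>

section \<open>The Bessel function as a perturbed oscillator\<close>

text \<open>The kernel is in general only a conditionally convergent integral of three Bessel
  functions, so it has to be recovered pointwise; mean-square inversion would not do. Pointwise
  inversion needs a local Lipschitz condition, which the explicit kernel satisfies except at |z - x|
  = t; for small t these are exactly the excluded points. Everything is done for t < x/2: then only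
  z between x/2 and 3x/2 matters, so nothing is required of f near 0 or infinity, and the Legendre
  series stays inside its disc of convergence. As x is fixed, no maximal function enters. For m < 0
  the dilated weight is singular at the moving points z = x - t and z = x + t, which an L1 Lebesgue
  point at x does not control; hence the p-th powers. The factor sqrt s in \<open>psi\<close> makes
  the measure z^(2\<alpha>+1) dz into Lebesgue measure once powers of x and z are shifted. For
  \<alpha> < -1/2 \<open>psi\<close> is unbounded at 0, hence the exponent min (\<alpha> + 1/2) 0 in
  every majorant; \<alpha> > -1 puts it above -1/2, so products of two values of \<open>psi\<close>
  are integrable at 0.\<close>

definition bessel_coeff :: "real \<Rightarrow> nat \<Rightarrow> real" where
  "bessel_coeff \<nu> k = (- 1) ^ k * rGamma (real k + \<nu> + 1) / fact k"

text \<open>The Bessel-Clifford function 0F1(; \<nu> + 1; -u) / Gamma(\<nu> + 1). At u = x^2/4 it is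
  the Bessel function stripped of (x/2)^\<nu>, and so smooth at 0.\<close>

definition bessel_entire :: "real \<Rightarrow> real \<Rightarrow> real" where
  "bessel_entire \<nu> u = (\<Sum>k. bessel_coeff \<nu> k * u ^ k)"

definition bessel_entire1 :: "real \<Rightarrow> real \<Rightarrow> real" where
  "bessel_entire1 \<nu> u = (\<Sum>k. diffs (bessel_coeff \<nu>) k * u ^ k)"

definition bessel_entire2 :: "real \<Rightarrow> real \<Rightarrow> real" where
  "bessel_entire2 \<nu> u = (\<Sum>k. diffs (diffs (bessel_coeff \<nu>)) k * u ^ k)"

lemma bessel_coeff_Suc:
  assumes "\<nu> > -1"
  shows "real (Suc k) * (real k + \<nu> + 1) * bessel_coeff \<nu> (Suc k) = - bessel_coeff \<nu> k"
proof -
  have "(real k + \<nu> + 1) * rGamma (real k + \<nu> + 1 + 1) = rGamma (real k + \<nu> + 1)"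
    by (rule rGamma_plus1)
  then have "rGamma (real k + \<nu> + 1) = (real k + \<nu> + 1) * rGamma (real (Suc k) + \<nu> + 1)"
    by (simp add: algebra_simps)
  then show ?thesis unfolding bessel_coeff_def
    by (simp add: fact_Suc divide_simps del: of_nat_Suc)
qed

lemma summable_bessel_coeff:
  assumes "\<nu> > -1"
  shows "summable (\<lambda>k. bessel_coeff \<nu> k * u ^ k)"
proof -
  \<comment> \<open>Beyond \<open>N\<close> the factor n + 1 is at least 2|u| and n + \<nu> + 1 is
    at least 1, so the ratio of consecutive terms is at most 1/2.\<close>
  obtain N :: nat where N: "real N > 2 * \<bar>u\<bar> + 2" "N > 1"
    by (metis reals_Archimedean2 less_max_iff_disj max_less_iff_conj of_nat_less_iff one_less_numeral_iff semiring_norm(76) max.strict_boundedE)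
  show ?thesis
  proof (rule summable_ratio_test[of "1/2" N])
    fix n assume n: "N \<le> n"
    then have rn: "real N \<le> real n" "n > 0" using N by auto
    have *: "bessel_coeff \<nu> n = - (real (Suc n) * (real n + \<nu> + 1)) * bessel_coeff \<nu> (Suc n)"
      using bessel_coeff_Suc[OF assms, of n] by simp
    have a: "real (Suc n) * (real n + \<nu> + 1) \<ge> 2 * \<bar>u\<bar> * 1"
      using rn N assms by (intro mult_mono) auto
    have "\<bar>u\<bar> * \<bar>bessel_coeff \<nu> (Suc n)\<bar> \<le> 1/2 * (real (Suc n) * (real n + \<nu> + 1)) * \<bar>bessel_coeff \<nu> (Suc n)\<bar>"
      using a by (intro mult_right_mono) auto
    also have "\<dots> = 1/2 * \<bar>bessel_coeff \<nu> n\<bar>"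
      unfolding * using assms rn by (simp add: abs_mult del: of_nat_Suc)
    finally have "\<bar>u\<bar> * \<bar>bessel_coeff \<nu> (Suc n)\<bar> * \<bar>u\<bar>^n \<le> 1/2 * \<bar>bessel_coeff \<nu> n\<bar> * \<bar>u\<bar>^n"
      by (intro mult_right_mono) auto
    then show "norm (bessel_coeff \<nu> (Suc n) * u ^ Suc n) \<le> 1/2 * norm (bessel_coeff \<nu> n * u ^ n)"
      by (simp add: abs_mult power_abs mult_ac)
  qed auto
qed

lemma summable_diffs_bessel_coeff:
  "\<nu> > -1 \<Longrightarrow> summable (\<lambda>k. diffs (bessel_coeff \<nu>) k * u ^ k)"
  by (rule termdiff_converges_all) (rule summable_bessel_coeff)

lemma summable_diffs2_bessel_coeff:
  "\<nu> > -1 \<Longrightarrow> summable (\<lambda>k. diffs (diffs (bessel_coeff \<nu>)) k * u ^ k)"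
  by (rule termdiff_converges_all) (rule summable_diffs_bessel_coeff)

lemma has_real_derivative_bessel_entire:
  "\<nu> > -1 \<Longrightarrow> (bessel_entire \<nu> has_real_derivative bessel_entire1 \<nu> u) (at u)"
  unfolding bessel_entire_def bessel_entire1_def
  by (rule termdiffs_strong_converges_everywhere[OF summable_bessel_coeff])

lemma has_real_derivative_bessel_entire1:
  "\<nu> > -1 \<Longrightarrow> (bessel_entire1 \<nu> has_real_derivative bessel_entire2 \<nu> u) (at u)"
  unfolding bessel_entire1_def bessel_entire2_def
  by (rule termdiffs_strong_converges_everywhere[OF summable_diffs_bessel_coeff])

text \<open>The coefficient of u^k on the left is (k + 1)(k + \<nu> + 1) c(k+1) + c(k), which
  \<open>bessel_coeff_Suc\<close> annihilates. This is Bessel's equation in the variable u =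
  x^2/4.\<close>

lemma bessel_entire_ode:
  assumes "\<nu> > -1"
  shows "u * bessel_entire2 \<nu> u + (\<nu> + 1) * bessel_entire1 \<nu> u + bessel_entire \<nu> u = 0"
proof -
  let ?c = "bessel_coeff \<nu>"
  have 1: "(\<lambda>k. diffs ?c k * u ^ k) sums bessel_entire1 \<nu> u"
    unfolding bessel_entire1_def by (rule summable_sums[OF summable_diffs_bessel_coeff[OF assms]])
  have 0: "(\<lambda>k. ?c k * u ^ k) sums bessel_entire \<nu> u"
    unfolding bessel_entire_def by (rule summable_sums[OF summable_bessel_coeff[OF assms]])
  have "(\<lambda>k. diffs (diffs ?c) k * u ^ k) sums bessel_entire2 \<nu> u"
    unfolding bessel_entire2_def by (rule summable_sums[OF summable_diffs2_bessel_coeff[OF assms]])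
  from sums_mult[OF this, of u]
  have "(\<lambda>k. real (Suc k) * diffs ?c (Suc k) * u ^ Suc k) sums (u * bessel_entire2 \<nu> u)"
    by (simp add: diffs_def mult_ac)
  then have 2: "(\<lambda>k. real k * diffs ?c k * u ^ k) sums (u * bessel_entire2 \<nu> u)"
    by (subst (asm) sums_Suc_iff) simp
  have "(\<lambda>k. real k * diffs ?c k * u ^ k + (\<nu> + 1) * (diffs ?c k * u ^ k) + ?c k * u ^ k)
          sums (u * bessel_entire2 \<nu> u + (\<nu> + 1) * bessel_entire1 \<nu> u + bessel_entire \<nu> u)"
    by (intro sums_add 0 2 sums_mult 1)
  also have "(\<lambda>k. real k * diffs ?c k * u ^ k + (\<nu> + 1) * (diffs ?c k * u ^ k) + ?c k * u ^ k)
      = (\<lambda>k. 0)"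
  proof
    fix k
    have "real k * diffs ?c k * u ^ k + (\<nu> + 1) * (diffs ?c k * u ^ k) + ?c k * u ^ k =
       (real (Suc k) * (real k + \<nu> + 1) * ?c (Suc k) + ?c k) * u ^ k"
      unfolding diffs_def by (simp add: algebra_simps)
    then show "real k * diffs ?c k * u ^ k + (\<nu> + 1) * (diffs ?c k * u ^ k) + ?c k * u ^ k = 0"
      using bessel_coeff_Suc[OF assms, of k] by simp
  qed
  finally show ?thesis using sums_unique2[OF _ sums_zero] by blast
qed

lemma bessel_J_eq:
  assumes "\<nu> > -1" "x > 0"
  shows "bessel_J \<nu> x = (x / 2) powr \<nu> * bessel_entire \<nu> (x\<^sup>2 / 4)"
proof -
  have "bessel_J \<nu> x = (\<Sum>k. (x / 2) powr \<nu> * (bessel_coeff \<nu> k * (x\<^sup>2 / 4) ^ k))"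
    unfolding bessel_J_def
  proof (rule suminf_cong)
    fix k
    have "(x / 2) powr (2 * real k + \<nu>) = (x/2) powr (real (2 * k)) * (x / 2) powr \<nu>"
      by (simp add: powr_add)
    also have "(x/2) powr (real (2 * k)) = (x/2) ^ (2 * k)"
      using assms by (subst powr_realpow) auto
    also have "(x/2) ^ (2 * k) = (x\<^sup>2 / 4) ^ k"
      by (simp add: power_mult power_divide)
    finally show "(- 1) ^ k * rGamma (real k + \<nu> + 1) / fact k * (x / 2) powr (2 * real k + \<nu>)
        = (x / 2) powr \<nu> * (bessel_coeff \<nu> k * (x\<^sup>2 / 4) ^ k)"
      by (simp add: bessel_coeff_def)
  qed
  also have "\<dots> = (x / 2) powr \<nu> * bessel_entire \<nu> (x\<^sup>2 / 4)"
    unfolding bessel_entire_def by (rule suminf_mult) (rule summable_bessel_coeff[OF assms(1)])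
  finally show ?thesis .
qed

section \<open>The function \<open>psi\<close> and its second-order equation\<close>

definition psi :: "real \<Rightarrow> real \<Rightarrow> real" where
  "psi \<alpha> s = 2 powr (- \<alpha>) * s powr (\<alpha> + 1/2) * bessel_entire \<alpha> (s\<^sup>2 / 4)"

definition dpsi :: "real \<Rightarrow> real \<Rightarrow> real" where
  "dpsi \<alpha> s = 2 powr (- \<alpha>) * s powr (\<alpha> + 1/2) *
     ((\<alpha> + 1/2) / s * bessel_entire \<alpha> (s\<^sup>2 / 4) + s / 2 * bessel_entire1 \<alpha> (s\<^sup>2 / 4))"

lemma psi_bessel_J:
  assumes "\<alpha> > -1" "s > 0"
  shows "psi \<alpha> s = sqrt s * bessel_J \<alpha> s"
proof -
  have "s powr (\<alpha> + 1/2) = s powr \<alpha> * sqrt s"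
    using assms by (simp add: powr_add powr_half_sqrt)
  then show ?thesis
    unfolding psi_def bessel_J_eq[OF assms] using assms
    by (simp add: powr_divide powr_minus field_simps)
qed

lemma has_real_derivative_bessel_entire_square:
  assumes "\<alpha> > -1"
  shows "((\<lambda>s. bessel_entire \<alpha> (s\<^sup>2 / 4)) has_real_derivative bessel_entire1 \<alpha> (s\<^sup>2 / 4) * (s / 2)) (at s)"
    and "((\<lambda>s. bessel_entire1 \<alpha> (s\<^sup>2 / 4)) has_real_derivative bessel_entire2 \<alpha> (s\<^sup>2 / 4) * (s / 2)) (at s)"
proof -
  have "((\<lambda>s::real. s\<^sup>2 / 4) has_real_derivative s / 2) (at s)"
    by (auto intro!: derivative_eq_intros)
  then show "((\<lambda>s. bessel_entire \<alpha> (s\<^sup>2 / 4)) has_real_derivative bessel_entire1 \<alpha> (s\<^sup>2 / 4) * (s / 2)) (at s)"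
    and "((\<lambda>s. bessel_entire1 \<alpha> (s\<^sup>2 / 4)) has_real_derivative bessel_entire2 \<alpha> (s\<^sup>2 / 4) * (s / 2)) (at s)"
    by (rule DERIV_chain2[OF has_real_derivative_bessel_entire[OF assms]]
        DERIV_chain2[OF has_real_derivative_bessel_entire1[OF assms]])+
qed

lemma has_real_derivative_psi:
  assumes "\<alpha> > -1" "s > 0"
  shows "(psi \<alpha> has_real_derivative dpsi \<alpha> s) (at s)"
proof -
  let ?u = "s\<^sup>2 / 4" and ?a = "\<alpha> + 1/2"
  have "(psi \<alpha> has_real_derivative 2 powr (-\<alpha>) * (?a * s powr (?a - 1)) * bessel_entire \<alpha> ?u
    + bessel_entire1 \<alpha> ?u * (s / 2) * (2 powr (-\<alpha>) * s powr ?a)) (at s)"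
    unfolding psi_def[abs_def]
    by (intro DERIV_mult DERIV_cmult has_real_derivative_powr has_real_derivative_bessel_entire_square assms)
  also have "s powr (?a - 1) = s powr ?a / s"
    by (subst powr_diff) (use assms in simp)
  also have "2 powr (-\<alpha>) * (?a * (s powr ?a / s)) * bessel_entire \<alpha> ?u
    + bessel_entire1 \<alpha> ?u * (s / 2) * (2 powr (-\<alpha>) * s powr ?a) = dpsi \<alpha> s"
    unfolding dpsi_def by (simp add: algebra_simps)
  finally show ?thesis .
qed

text \<open>Liouville's normal form: the factor sqrt s removes the first-order term of Bessel's
  equation. What is left is a harmonic oscillator perturbed by q/s^2, which is integrable at
  infinity.\<close>

lemma has_real_derivative_dpsi:
  assumes "\<alpha> > -1" "s > 0"
  shows "(dpsi \<alpha> has_real_derivative ((\<alpha>\<^sup>2 - 1/4) / s\<^sup>2 - 1) * psi \<alpha> s) (at s)"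
proof -
  let ?u = "s\<^sup>2 / 4" and ?a = "\<alpha> + 1/2"
  have b2: "s\<^sup>2 * bessel_entire2 \<alpha> ?u = - 4 * (\<alpha> + 1) * bessel_entire1 \<alpha> ?u - 4 * bessel_entire \<alpha> ?u"
    using bessel_entire_ode[OF assms(1), of ?u] by (simp add: field_simps)
  define D where "D = (- ?a / s\<^sup>2 * bessel_entire \<alpha> ?u + bessel_entire1 \<alpha> ?u * (s / 2) * (?a / s))
    + (1 / 2 * bessel_entire1 \<alpha> ?u + bessel_entire2 \<alpha> ?u * (s / 2) * (s / 2))"
  have 1: "((\<lambda>s. ?a / s) has_real_derivative - ?a / s\<^sup>2) (at s)"
    using assms by (auto intro!: derivative_eq_intros simp: power2_eq_square)
  have 2: "((\<lambda>s. s / 2) has_real_derivative 1 / 2) (at s)"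
    by (auto intro!: derivative_eq_intros)
  have "(dpsi \<alpha> has_real_derivative
     2 powr (-\<alpha>) * (?a * s powr (?a - 1)) * (?a / s * bessel_entire \<alpha> ?u + s / 2 * bessel_entire1 \<alpha> ?u)
     + D * (2 powr (-\<alpha>) * s powr ?a)) (at s)"
    unfolding dpsi_def[abs_def] D_def
    by (intro DERIV_mult DERIV_cmult has_real_derivative_powr has_real_derivative_bessel_entire_square assms
      DERIV_add 1 2)
  also have "s powr (?a - 1) = s powr ?a / s"
    by (subst powr_diff) (use assms in simp)
  also have "2 powr (-\<alpha>) * (?a * (s powr ?a / s)) * (?a / s * bessel_entire \<alpha> ?u + s / 2 * bessel_entire1 \<alpha> ?u)
     + D * (2 powr (-\<alpha>) * s powr ?a) =
      2 powr (-\<alpha>) * s powr ?a * (?a / s * (?a / s * bessel_entire \<alpha> ?u + s / 2 * bessel_entire1 \<alpha> ?u) + D)"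
  proof -
    have "c * (a * (P / s)) * X + D * (c * P) = c * P * (a / s * X + D)" for c a P X :: real
      by (simp add: algebra_simps)
    then show ?thesis .
  qed
  also have "?a / s * (?a / s * bessel_entire \<alpha> ?u + s / 2 * bessel_entire1 \<alpha> ?u) + D
      = ((\<alpha>\<^sup>2 - 1/4) / s\<^sup>2 - 1) * bessel_entire \<alpha> ?u"
  proof -
    have "bessel_entire2 \<alpha> ?u * (s / 2) * (s / 2) = (s\<^sup>2 * bessel_entire2 \<alpha> ?u) / 4"
      by (simp add: power2_eq_square)
    also have "\<dots> = - (\<alpha> + 1) * bessel_entire1 \<alpha> ?u - bessel_entire \<alpha> ?u"
      unfolding b2 by simp
    finally have b: "bessel_entire2 \<alpha> ?u * (s / 2) * (s / 2) = - (\<alpha> + 1) * bessel_entire1 \<alpha> ?u - bessel_entire \<alpha> ?u" .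
    have D: "D = (- ?a / s\<^sup>2 * bessel_entire \<alpha> ?u + ?a / 2 * bessel_entire1 \<alpha> ?u)
      + (1 / 2 * bessel_entire1 \<alpha> ?u + (- (\<alpha> + 1) * bessel_entire1 \<alpha> ?u - bessel_entire \<alpha> ?u))"
      unfolding D_def b using assms by (simp add: mult.commute)
    have "?a / s * (?a / s * bessel_entire \<alpha> ?u + s / 2 * bessel_entire1 \<alpha> ?u)
      = ?a\<^sup>2 / s\<^sup>2 * bessel_entire \<alpha> ?u + ?a / 2 * bessel_entire1 \<alpha> ?u"
      using assms by (simp add: power2_eq_square distrib_left)
    moreover have "a\<^sup>2 / S * b + a / 2 * c + ((- a / S * b + a / 2 * c) + (1 / 2 * c + (- (a + 1/2) * c - b)))
      = (a\<^sup>2 / S - a / S - 1) * b" for a b c S :: real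
      unfolding divide_inverse by (simp add: algebra_simps)
    from this[of ?a "s\<^sup>2" "bessel_entire \<alpha> ?u" "bessel_entire1 \<alpha> ?u"]
    have "?a\<^sup>2 / s\<^sup>2 * bessel_entire \<alpha> ?u + ?a / 2 * bessel_entire1 \<alpha> ?u + D = (?a\<^sup>2 / s\<^sup>2 - ?a / s\<^sup>2 - 1) * bessel_entire \<alpha> ?u"
      unfolding D by (simp add: algebra_simps)
    ultimately have "?a / s * (?a / s * bessel_entire \<alpha> ?u + s / 2 * bessel_entire1 \<alpha> ?u) + D
      = (?a\<^sup>2 / s\<^sup>2 - ?a / s\<^sup>2 - 1) * bessel_entire \<alpha> ?u"
      by simp
    also have "?a\<^sup>2 / s\<^sup>2 - ?a / s\<^sup>2 = (\<alpha>\<^sup>2 - 1/4) / s\<^sup>2"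
      by (simp add: power2_eq_square algebra_simps flip: diff_divide_distrib)
    finally show ?thesis .
  qed
  finally show ?thesis unfolding psi_def by (simp add: mult_ac)
qed

section \<open>Perturbed oscillators at infinity\<close>

text \<open>The bound on the derivative makes F - M/s increasing and F + M/s decreasing. The first
  stays below the second, hence converges, and M/s tends to 0.\<close>

lemma bounded_continuous_DERIV_limit_at_top:
  fixes F F' :: "real \<Rightarrow> real"
  assumes d: "\<And>s. s \<ge> 1 \<Longrightarrow> (F has_real_derivative F' s) (at s)"
    and b: "\<And>s. s \<ge> 1 \<Longrightarrow> \<bar>F' s\<bar> \<le> M / s\<^sup>2"
  obtains L where "(F \<longlongrightarrow> L) at_top"
proof -
  have M: "M \<ge> 0" using b[of 1] by simp
  define G where "G s = F s - M / s" for s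
  have dG: "(G has_real_derivative F' s + M / s\<^sup>2) (at s)" if "s \<ge> 1" for s
    unfolding G_def[abs_def] using that
    by (auto intro!: derivative_eq_intros d simp: power2_eq_square)
  have mono: "G s \<le> G t" if "1 \<le> s" "s \<le> t" for s t
  proof (rule DERIV_nonneg_imp_nondecreasing[OF that(2)])
    fix x assume "s \<le> x" "x \<le> t"
    then have "x \<ge> 1" using that by simp
    from dG[OF this] b[OF this] show "\<exists>y. (G has_real_derivative y) (at x) \<and> 0 \<le> y"
      by (intro exI[of _ "F' x + M / x\<^sup>2"]) auto
  qed
  define H where "H s = F s + M / s" for s
  have dH: "(H has_real_derivative F' s - M / s\<^sup>2) (at s)" if "s \<ge> 1" for s
    unfolding H_def[abs_def] using that
    by (auto intro!: derivative_eq_intros d simp: power2_eq_square)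
  have anti: "H t \<le> H s" if "1 \<le> s" "s \<le> t" for s t
  proof (rule DERIV_nonpos_imp_nonincreasing[OF that(2)])
    fix x assume "s \<le> x" "x \<le> t"
    then have "x \<ge> 1" using that by simp
    from dH[OF this] b[OF this] show "\<exists>y. (H has_real_derivative y) (at x) \<and> y \<le> 0"
      by (intro exI[of _ "F' x - M / x\<^sup>2"]) auto
  qed
  have bdd: "G s \<le> H 1" if "s \<ge> 1" for s
  proof -
    have "G s \<le> H s" unfolding G_def H_def using that M by (simp add: field_simps)
    with anti[of 1 s] that show ?thesis by simp
  qed
  define L where "L = (SUP s\<in>{1..}. G s)"
  have bd: "bdd_above (G ` {1..})" using bdd by (intro bdd_aboveI[of _ "H 1"]) auto
  have "(G \<longlongrightarrow> L) at_top"
  proof (rule order_tendstoI)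
    fix a assume "a < L"
    then obtain s where s: "s \<ge> 1" "a < G s"
      unfolding L_def using less_cSUP_iff[OF _ bd, of a] by auto
    then show "\<forall>\<^sub>F x in at_top. a < G x"
      using mono[OF s(1)] by (auto simp: eventually_at_top_linorder intro!: exI[of _ s] order_less_le_trans[of a "G s"])
  next
    fix a assume a: "L < a"
    have "G x \<le> L" if "x \<ge> 1" for x unfolding L_def using that bd by (intro cSUP_upper) auto
    with a show "\<forall>\<^sub>F x in at_top. G x < a"
      by (auto simp: eventually_at_top_linorder intro!: exI[of _ 1] intro: order_le_less_trans)
  qed
  moreover have "((\<lambda>s. M / s) \<longlongrightarrow> 0) at_top"
    by (intro tendsto_divide_0[OF tendsto_const] filterlim_at_top_imp_at_infinity filterlim_ident)
  ultimately have "((\<lambda>s. G s + M / s) \<longlongrightarrow> L + 0) at_top"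
    by (intro tendsto_add)
  then show thesis using that[of L] by (simp add: G_def)
qed

text \<open>A Gronwall argument: the energy f^2 + f'^2 is conserved for q = 0, and its derivative 2
  q f f' / s^2 is at most |q|/s^2 times the energy. The factor exp (|q|/s) has logarithmic
  derivative -|q|/s^2, so \<open>E\<close> decreases, and being at least 1 it keeps the energy below
  \<open>E 1\<close>.\<close>

lemma perturbed_oscillator_bounded:
  fixes f f' :: "real \<Rightarrow> real"
  assumes f: "\<And>s. s \<ge> 1 \<Longrightarrow> (f has_real_derivative f' s) (at s)"
    and f': "\<And>s. s \<ge> 1 \<Longrightarrow> (f' has_real_derivative (q / s\<^sup>2 - 1) * f s) (at s)"
  obtains M where "\<And>s. s \<ge> 1 \<Longrightarrow> \<bar>f s\<bar> \<le> M" "\<And>s. s \<ge> 1 \<Longrightarrow> \<bar>f' s\<bar> \<le> M"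
proof -
  define E where "E s = ((f s)\<^sup>2 + (f' s)\<^sup>2) * exp (\<bar>q\<bar> / s)" for s
  have dE: "(E has_real_derivative (2 * q * f s * f' s / s\<^sup>2 - \<bar>q\<bar> / s\<^sup>2 * ((f s)\<^sup>2 + (f' s)\<^sup>2)) * exp (\<bar>q\<bar> / s)) (at s)"
    if "s \<ge> 1" for s
  proof -
    have 1: "((\<lambda>s. (f s)\<^sup>2 + (f' s)\<^sup>2) has_real_derivative
        2 * (f' s * f s) + 2 * ((q / s\<^sup>2 - 1) * f s * f' s)) (at s)"
      by (auto intro!: derivative_eq_intros f[OF that] f'[OF that])
    have "((\<lambda>s. \<bar>q\<bar> / s) has_real_derivative - \<bar>q\<bar> / s\<^sup>2) (at s)"
      using that by (auto intro!: derivative_eq_intros simp: power2_eq_square)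
    from DERIV_chain2[OF DERIV_exp this]
    have 2: "((\<lambda>s. exp (\<bar>q\<bar> / s)) has_real_derivative exp (\<bar>q\<bar> / s) * (- \<bar>q\<bar> / s\<^sup>2)) (at s)" .
    have "2 * (f' s * f s) + 2 * ((q / s\<^sup>2 - 1) * f s * f' s) = 2 * q * f s * f' s / s\<^sup>2"
      by (simp add: algebra_simps)
    with DERIV_mult[OF 1 2] show ?thesis
      unfolding E_def[abs_def] by (simp add: algebra_simps add_divide_distrib)
  qed
  have anti: "E s \<le> E 1" if "1 \<le> s" for s
  proof (rule DERIV_nonpos_imp_nonincreasing[OF that])
    fix x assume "1 \<le> x" "x \<le> s"
    have "2 * \<bar>f x * f' x\<bar> \<le> (f x)\<^sup>2 + (f' x)\<^sup>2"
      using sum_squares_bound[of "\<bar>f x\<bar>" "\<bar>f' x\<bar>"] by (simp add: abs_mult)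
    then have "\<bar>q\<bar> * (2 * \<bar>f x * f' x\<bar>) \<le> \<bar>q\<bar> * ((f x)\<^sup>2 + (f' x)\<^sup>2)"
      by (intro mult_left_mono) auto
    moreover have "2 * q * f x * f' x \<le> \<bar>q\<bar> * (2 * \<bar>f x * f' x\<bar>)"
      using abs_ge_self[of "2 * q * f x * f' x"] by (simp add: abs_mult)
    ultimately have "2 * q * f x * f' x \<le> \<bar>q\<bar> * ((f x)\<^sup>2 + (f' x)\<^sup>2)" by linarith
    then have "2 * q * f x * f' x / x\<^sup>2 \<le> \<bar>q\<bar> * ((f x)\<^sup>2 + (f' x)\<^sup>2) / x\<^sup>2"
      by (rule divide_right_mono) simp
    then have "(2 * q * f x * f' x / x\<^sup>2 - \<bar>q\<bar> / x\<^sup>2 * ((f x)\<^sup>2 + (f' x)\<^sup>2)) * exp (\<bar>q\<bar> / x) \<le> 0"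
      by (intro mult_nonpos_nonneg) auto
    with dE[OF \<open>1 \<le> x\<close>] show "\<exists>y. (E has_real_derivative y) (at x) \<and> y \<le> 0" by blast
  qed
  have le: "(f s)\<^sup>2 + (f' s)\<^sup>2 \<le> E 1" if "s \<ge> 1" for s
  proof -
    have "(f s)\<^sup>2 + (f' s)\<^sup>2 \<le> E s"
      unfolding E_def using that mult_left_mono[of 1 "exp (\<bar>q\<bar> / s)" "(f s)\<^sup>2 + (f' s)\<^sup>2"] by simp
    then show ?thesis using anti[OF that] by simp
  qed
  show thesis
  proof (rule that[of "sqrt (E 1)"])
    fix s :: real assume "s \<ge> 1"
    from le[OF this] have "(f s)\<^sup>2 \<le> E 1" "(f' s)\<^sup>2 \<le> E 1"
      using zero_le_power2[of "f s"] zero_le_power2[of "f' s"] by linarith+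
    then show "\<bar>f s\<bar> \<le> sqrt (E 1)" "\<bar>f' s\<bar> \<le> sqrt (E 1)"
      by (auto intro: real_le_rsqrt)
  qed
qed

text \<open>Variation of constants: the rotated vector \<open>(f cos - f' sin, f sin + f' cos)\<close> has derivative
  of order \<open>1/s\<^sup>2\<close>.\<close>
lemma perturbed_oscillator_asymptotics:
  fixes f f' :: "real \<Rightarrow> real"
  assumes f: "\<And>s. s \<ge> 1 \<Longrightarrow> (f has_real_derivative f' s) (at s)"
    and f': "\<And>s. s \<ge> 1 \<Longrightarrow> (f' has_real_derivative (q / s\<^sup>2 - 1) * f s) (at s)"
  obtains A B where "((\<lambda>s. f s - (A * cos s + B * sin s)) \<longlongrightarrow> 0) at_top"
    "((\<lambda>s. f' s - (B * cos s - A * sin s)) \<longlongrightarrow> 0) at_top"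
proof -
  obtain M where M: "\<And>s. s \<ge> 1 \<Longrightarrow> \<bar>f s\<bar> \<le> M" "\<And>s. s \<ge> 1 \<Longrightarrow> \<bar>f' s\<bar> \<le> M"
    using perturbed_oscillator_bounded[OF f f'] by blast
  define P Q where "P s = f s * cos s - f' s * sin s" and "Q s = f s * sin s + f' s * cos s" for s
  have dP: "(P has_real_derivative - (sin s * (q / s\<^sup>2 * f s))) (at s)" if "s \<ge> 1" for s
    unfolding P_def[abs_def]
    by (rule DERIV_cong, (rule derivative_eq_intros f[OF that] f'[OF that] refl)+)
      (simp add: algebra_simps)
  have dQ: "(Q has_real_derivative cos s * (q / s\<^sup>2 * f s)) (at s)" if "s \<ge> 1" for s
    unfolding Q_def[abs_def]
    by (rule DERIV_cong, (rule derivative_eq_intros f[OF that] f'[OF that] refl)+)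
      (simp add: algebra_simps)
  have b: "\<bar>c * (q / s\<^sup>2 * f s)\<bar> \<le> (\<bar>q\<bar> * M) / s\<^sup>2" if "s \<ge> 1" "\<bar>c\<bar> \<le> 1" for s c
  proof -
    have "\<bar>c * (q / s\<^sup>2 * f s)\<bar> = \<bar>c\<bar> * (\<bar>q\<bar> / s\<^sup>2 * \<bar>f s\<bar>)"
      by (simp add: abs_mult)
    also have "\<dots> \<le> 1 * (\<bar>q\<bar> / s\<^sup>2 * M)"
      by (intro mult_mono mult_left_mono M that) (use M(1)[OF that(1)] in auto)
    finally show ?thesis by simp
  qed
  obtain A where A: "(P \<longlongrightarrow> A) at_top"
    by (rule bounded_continuous_DERIV_limit_at_top[OF dP, of "\<bar>q\<bar> * M"])
      (use b[of _ "sin _"] in auto)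
  obtain B where B: "(Q \<longlongrightarrow> B) at_top"
    by (rule bounded_continuous_DERIV_limit_at_top[OF dQ, of "\<bar>q\<bar> * M"])
      (use b[of _ "cos _"] in auto)
  \<comment> \<open>Rotating (P, Q) back recovers (f, f'), so both errors are combinations of P - A
    and Q - B with bounded coefficients.\<close>
  have fe: "f s - (A * cos s + B * sin s) = (P s - A) * cos s + (Q s - B) * sin s"
    and f'e: "f' s - (B * cos s - A * sin s) = (Q s - B) * cos s - (P s - A) * sin s" for s
  proof -
    have "P s * cos s + Q s * sin s = f s * (sin s * sin s + cos s * cos s)"
      by (simp only: P_def Q_def algebra_simps)
    then show "f s - (A * cos s + B * sin s) = (P s - A) * cos s + (Q s - B) * sin s"
      by (simp add: algebra_simps)
    have "Q s * cos s - P s * sin s = f' s * (sin s * sin s + cos s * cos s)"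
      by (simp only: P_def Q_def algebra_simps)
    then show "f' s - (B * cos s - A * sin s) = (Q s - B) * cos s - (P s - A) * sin s"
      by (simp add: algebra_simps)
  qed
  have z: "((\<lambda>s. (g s - l) * c s) \<longlongrightarrow> 0) at_top"
    if "(g \<longlongrightarrow> l) at_top" "\<And>s. \<bar>c s\<bar> \<le> 1" for g c :: "real \<Rightarrow> real" and l
  proof (rule Lim_null_comparison)
    show "((\<lambda>s. \<bar>g s - l\<bar>) \<longlongrightarrow> 0) at_top"
      using that(1) by (simp add: tendsto_rabs_zero_iff LIM_zero)
    show "\<forall>\<^sub>F s in at_top. norm ((g s - l) * c s) \<le> \<bar>g s - l\<bar>"
      using that(2) by (auto simp: abs_mult intro!: always_eventually mult_left_le)
  qed
  show thesis
  proof (rule that[of A B])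
    show "((\<lambda>s. f s - (A * cos s + B * sin s)) \<longlongrightarrow> 0) at_top"
      unfolding fe using tendsto_add[OF z[OF A, of cos] z[OF B, of sin]] by simp
    show "((\<lambda>s. f' s - (B * cos s - A * sin s)) \<longlongrightarrow> 0) at_top"
      unfolding f'e using tendsto_diff[OF z[OF B, of cos] z[OF A, of sin]] by simp
  qed
qed

lemma psi_asymptotics:
  assumes "\<alpha> > -1"
  obtains A B where "((\<lambda>s. psi \<alpha> s - (A * cos s + B * sin s)) \<longlongrightarrow> 0) at_top"
    "((\<lambda>s. dpsi \<alpha> s - (B * cos s - A * sin s)) \<longlongrightarrow> 0) at_top"
  by (rule perturbed_oscillator_asymptotics[of "psi \<alpha>" "dpsi \<alpha>" "\<alpha>\<^sup>2 - 1/4"])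
    (use assms in \<open>auto intro!: has_real_derivative_psi has_real_derivative_dpsi\<close>)

lemma psi_bounded_at_top:
  assumes "\<alpha> > -1"
  obtains M where "\<And>s. s \<ge> 1 \<Longrightarrow> \<bar>psi \<alpha> s\<bar> \<le> M" "\<And>s. s \<ge> 1 \<Longrightarrow> \<bar>dpsi \<alpha> s\<bar> \<le> M"
  by (rule perturbed_oscillator_bounded[of "psi \<alpha>" "dpsi \<alpha>" "\<alpha>\<^sup>2 - 1/4"])
    (use assms in \<open>auto intro!: has_real_derivative_psi has_real_derivative_dpsi\<close>)

section \<open>Majorants for \<open>psi\<close> and its derivative on the half-line\<close>

lemma continuous_bessel_entire: "\<alpha> > -1 \<Longrightarrow> continuous_on S (bessel_entire \<alpha>)"
  and continuous_bessel_entire1: "\<alpha> > -1 \<Longrightarrow> continuous_on S (bessel_entire1 \<alpha>)"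
  by (auto intro!: continuous_at_imp_continuous_on DERIV_isCont has_real_derivative_bessel_entire
      has_real_derivative_bessel_entire1)

text \<open>The derivative is weighted by s because its worst term is (\<alpha> + 1/2)/s times
  \<open>psi\<close>; with the weight it has the order of \<open>psi\<close> itself.\<close>

lemma psi_near_0:
  assumes "\<alpha> > -1"
  obtains M where "\<And>s. 0 < s \<Longrightarrow> s \<le> 1 \<Longrightarrow> \<bar>psi \<alpha> s\<bar> \<le> M * s powr (\<alpha> + 1/2)"
    "\<And>s. 0 < s \<Longrightarrow> s \<le> 1 \<Longrightarrow> \<bar>s * dpsi \<alpha> s\<bar> \<le> M * s powr (\<alpha> + 1/2)"
proof -
  have "bounded (bessel_entire \<alpha> ` {0..1})" "bounded (bessel_entire1 \<alpha> ` {0..1})"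
    using assms by (auto intro!: compact_imp_bounded compact_continuous_image continuous_bessel_entire continuous_bessel_entire1)
  then obtain M0 M1 where M0: "\<And>u. 0 \<le> u \<Longrightarrow> u \<le> 1 \<Longrightarrow> \<bar>bessel_entire \<alpha> u\<bar> \<le> M0"
    and M1: "\<And>u. 0 \<le> u \<Longrightarrow> u \<le> 1 \<Longrightarrow> \<bar>bessel_entire1 \<alpha> u\<bar> \<le> M1"
    unfolding bounded_iff by (metis atLeastAtMost_iff imageI real_norm_def)
  have M0p: "M0 \<ge> 0" "M1 \<ge> 0" using M0[of 0] M1[of 0] by auto
  define c :: real where "c = 2 powr (-\<alpha>)"
  have c: "c > 0" by (simp add: c_def)
  define M where "M = c * ((\<bar>\<alpha> + 1/2\<bar> + 1) * M0 + M1)"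
  show thesis
  proof (rule that[of M])
    fix s :: real assume s: "0 < s" "s \<le> 1"
    have u: "0 \<le> s\<^sup>2 / 4" "s\<^sup>2 / 4 \<le> 1" using s power_le_one[of s 2] by auto
    have "\<bar>psi \<alpha> s\<bar> = c * \<bar>bessel_entire \<alpha> (s\<^sup>2/4)\<bar> * s powr (\<alpha> + 1/2)"
      unfolding psi_def c_def by (simp add: abs_mult)
    also have "\<dots> \<le> M * s powr (\<alpha> + 1/2)"
    proof (rule mult_right_mono)
      have "\<bar>bessel_entire \<alpha> (s\<^sup>2/4)\<bar> \<le> 1 * M0" using M0[OF u] by simp
      also have "\<dots> \<le> (\<bar>\<alpha> + 1/2\<bar> + 1) * M0 + M1"
        using M0p by (intro order_trans[OF mult_right_mono[of 1 "\<bar>\<alpha> + 1/2\<bar> + 1"]]) auto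
      finally show "c * \<bar>bessel_entire \<alpha> (s\<^sup>2/4)\<bar> \<le> M"
        unfolding M_def using c by simp
    qed simp
    finally show "\<bar>psi \<alpha> s\<bar> \<le> M * s powr (\<alpha> + 1/2)" .
    have "s * dpsi \<alpha> s = c * ((\<alpha> + 1/2) * bessel_entire \<alpha> (s\<^sup>2 / 4) + s\<^sup>2 / 2 * bessel_entire1 \<alpha> (s\<^sup>2 / 4)) * s powr (\<alpha> + 1/2)"
      unfolding dpsi_def c_def using s by (simp add: field_simps power2_eq_square)
    then have "\<bar>s * dpsi \<alpha> s\<bar> = c * \<bar>(\<alpha> + 1/2) * bessel_entire \<alpha> (s\<^sup>2 / 4) + s\<^sup>2 / 2 * bessel_entire1 \<alpha> (s\<^sup>2 / 4)\<bar> * s powr (\<alpha> + 1/2)"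
      using c by (simp add: abs_mult)
    also have "\<dots> \<le> M * s powr (\<alpha> + 1/2)"
    proof (rule mult_right_mono)
      have "\<bar>(\<alpha> + 1/2) * bessel_entire \<alpha> (s\<^sup>2 / 4)\<bar> \<le> (\<bar>\<alpha> + 1/2\<bar> + 1) * M0"
        unfolding abs_mult by (intro mult_mono M0 u) auto
      moreover have "\<bar>s\<^sup>2 / 2 * bessel_entire1 \<alpha> (s\<^sup>2 / 4)\<bar> \<le> 1 * M1"
        unfolding abs_mult using u by (intro mult_mono M1 u) (use s power_le_one[of s 2] in auto)
      ultimately have "\<bar>(\<alpha> + 1/2) * bessel_entire \<alpha> (s\<^sup>2 / 4) + s\<^sup>2 / 2 * bessel_entire1 \<alpha> (s\<^sup>2 / 4)\<bar> \<le> (\<bar>\<alpha> + 1/2\<bar> + 1) * M0 + M1"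
        by linarith
      then show "c * \<bar>(\<alpha> + 1/2) * bessel_entire \<alpha> (s\<^sup>2 / 4) + s\<^sup>2 / 2 * bessel_entire1 \<alpha> (s\<^sup>2 / 4)\<bar> \<le> M"
        unfolding M_def using c by simp
    qed simp
    finally show "\<bar>s * dpsi \<alpha> s\<bar> \<le> M * s powr (\<alpha> + 1/2)" .
  qed
qed

text \<open>Near 0 \<open>psi\<close> is bounded for \<alpha> \<ge> -1/2 and may grow like
  s^(\<alpha>+1/2) otherwise; the minimum with 0 treats both cases at once. The same exponent is
  \<open>?b\<close> in the later majorants.\<close>

lemma psi_bound:
  assumes "\<alpha> > -1"
  obtains C where "C > 0"
    "\<And>s. s > 0 \<Longrightarrow> \<bar>psi \<alpha> s\<bar> \<le> C * (1 + s powr min (\<alpha> + 1/2) 0)"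
    "\<And>s. s > 0 \<Longrightarrow> \<bar>s * dpsi \<alpha> s\<bar> \<le> C * (s + s powr min (\<alpha> + 1/2) 0)"
proof -
  obtain M where M: "\<And>s. s \<ge> 1 \<Longrightarrow> \<bar>psi \<alpha> s\<bar> \<le> M" "\<And>s. s \<ge> 1 \<Longrightarrow> \<bar>dpsi \<alpha> s\<bar> \<le> M"
    using psi_bounded_at_top[OF assms] by blast
  obtain N where N: "\<And>s. 0 < s \<Longrightarrow> s \<le> 1 \<Longrightarrow> \<bar>psi \<alpha> s\<bar> \<le> N * s powr (\<alpha> + 1/2)"
    "\<And>s. 0 < s \<Longrightarrow> s \<le> 1 \<Longrightarrow> \<bar>s * dpsi \<alpha> s\<bar> \<le> N * s powr (\<alpha> + 1/2)"
    using psi_near_0[OF assms] by blast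
  have MN: "M \<ge> 0" "N \<ge> 0" using M(1)[of 1] N(1)[of 1] by auto
  let ?b = "min (\<alpha> + 1/2) 0"
  have small: "N * s powr (\<alpha> + 1/2) \<le> (M + N + 1) * s powr ?b" if "0 < s" "s \<le> 1" for s
    using MN that by (intro mult_mono powr_mono') auto
  show thesis
  proof (rule that[of "M + N + 1"])
    show "M + N + 1 > 0" using MN by simp
    fix s :: real assume s: "s > 0"
    show "\<bar>psi \<alpha> s\<bar> \<le> (M + N + 1) * (1 + s powr ?b)"
    proof (cases "s \<le> 1")
      case True
      have "0 \<le> (M + N + 1) * 1" using MN by simp
      with N(1)[OF s True] small[OF s True] show ?thesis unfolding distrib_left by linarith
    next
      case False
      have "\<bar>psi \<alpha> s\<bar> \<le> M * 1" using M(1)[of s] False by simp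
      also have "\<dots> \<le> (M + N + 1) * (1 + s powr ?b)" using MN by (intro mult_mono) auto
      finally show ?thesis .
    qed
    show "\<bar>s * dpsi \<alpha> s\<bar> \<le> (M + N + 1) * (s + s powr ?b)"
    proof (cases "s \<le> 1")
      case True
      have "0 \<le> (M + N + 1) * s" using MN s by simp
      with N(2)[OF s True] small[OF s True] show ?thesis unfolding distrib_left by linarith
    next
      case False
      have "\<bar>s * dpsi \<alpha> s\<bar> \<le> M * s" using M(2)[of s] False s by (simp add: abs_mult mult.commute)
      also have "\<dots> \<le> (M + N + 1) * (s + s powr ?b)" using MN s by (intro mult_mono) auto
      finally show ?thesis .
    qed
  qed
qed

lemma borel_measurable_psi [measurable]:
  assumes "\<alpha> > -1" shows "psi \<alpha> \<in> borel_measurable borel"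
proof -
  have [measurable]: "bessel_entire \<alpha> \<in> borel_measurable borel"
    using continuous_bessel_entire[OF assms, of UNIV] by (rule borel_measurable_continuous_onI)
  show ?thesis unfolding psi_def[abs_def] by measurable
qed

lemma borel_measurable_dpsi [measurable]:
  assumes "\<alpha> > -1" shows "dpsi \<alpha> \<in> borel_measurable borel"
proof -
  have [measurable]: "bessel_entire \<alpha> \<in> borel_measurable borel" "bessel_entire1 \<alpha> \<in> borel_measurable borel"
    using continuous_bessel_entire[OF assms, of UNIV] continuous_bessel_entire1[OF assms, of UNIV]
    by (auto intro: borel_measurable_continuous_onI)
  show ?thesis unfolding dpsi_def[abs_def] by measurable
qed

section \<open>The Riemann-Lebesgue lemma\<close>

text \<open>The free phase covers cosine and sine together: \<phi> = -pi/2 gives the sine.\<close>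

definition riemann_lebesgue :: "(real \<Rightarrow> real) \<Rightarrow> bool" where
  "riemann_lebesgue h \<longleftrightarrow>
     (\<forall>\<phi>. ((\<lambda>R. LINT w|lborel. h w * cos (R * w + \<phi>)) \<longlongrightarrow> 0) at_top)"

lemma integrable_mult_cos:
  fixes h :: "real \<Rightarrow> real"
  assumes "integrable lborel h"
  shows "integrable lborel (\<lambda>w. h w * cos (R * w + \<phi>))"
proof (rule Bochner_Integration.integrable_bound[OF assms])
  show "AE x in lborel. norm (h x * cos (R * x + \<phi>)) \<le> norm (h x)"
    by (auto simp: abs_mult intro!: mult_left_le)
qed (use assms in measurable)

text \<open>Since |cos| \<le> 1, replacing h by g changes the integral by at most their L1 distance,
  uniformly in R. The property therefore passes to L1 limits.\<close>

lemma riemann_lebesgue_approx: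
  assumes h: "integrable lborel h"
    and approx: "\<And>e. e > 0 \<Longrightarrow> \<exists>g. integrable lborel g \<and> (LINT w|lborel. \<bar>h w - g w\<bar>) \<le> e \<and> riemann_lebesgue g"
  shows "riemann_lebesgue h"
  unfolding riemann_lebesgue_def
proof
  fix \<phi>
  show "((\<lambda>R. LINT w|lborel. h w * cos (R * w + \<phi>)) \<longlongrightarrow> 0) at_top"
  proof (rule tendstoI)
    fix e :: real assume "e > 0"
    then obtain g where g: "integrable lborel g" "(LINT w|lborel. \<bar>h w - g w\<bar>) \<le> e / 2" "riemann_lebesgue g"
      using approx[of "e / 2"] by auto
    have "\<forall>\<^sub>F R in at_top. dist (LINT w|lborel. g w * cos (R * w + \<phi>)) 0 < e / 2"
      using g(3) \<open>e > 0\<close> unfolding riemann_lebesgue_def by (intro tendstoD) auto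
    then show "\<forall>\<^sub>F R in at_top. dist (LINT w|lborel. h w * cos (R * w + \<phi>)) 0 < e"
    proof eventually_elim
      case (elim R)
      have "\<bar>(LINT w|lborel. h w * cos (R * w + \<phi>)) - (LINT w|lborel. g w * cos (R * w + \<phi>))\<bar>
        = \<bar>LINT w|lborel. h w * cos (R * w + \<phi>) - g w * cos (R * w + \<phi>)\<bar>"
        by (simp add: integrable_mult_cos h g(1))
      also have "\<dots> \<le> (LINT w|lborel. \<bar>h w * cos (R * w + \<phi>) - g w * cos (R * w + \<phi>)\<bar>)"
        by (rule integral_abs_bound)
      also have "\<dots> \<le> (LINT w|lborel. \<bar>h w - g w\<bar>)"
      proof (rule integral_mono)
        fix w
        have "\<bar>h w * cos (R * w + \<phi>) - g w * cos (R * w + \<phi>)\<bar> = \<bar>h w - g w\<bar> * \<bar>cos (R * w + \<phi>)\<bar>"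
          by (simp add: abs_mult[symmetric] left_diff_distrib)
        also have "\<dots> \<le> \<bar>h w - g w\<bar>"
          by (intro mult_left_le) auto
        finally show "\<bar>h w * cos (R * w + \<phi>) - g w * cos (R * w + \<phi>)\<bar> \<le> \<bar>h w - g w\<bar>" .
      qed (intro integrable_abs Bochner_Integration.integrable_diff integrable_mult_cos h g(1))+
      finally show ?case using elim g(2) by simp
    qed
  qed
qed

lemma riemann_lebesgue_add:
  assumes "integrable lborel f" "integrable lborel g" "riemann_lebesgue f" "riemann_lebesgue g"
  shows "riemann_lebesgue (\<lambda>w. f w + g w)"
  unfolding riemann_lebesgue_def
proof
  fix \<phi>
  have "((\<lambda>R. (LINT w|lborel. f w * cos (R * w + \<phi>)) + (LINT w|lborel. g w * cos (R * w + \<phi>))) \<longlongrightarrow> 0 + 0) at_top"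
    using assms(3,4) unfolding riemann_lebesgue_def by (intro tendsto_add) auto
  then show "((\<lambda>R. LINT w|lborel. (f w + g w) * cos (R * w + \<phi>)) \<longlongrightarrow> 0) at_top"
    by (simp add: distrib_right integrable_mult_cos assms(1,2))
qed

lemma riemann_lebesgue_cmult:
  assumes "riemann_lebesgue f"
  shows "riemann_lebesgue (\<lambda>w. c * f w)"
  unfolding riemann_lebesgue_def
proof
  fix \<phi>
  have "((\<lambda>R. c * (LINT w|lborel. f w * cos (R * w + \<phi>))) \<longlongrightarrow> c * 0) at_top"
    using assms unfolding riemann_lebesgue_def by (intro tendsto_mult tendsto_const) auto
  then show "((\<lambda>R. LINT w|lborel. (c * f w) * cos (R * w + \<phi>)) \<longlongrightarrow> 0) at_top"
    by (simp add: mult.assoc)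
qed

lemma riemann_lebesgue_Icc:
  "riemann_lebesgue (indicator {a..b})"
proof (cases "a \<le> b")
  case True
  show ?thesis unfolding riemann_lebesgue_def
  proof
    fix \<phi>
    show "((\<lambda>R. LINT w|lborel. indicator {a..b} w * cos (R * w + \<phi>)) \<longlongrightarrow> 0) at_top"
    proof (rule Lim_null_comparison)
      show "((\<lambda>R. 2 / R) \<longlongrightarrow> 0) (at_top :: real filter)"
        by (intro tendsto_divide_0[OF tendsto_const] filterlim_at_top_imp_at_infinity filterlim_ident)
      show "\<forall>\<^sub>F R in at_top. norm (LINT w|lborel. indicator {a..b} w * cos (R * w + \<phi>)) \<le> 2 / R"
        using eventually_gt_at_top[of 0]
      proof eventually_elim
        case (elim R)
        have "(LINT w|lborel. indicator {a..b} w *\<^sub>R cos (R * w + \<phi>)) = sin (R * b + \<phi>) / R - sin (R * a + \<phi>) / R"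
        proof (rule integral_FTC_atLeastAtMost[OF True])
          fix x
          show "((\<lambda>x. sin (R * x + \<phi>) / R) has_vector_derivative cos (R * x + \<phi>)) (at x within {a..b})"
            unfolding has_real_derivative_iff_has_vector_derivative[symmetric] using elim
            by (auto intro!: derivative_eq_intros)
        qed (intro continuous_intros)
        also have "\<dots> = (sin (R * b + \<phi>) - sin (R * a + \<phi>)) / R" by (simp add: diff_divide_distrib)
        also have "\<bar>\<dots>\<bar> \<le> 2 / R"
          using elim abs_sin_le_one[of "R * b + \<phi>"] abs_sin_le_one[of "R * a + \<phi>"]
          by (simp add: abs_divide, intro divide_right_mono) linarith+
        finally show ?case by simp
      qed
    qed
  qed
qed (simp add: riemann_lebesgue_def)

text \<open>Dynkin's argument on half-lines. Intersecting with a fixed bounded interval keeps all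
  indicators integrable, so that complements become differences; a countable disjoint union is an L1
  limit of finite sums by dominated convergence.\<close>

lemma riemann_lebesgue_bounded_set:
  assumes "A \<in> sets borel"
  shows "riemann_lebesgue (indicator (A \<inter> {-N..N}))"
proof -
  let ?I = "{-N..N::real}"
  have int: "integrable lborel (indicator (B \<inter> ?I) :: real \<Rightarrow> real)" if "B \<in> sets borel" for B
  proof (rule integrable_real_indicator)
    have "emeasure lborel (B \<inter> ?I) \<le> emeasure lborel ?I" by (intro emeasure_mono) auto
    also have "\<dots> < \<infinity>" by (simp add: emeasure_lborel_Icc_eq)
    finally show "emeasure lborel (B \<inter> ?I) < \<infinity>" .
  qed (use that in auto)
  have sb: "sets borel = sigma_sets UNIV (range (atMost :: real \<Rightarrow> real set))"
    by (subst borel_eq_atMost) auto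
  have "Int_stable (range (atMost :: real \<Rightarrow> real set))"
    "range (atMost :: real \<Rightarrow> real set) \<subseteq> Pow UNIV"
    "A \<in> sigma_sets UNIV (range (atMost :: real \<Rightarrow> real set))"
    using assms sb by (auto simp: Int_stable_def)
  then show ?thesis
  proof (induct rule: sigma_sets_induct_disjoint)
    case (basic A)
    then obtain a where "A = {..a}" by auto
    then have "A \<inter> ?I = {-N..min a N}" by auto
    then show ?case by (simp add: riemann_lebesgue_Icc)
  next
    case empty
    then show ?case by (simp add: riemann_lebesgue_def)
  next
    case (compl A)
    then have A: "A \<in> sets borel" using sb by simp
    have "indicator ((UNIV - A) \<inter> ?I) = (\<lambda>w. indicator (UNIV \<inter> ?I) w + (- 1) * (indicator (A \<inter> ?I) w :: real))"
      by (auto simp: fun_eq_iff indicator_def)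
    moreover have "riemann_lebesgue \<dots>"
      using compl(2) riemann_lebesgue_Icc[of "-N" N]
      by (intro riemann_lebesgue_add riemann_lebesgue_cmult int A integrable_mult_right) auto
    ultimately show ?case by simp
  next
    case (union A)
    then have A: "A i \<in> sets borel" for i using sb by auto
    define g :: "nat \<Rightarrow> real \<Rightarrow> real" where "g n = (\<lambda>w. \<Sum>i<n. indicator (A i \<inter> ?I) w)" for n
    have g_int: "integrable lborel (g n)" for n
      unfolding g_def by (intro Bochner_Integration.integrable_sum int A)
    have g_rl: "riemann_lebesgue (g n)" for n
    proof (induct n)
      case 0 then show ?case by (simp add: g_def riemann_lebesgue_def)
    next
      case (Suc n)
      have "g (Suc n) = (\<lambda>w. g n w + indicator (A n \<inter> ?I) w)" by (simp add: g_def)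
      moreover have "riemann_lebesgue \<dots>" by (intro riemann_lebesgue_add g_int int A Suc union(3))
      ultimately show ?case by simp
    qed
    have g_eq: "g n w = indicator ((\<Union>i<n. A i) \<inter> ?I) w" for n w
    proof (induct n)
      case (Suc n)
      have "A n \<inter> A i = {}" if "i < n" for i
        by (rule disjoint_family_onD[OF union(1)]) (use that in auto)
      then have "A n \<inter> (\<Union>i<n. A i) = {}" by blast
      then have "indicator ((\<Union>i<Suc n. A i) \<inter> ?I) w = indicator ((\<Union>i<n. A i) \<inter> ?I) w + (indicator (A n \<inter> ?I) w :: real)"
        by (auto simp: lessThan_Suc indicator_def)
      then show ?case using Suc by (simp add: g_def)
    qed (simp add: g_def)
    let ?h = "indicator (\<Union> (range A) \<inter> ?I) :: real \<Rightarrow> real"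
    have h_int: "integrable lborel ?h" using A by (intro int) auto
    have conv: "(\<lambda>n. LINT w|lborel. \<bar>?h w - g n w\<bar>) \<longlonglongrightarrow> integral\<^sup>L lborel (\<lambda>w::real. 0)"
    proof (rule integral_dominated_convergence[where w = "indicator (UNIV \<inter> ?I)"])
      show "integrable lborel (indicator (UNIV \<inter> ?I) :: real \<Rightarrow> real)" by (rule int) auto
      show "AE x in lborel. norm \<bar>?h x - g n x\<bar> \<le> indicator (UNIV \<inter> ?I) x" for n
        unfolding g_eq by (auto simp: indicator_def)
      show "AE x in lborel. (\<lambda>n. \<bar>?h x - g n x\<bar>) \<longlonglongrightarrow> 0"
      proof (rule AE_I2)
        fix x
        have "\<forall>\<^sub>F n in sequentially. \<bar>?h x - g n x\<bar> = 0"
        proof (cases "x \<in> \<Union> (range A)")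
          case True
          then obtain j where j: "x \<in> A j" by auto
          show ?thesis using eventually_gt_at_top[of j]
            by eventually_elim (use j in \<open>auto simp: g_eq indicator_def\<close>)
        qed (auto simp: g_eq indicator_def)
        then show "(\<lambda>n. \<bar>?h x - g n x\<bar>) \<longlonglongrightarrow> 0"
          by (rule tendsto_eventually)
      qed
    qed (use h_int g_int in measurable)
    show ?case
    proof (rule riemann_lebesgue_approx[OF h_int])
      fix e :: real assume "e > 0"
      then have "\<forall>\<^sub>F n in sequentially. (LINT w|lborel. \<bar>?h w - g n w\<bar>) < e"
        using conv by (intro order_tendstoD(2)) auto
      then obtain n where "(LINT w|lborel. \<bar>?h w - g n w\<bar>) < e"
        by (auto simp: eventually_sequentially)
      then show "\<exists>g. integrable lborel g \<and> (LINT w|lborel. \<bar>?h w - g w\<bar>) \<le> e \<and> riemann_lebesgue g"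
        using g_int g_rl by (intro exI[of _ "g n"]) auto
    qed
  qed
qed

lemma riemann_lebesgue_set:
  assumes "A \<in> sets lborel" "emeasure lborel A < \<infinity>"
  shows "riemann_lebesgue (indicator A)"
proof -
  let ?g = "\<lambda>n::nat. indicator (A \<inter> {-real n..real n}) :: real \<Rightarrow> real"
  have h_int: "integrable lborel (indicator A :: real \<Rightarrow> real)" using assms by (intro integrable_real_indicator) auto
  have g_int: "integrable lborel (?g n)" for n
    by (rule Bochner_Integration.integrable_bound[OF h_int]) (use assms in \<open>auto simp: indicator_def\<close>)
  have conv: "(\<lambda>n. LINT w|lborel. \<bar>indicator A w - ?g n w\<bar>) \<longlonglongrightarrow> integral\<^sup>L lborel (\<lambda>w::real. 0)"
  proof (rule integral_dominated_convergence[where w = "indicator A"])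
    show "AE x in lborel. norm \<bar>indicator A x - ?g n x\<bar> \<le> indicator A x" for n
      by (auto simp: indicator_def)
    show "AE x in lborel. (\<lambda>n. \<bar>indicator A x - ?g n x\<bar>) \<longlonglongrightarrow> 0"
    proof (rule AE_I2)
      fix x :: real
      obtain N :: nat where N: "\<bar>x\<bar> \<le> real N" using real_arch_simple by blast
      have "\<forall>\<^sub>F n in sequentially. \<bar>indicator A x - ?g n x\<bar> = 0"
        using eventually_ge_at_top[of N]
        by eventually_elim (use N in \<open>auto simp: indicator_def\<close>)
      then show "(\<lambda>n. \<bar>indicator A x - ?g n x\<bar>) \<longlonglongrightarrow> 0"
        by (rule tendsto_eventually)
    qed
  qed (use h_int g_int in measurable)
  show ?thesis
  proof (rule riemann_lebesgue_approx[OF h_int])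
    fix e :: real assume "e > 0"
    then have "\<forall>\<^sub>F n in sequentially. (LINT w|lborel. \<bar>indicator A w - ?g n w\<bar>) < e"
      using conv by (intro order_tendstoD(2)) auto
    then obtain n where "(LINT w|lborel. \<bar>indicator A w - ?g n w\<bar>) < e"
      by (auto simp: eventually_sequentially)
    then show "\<exists>g. integrable lborel g \<and> (LINT w|lborel. \<bar>indicator A w - g w\<bar>) \<le> e \<and> riemann_lebesgue g"
      using g_int riemann_lebesgue_bounded_set[of A "real n"] assms by (intro exI[of _ "?g n"]) auto
  qed
qed

lemma riemann_lebesgue_lemma:
  assumes "integrable lborel h"
  shows "riemann_lebesgue h"
  using assms
proof (induct rule: integrable_induct)
  case (base A c)
  then show ?case
    using riemann_lebesgue_cmult[OF riemann_lebesgue_set, of A c] by (simp add: mult.commute)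
next
  case (add f g)
  then show ?case by (intro riemann_lebesgue_add)
next
  case (lim f s)
  have conv: "(\<lambda>n. LINT w|lborel. \<bar>f w - s n w\<bar>) \<longlonglongrightarrow> integral\<^sup>L lborel (\<lambda>w::real. 0)"
  \<comment> \<open>The simple approximations satisfy |s n| \<le> 2 |f|, whence the factor 3 for the
    difference.\<close>
  proof (rule integral_dominated_convergence[where w = "\<lambda>w. 3 * \<bar>f w\<bar>"])
    show "AE x in lborel. norm \<bar>f x - s n x\<bar> \<le> 3 * \<bar>f x\<bar>" for n
    proof (rule AE_I2)
      fix x :: real
      show "norm \<bar>f x - s n x\<bar> \<le> 3 * \<bar>f x\<bar>"
        using lim(4)[of x n] abs_triangle_ineq4[of "f x" "s n x"] by simp
    qed
    show "AE x in lborel. (\<lambda>n. \<bar>f x - s n x\<bar>) \<longlonglongrightarrow> 0"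
    proof (rule AE_I2)
      fix x :: real
      have "(\<lambda>n. \<bar>f x - s n x\<bar>) \<longlonglongrightarrow> \<bar>f x - f x\<bar>"
        by (intro tendsto_intros lim(3)) auto
      then show "(\<lambda>n. \<bar>f x - s n x\<bar>) \<longlonglongrightarrow> 0" by simp
    qed
    show "integrable lborel (\<lambda>w. 3 * \<bar>f w\<bar>)" using lim(5) by simp
  qed (use lim in measurable)
  show ?case
  proof (rule riemann_lebesgue_approx)
    show "integrable lborel f" by fact
    fix e :: real assume "e > 0"
    then have "\<forall>\<^sub>F n in sequentially. (LINT w|lborel. \<bar>f w - s n w\<bar>) < e"
      using conv by (intro order_tendstoD(2)) auto
    then obtain n where "(LINT w|lborel. \<bar>f w - s n w\<bar>) < e"
      by (auto simp: eventually_sequentially)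
    then show "\<exists>g. integrable lborel g \<and> (LINT w|lborel. \<bar>f w - g w\<bar>) \<le> e \<and> riemann_lebesgue g"
      using lim by (intro exI[of _ "s n"]) auto
  qed
qed

section \<open>Hankel inversion\<close>

lemma set_integrable_lebesgue_iff_lborel:
  fixes f :: "real \<Rightarrow> real"
  assumes "f \<in> borel_measurable borel" "S \<in> sets borel"
  shows "set_integrable lebesgue S f \<longleftrightarrow> set_integrable lborel S f"
  unfolding set_integrable_def using assms by (subst integrable_completion) auto

text \<open>Nonnegativity upgrades gauge integrability to absolute integrability. This is the bridge
  by which gauge integrals of powers and of Euler's Gamma integrand become Lebesgue
  integrals.\<close>

lemma has_integral_nonneg_lborel:
  fixes f :: "real \<Rightarrow> real"
  assumes "(f has_integral I) S" "\<And>x. x \<in> S \<Longrightarrow> f x \<ge> 0"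
    and "f \<in> borel_measurable borel" "S \<in> sets borel"
  shows "set_integrable lborel S f" "(LBINT x:S. f x) = I"
proof -
  have "f absolutely_integrable_on S"
    using assms(1,2) by (intro nonnegative_absolutely_integrable_1) auto
  then show *: "set_integrable lborel S f"
    using set_integrable_lebesgue_iff_lborel[OF assms(3,4)] by simp
  show "(LBINT x:S. f x) = I"
    using set_borel_integral_eq_integral(2)[OF *] assms(1) by (simp add: integral_unique)
qed

lemma set_integrable_powr_Ioc:
  fixes c R :: real
  assumes "c > -1"
  shows "set_integrable lborel {0<..R} (\<lambda>y. y powr c)"
proof (cases "R \<ge> 0")
  case True
  then show ?thesis
    using integrable_on_powr_from_0'[OF assms True]
    by (intro has_integral_nonneg_lborel(1)[OF integrable_integral]) auto
qed (simp add: set_integrable_def)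

section \<open>Gaussian moments and the Hankel transform of the Gaussian\<close>

text \<open>Euler's integral for Gamma x under the substitution v = w^2 / 2, which maps the
  half-line onto itself with derivative w.\<close>

lemma gaussian_moment:
  fixes x :: real
  assumes "x > 0"
  shows "set_integrable lborel {0<..} (\<lambda>w. w powr (2 * x - 1) * exp (- w\<^sup>2 / 2))"
    and "(LBINT w:{0<..}. w powr (2 * x - 1) * exp (- w\<^sup>2 / 2)) = 2 powr (x - 1) * Gamma x"
proof -
  let ?f = "\<lambda>v::real. v powr (x - 1) / exp v" and ?g = "\<lambda>w::real. w\<^sup>2 / 2"
  have im: "?g ` {0<..} = {0<..}"
  proof (intro equalityI subsetI)
    fix v :: real assume "v \<in> {0<..}"
    then have "v = ?g (sqrt (2 * v))" "sqrt (2 * v) \<in> {0<..}" by auto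
    then show "v \<in> ?g ` {0<..}" by (rule image_eqI)
  qed auto
  have "(?f has_integral Gamma x) {0..}" by (rule Gamma_integral_real[OF assms])
  then have "((\<lambda>t. if t \<in> {0<..} then ?f t else 0) has_integral Gamma x) {0..}"
    by (rule has_integral_spike [of "{0}", rotated 2]) auto
  then have f: "(?f has_integral Gamma x) {0<..}"
    by (subst (asm) has_integral_restrict) auto
  have fa: "?f absolutely_integrable_on {0<..}"
    using f by (intro nonnegative_absolutely_integrable_1) auto
  have "?f absolutely_integrable_on (?g ` {0<..}) \<and> integral (?g ` {0<..}) ?f = Gamma x"
    unfolding im using fa f by (auto simp: integral_unique)
  then have 1: "(\<lambda>w. \<bar>w\<bar> * ?f (?g w)) absolutely_integrable_on {0<..}"
    and 2: "integral {0<..} (\<lambda>w. \<bar>w\<bar> * ?f (?g w)) = Gamma x"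
    by (subst (asm) has_absolute_integral_change_of_variables_1'[symmetric, where g' = "\<lambda>w. w"],
        auto intro!: derivative_eq_intros inj_onI)+
  have eq: "\<bar>w\<bar> * ?f (?g w) = 2 powr (1 - x) * (w powr (2 * x - 1) * exp (- w\<^sup>2 / 2))" if "w \<in> {0<..}" for w :: real
  proof -
    have w: "w > 0" using that by simp
    have "(w\<^sup>2) powr (x - 1) = w powr (2 * x - 2)"
      using powr_powr[of w 2 "x - 1"] w by (simp add: right_diff_distrib)
    also have "\<dots> = w powr (2 * x - 1) / w"
      using w powr_diff[of w "2 * x - 1" 1] by simp
    finally have 1: "(w\<^sup>2) powr (x - 1) = w powr (2 * x - 1) / w" .
    have "2 powr (1 - x) = 1 / (2 powr (x - 1) :: real)"
      using powr_minus_divide[of "2::real" "x - 1"] by (simp only: minus_diff_eq)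
    then have "(w\<^sup>2 / 2) powr (x - 1) = w powr (2 * x - 1) / w * 2 powr (1 - x)"
      unfolding 1[symmetric] by (subst powr_divide) auto
    then show ?thesis using w by (simp add: exp_minus field_simps)
  qed
  have 3: "(\<lambda>w. 2 powr (1 - x) * (w powr (2 * x - 1) * exp (- w\<^sup>2 / 2))) absolutely_integrable_on {0<..}"
    using set_integrable_cong[OF refl refl eq, THEN iffD1, OF _ 1] by simp
  have 4: "((\<lambda>w. 2 powr (1 - x) * (w powr (2 * x - 1) * exp (- w\<^sup>2 / 2))) has_integral Gamma x) {0<..}"
  proof (rule has_integral_eq[OF eq])
    show "((\<lambda>w. \<bar>w\<bar> * ?f (?g w)) has_integral Gamma x) {0<..}"
      using set_lebesgue_integral_eq_integral(1)[OF 1] 2 by (simp add: has_integral_integrable_integral)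
  qed
  have "((\<lambda>w. 2 powr (x - 1) * (2 powr (1 - x) * (w powr (2 * x - 1) * exp (- w\<^sup>2 / 2)))) has_integral 2 powr (x - 1) * Gamma x) {0<..}"
    by (intro has_integral_mult_right 4)
  moreover have "(2::real) powr (x - 1) * (2 powr (1 - x) * t) = t" for t
    by (simp add: powr_add[symmetric] mult.assoc[symmetric])
  ultimately have 5: "((\<lambda>w. w powr (2 * x - 1) * exp (- w\<^sup>2 / 2)) has_integral 2 powr (x - 1) * Gamma x) {0<..}"
    by simp
  show "set_integrable lborel {0<..} (\<lambda>w. w powr (2 * x - 1) * exp (- w\<^sup>2 / 2))"
    and "(LBINT w:{0<..}. w powr (2 * x - 1) * exp (- w\<^sup>2 / 2)) = 2 powr (x - 1) * Gamma x"
    by (rule has_integral_nonneg_lborel[OF 5]; simp)+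
qed

lemma summable_norm_bessel_coeff:
  assumes "\<nu> > -1"
  shows "summable (\<lambda>k. norm (bessel_coeff \<nu> k * u ^ k))"
  using powser_insidea[OF summable_bessel_coeff[OF assms, of "\<bar>u\<bar> + 1"], of u] by simp

text \<open>The Gaussian is its own Hankel transform; this test function replaces any knowledge of the
  amplitude and phase of \<open>psi\<close> at infinity in the inversion theorem.\<close>
lemma psi_gaussian:
  assumes "\<alpha> > -1" "y > 0"
  shows "set_integrable lborel {0<..} (\<lambda>w. w powr (\<alpha> + 1/2) * exp (- w\<^sup>2 / 2) * psi \<alpha> (y * w))"
    and "(LBINT w:{0<..}. w powr (\<alpha> + 1/2) * exp (- w\<^sup>2 / 2) * psi \<alpha> (y * w))
      = y powr (\<alpha> + 1/2) * exp (- y\<^sup>2 / 2)"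
proof -
  let ?a = "\<alpha> + 1/2"
  \<comment> \<open>One factor w^(\<alpha>+1/2) comes from the Gaussian, the other together with
    w^(2k) from the k-th term of \<open>psi\<close>; the total exponent 2\<alpha> + 1 + 2k is that
    of a Gaussian moment with parameter \<alpha> + 1 + k.\<close>
  define m where "m k w = w powr (2 * (\<alpha> + 1 + real k) - 1) * exp (- w\<^sup>2 / 2)" for k and w :: real
  define c where "c k = 2 powr (-\<alpha>) * y powr ?a * (bessel_coeff \<alpha> k * (y\<^sup>2 / 4) ^ k)" for k
  define f where "f k w = indicator {0<..} w *\<^sub>R (c k * m k w)" for k w
  have m_int: "set_integrable lborel {0<..} (m k)"
    and m_val: "(LBINT w:{0<..}. m k w) = 2 powr (\<alpha> + real k) * Gamma (\<alpha> + 1 + real k)" for k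
    unfolding m_def using gaussian_moment[of "\<alpha> + 1 + real k"] assms(1) by (simp_all add: algebra_simps)
  have f_int: "integrable lborel (f k)" for k
    unfolding f_def using set_integrable_mult_right[OF m_int[of k], of "c k"]
    by (simp add: set_integrable_def)
  \<comment> \<open>The Gamma value of the moment cancels the \<open>rGamma\<close> of the
    coefficient. Up to y^(\<alpha>+1/2) the terms are those of the exponential series at -y^2/2 and
    their norms those at y^2/2, which also justifies summing under the integral.\<close>
  have f_val: "integral\<^sup>L lborel (f k) = y powr ?a * ((- y\<^sup>2 / 2) ^ k /\<^sub>R fact k)"
    and nf_val: "(LINT w|lborel. norm (f k w)) = y powr ?a * ((y\<^sup>2 / 2) ^ k /\<^sub>R fact k)" for k
  proof -
    have G: "Gamma (\<alpha> + 1 + real k) > 0" using assms(1) by (intro Gamma_real_pos) simp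
    have cc: "rGamma (real k + \<alpha> + 1) * Gamma (\<alpha> + 1 + real k) = 1"
      using G by (simp add: rGamma_inverse_Gamma add_ac)
    have pw: "2 powr (-\<alpha>) * 2 powr (\<alpha> + real k) = (2::real) ^ k"
      by (simp add: powr_add[symmetric] powr_realpow)
    have "(LBINT w:{0<..}. c k * m k w) = c k * (2 powr (\<alpha> + real k) * Gamma (\<alpha> + 1 + real k))"
      by (simp add: m_val)
    also have "\<dots> = y powr ?a * ((- 1) ^ k * (2 powr (-\<alpha>) * 2 powr (\<alpha> + real k)) * (y\<^sup>2 / 4) ^ k
       * (rGamma (real k + \<alpha> + 1) * Gamma (\<alpha> + 1 + real k)) / fact k)"
      unfolding c_def bessel_coeff_def by (simp add: field_simps)
    also have "\<dots> = y powr ?a * ((- 1) ^ k * 2 ^ k * (y\<^sup>2 / 4) ^ k / fact k)"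
      unfolding cc pw by simp
    also have "(- 1) ^ k * 2 ^ k * (y\<^sup>2 / 4) ^ k = (- y\<^sup>2 / 2) ^ k"
      by (simp add: power_mult_distrib[symmetric])
    finally have v: "(LBINT w:{0<..}. c k * m k w) = y powr ?a * ((- y\<^sup>2 / 2) ^ k / fact k)" .
    then show "integral\<^sup>L lborel (f k) = y powr ?a * ((- y\<^sup>2 / 2) ^ k /\<^sub>R fact k)"
      unfolding f_def set_lebesgue_integral_def by (simp add: field_simps)
    have "(- y\<^sup>2 / 2) ^ k = (- 1) ^ k * (y\<^sup>2 / 2) ^ k"
      by (simp add: power_mult_distrib[symmetric])
    with v have v': "\<bar>LBINT w:{0<..}. c k * m k w\<bar> = y powr ?a * ((y\<^sup>2 / 2) ^ k / fact k)"
      by (simp add: abs_mult)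
    have mnn: "m k w \<ge> 0" for w unfolding m_def by simp
    have "(LINT w|lborel. norm (f k w)) = (LBINT w:{0<..}. \<bar>c k\<bar> * m k w)"
      unfolding f_def set_lebesgue_integral_def
      by (intro Bochner_Integration.integral_cong) (auto simp: abs_mult mnn indicator_def)
    also have "\<dots> = \<bar>LBINT w:{0<..}. c k * m k w\<bar>"
      using Gamma_real_pos[of "\<alpha> + 1 + real k"] assms(1) by (simp add: abs_mult m_val)
    finally show "(LINT w|lborel. norm (f k w)) = y powr ?a * ((y\<^sup>2 / 2) ^ k /\<^sub>R fact k)"
      unfolding v' by (simp add: field_simps)
  qed
  have f_sums: "(\<lambda>k. f k w) sums (indicator {0<..} w *\<^sub>R (w powr ?a * exp (- w\<^sup>2 / 2) * psi \<alpha> (y * w)))"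
    and f_abs: "summable (\<lambda>k. norm (f k w))" for w
  proof -
    have "summable (\<lambda>k. norm (f k w)) \<and> (\<lambda>k. f k w) sums (indicator {0<..} w *\<^sub>R (w powr ?a * exp (- w\<^sup>2 / 2) * psi \<alpha> (y * w)))"
    proof (cases "w > 0")
      case True
      define K where "K = 2 powr (-\<alpha>) * (y * w) powr ?a * w powr ?a * exp (- w\<^sup>2 / 2)"
      have fk: "f k w = K * (bessel_coeff \<alpha> k * ((y * w)\<^sup>2 / 4) ^ k)" for k
      proof -
        have "w powr (2 * (\<alpha> + 1 + real k) - 1) = w powr (?a + ?a + real (2 * k))"
          by (simp add: algebra_simps)
        also have "\<dots> = w powr ?a * w powr ?a * (w\<^sup>2) ^ k"
          using True by (simp only: powr_add powr_realpow power_mult)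
        finally have "m k w = w powr ?a * w powr ?a * (w\<^sup>2) ^ k * exp (- w\<^sup>2 / 2)"
          unfolding m_def by simp
        moreover have "(y\<^sup>2 / 4) ^ k * (w\<^sup>2) ^ k = ((y * w)\<^sup>2 / 4) ^ k"
          by (simp add: power_mult_distrib power_divide)
        moreover have "(y * w) powr ?a = y powr ?a * w powr ?a"
          using True assms(2) by (simp add: powr_mult)
        ultimately show ?thesis
          using True unfolding f_def c_def K_def by (simp add: mult_ac)
      qed
      have "(\<lambda>k. K * (bessel_coeff \<alpha> k * ((y * w)\<^sup>2 / 4) ^ k)) sums (K * bessel_entire \<alpha> ((y * w)\<^sup>2 / 4))"
        unfolding bessel_entire_def by (intro sums_mult summable_sums summable_bessel_coeff assms)
      moreover have "summable (\<lambda>k. \<bar>K\<bar> * norm (bessel_coeff \<alpha> k * ((y * w)\<^sup>2 / 4) ^ k))"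
        by (intro summable_mult summable_norm_bessel_coeff assms)
      ultimately show ?thesis
        unfolding fk K_def psi_def using True by (simp add: mult_ac abs_mult)
    qed (simp add: f_def)
    then show "(\<lambda>k. f k w) sums (indicator {0<..} w *\<^sub>R (w powr ?a * exp (- w\<^sup>2 / 2) * psi \<alpha> (y * w)))"
      "summable (\<lambda>k. norm (f k w))" by auto
  qed
  have eq: "(\<lambda>w. \<Sum>k. f k w) = (\<lambda>w. indicator {0<..} w *\<^sub>R (w powr ?a * exp (- w\<^sup>2 / 2) * psi \<alpha> (y * w)))"
    by (rule ext) (rule sums_unique[OF f_sums, symmetric])
  have sm: "summable (\<lambda>k. LINT w|lborel. norm (f k w))"
    unfolding nf_val by (intro summable_mult summable_exp_generic)
  have ab: "AE w in lborel. summable (\<lambda>k. norm (f k w))"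
    by (intro AE_I2 f_abs)
  show "set_integrable lborel {0<..} (\<lambda>w. w powr (\<alpha> + 1/2) * exp (- w\<^sup>2 / 2) * psi \<alpha> (y * w))"
    unfolding set_integrable_def eq[symmetric] by (rule integrable_suminf[OF f_int ab sm])
  have "(\<lambda>k. integral\<^sup>L lborel (f k)) sums (LINT w|lborel. (\<Sum>k. f k w))"
    by (rule sums_integral[OF f_int ab sm])
  moreover have "(\<lambda>k. integral\<^sup>L lborel (f k)) sums (y powr ?a * exp (- y\<^sup>2 / 2))"
    unfolding f_val by (intro sums_mult exp_converges)
  ultimately show "(LBINT w:{0<..}. w powr (\<alpha> + 1/2) * exp (- w\<^sup>2 / 2) * psi \<alpha> (y * w))
      = y powr (\<alpha> + 1/2) * exp (- y\<^sup>2 / 2)"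
    unfolding set_lebesgue_integral_def eq by (rule sums_unique2)
qed

text \<open>Separates the two variables of the weight, so that dominating functions on the product
  space factorise.\<close>

lemma one_plus_powr_mult_le:
  fixes y w b :: real
  assumes "y > 0" "w > 0"
  shows "1 + (y * w) powr b \<le> (1 + y powr b) * (1 + w powr b)"
  using assms by (simp add: powr_mult algebra_simps)

text \<open>The worst term of the square is y^(2b) with 2b > -1. For b = min (\<alpha> + 1/2) 0 the
  condition holds because \<alpha> > -1.\<close>

lemma set_integrable_one_plus_powr_square:
  fixes b R :: real
  assumes "b > -1/2"
  shows "set_integrable lborel {0<..R} (\<lambda>y. (1 + y powr b)\<^sup>2)"
proof -
  have "set_integrable lborel {0<..R} (\<lambda>y. y powr 0 + (2 * y powr b + y powr (2 * b)))"
    using assms by (intro set_integral_add set_integrable_mult_right set_integrable_powr_Ioc) auto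
  then show ?thesis
    by (rule set_integrable_cong[THEN iffD1, rotated -1])
      (auto simp: power2_eq_square algebra_simps powr_add[symmetric])
qed

section \<open>Lommel's integral\<close>

text \<open>The singular parts (\<alpha> + 1/2)/s of the two logarithmic derivatives both contribute
  (\<alpha> + 1/2)/y and cancel in the difference. What remains carries y^(2\<alpha>+2), a positive
  power, times a continuous function.\<close>

lemma tendsto_lommel_0:
  assumes "\<alpha> > -1" "w > 0" "z > 0"
  shows "((\<lambda>y. z * psi \<alpha> (y * w) * dpsi \<alpha> (y * z) - w * dpsi \<alpha> (y * w) * psi \<alpha> (y * z)) \<longlongrightarrow> 0) (at_right 0)"
proof -
  let ?a = "\<alpha> + 1/2"
  let ?c = "2 powr (-\<alpha>) :: real"
  let ?F = "\<lambda>y. ?c\<^sup>2 * (w * z) powr ?a / 2 * y powr (2 * \<alpha> + 2) *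
    (z\<^sup>2 * bessel_entire \<alpha> ((y * w)\<^sup>2 / 4) * bessel_entire1 \<alpha> ((y * z)\<^sup>2 / 4) - w\<^sup>2 * bessel_entire1 \<alpha> ((y * w)\<^sup>2 / 4) * bessel_entire \<alpha> ((y * z)\<^sup>2 / 4))"
  have eq: "z * psi \<alpha> (y * w) * dpsi \<alpha> (y * z) - w * dpsi \<alpha> (y * w) * psi \<alpha> (y * z) = ?F y" if "y > 0" for y
  proof -
    define A B A1 B1 where "A = bessel_entire \<alpha> ((y * w)\<^sup>2 / 4)" and "B = bessel_entire \<alpha> ((y * z)\<^sup>2 / 4)"
      and "A1 = bessel_entire1 \<alpha> ((y * w)\<^sup>2 / 4)" and "B1 = bessel_entire1 \<alpha> ((y * z)\<^sup>2 / 4)"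
    define Y W Z where "Y = y powr ?a" and "W = w powr ?a" and "Z = z powr ?a"
    have "z * psi \<alpha> (y * w) * dpsi \<alpha> (y * z) - w * dpsi \<alpha> (y * w) * psi \<alpha> (y * z)
      = z * (?c * (Y * W) * A) * (?c * (Y * Z) * (?a / (y * z) * B + y * z / 2 * B1))
       - w * (?c * (Y * W) * (?a / (y * w) * A + y * w / 2 * A1)) * (?c * (Y * Z) * B)"
      unfolding psi_def dpsi_def A_def B_def A1_def B1_def Y_def W_def Z_def
      using assms that by (simp add: powr_mult)
    also have "\<dots> = ?c\<^sup>2 * (Y * Y) * (W * Z) * (z * A * (?a / (y * z) * B + y * z / 2 * B1)
       - w * (?a / (y * w) * A + y * w / 2 * A1) * B)"
      by (simp add: power2_eq_square algebra_simps)
    also have "z * A * (?a / (y * z) * B + y * z / 2 * B1) - w * (?a / (y * w) * A + y * w / 2 * A1) * B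
      = y / 2 * (z\<^sup>2 * A * B1 - w\<^sup>2 * A1 * B)"
    proof -
      have "z * (?a / (y * z)) = ?a / y" "w * (?a / (y * w)) = ?a / y" using assms by auto
      then have "z * A * (?a / (y * z) * B) = ?a / y * A * B" "w * (?a / (y * w) * A) * B = ?a / y * A * B"
        by (metis mult.assoc mult.left_commute)+
      then show ?thesis by (simp add: distrib_left distrib_right power2_eq_square algebra_simps)
    qed
    also have "?c\<^sup>2 * (Y * Y) * (W * Z) * (y / 2 * (z\<^sup>2 * A * B1 - w\<^sup>2 * A1 * B))
      = ?c\<^sup>2 * (W * Z) / 2 * (Y * Y * y) * (z\<^sup>2 * A * B1 - w\<^sup>2 * A1 * B)" by simp
    also have "Y * Y * y = y powr (?a + ?a + 1)"
      unfolding Y_def using that by (simp only: powr_add powr_one)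
    also have "?a + ?a + 1 = 2 * \<alpha> + 2" by simp
    also have "W * Z = (w * z) powr ?a"
      unfolding W_def Z_def using assms by (simp add: powr_mult)
    finally show ?thesis unfolding A_def B_def A1_def B1_def .
  qed
  have l: "((\<lambda>y. (y * v)\<^sup>2 / 4) \<longlongrightarrow> 0) (at_right 0)" for v :: real
    by (auto intro!: tendsto_eq_intros)
  have "isCont (bessel_entire \<alpha>) 0" "isCont (bessel_entire1 \<alpha>) 0"
    using assms(1) by (auto intro: DERIV_isCont has_real_derivative_bessel_entire has_real_derivative_bessel_entire1)
  note b = isCont_tendsto_compose[OF this(1) l] isCont_tendsto_compose[OF this(2) l]
  have "((\<lambda>y. y powr (2 * \<alpha> + 2)) \<longlongrightarrow> 0 powr (2 * \<alpha> + 2)) (at_right 0)"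
    using assms by (intro tendsto_powr' tendsto_intros) (auto simp: eventually_at_filter)
  then have "(?F \<longlongrightarrow> ?c\<^sup>2 * (w * z) powr ?a / 2 * 0 powr (2 * \<alpha> + 2) *
    (z\<^sup>2 * bessel_entire \<alpha> 0 * bessel_entire1 \<alpha> 0 - w\<^sup>2 * bessel_entire1 \<alpha> 0 * bessel_entire \<alpha> 0)) (at_right 0)"
    by (intro tendsto_mult tendsto_const tendsto_diff b)
  then have "(?F \<longlongrightarrow> 0) (at_right 0)" by simp
  then show ?thesis
  proof (rule Lim_transform_eventually)
    show "\<forall>\<^sub>F y in at_right 0. ?F y = z * psi \<alpha> (y * w) * dpsi \<alpha> (y * z) - w * dpsi \<alpha> (y * w) * psi \<alpha> (y * z)"
      using eventually_at_right_less[of 0] by eventually_elim (rule eq[symmetric])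
  qed
qed

lemma psi_product_bound:
  assumes "\<alpha> > -1"
  obtains C where "C > 0" and "\<And>y w z. y > 0 \<Longrightarrow> w > 0 \<Longrightarrow> z > 0 \<Longrightarrow>
    \<bar>psi \<alpha> (y * w) * psi \<alpha> (y * z)\<bar> \<le>
      C * (1 + w powr min (\<alpha> + 1/2) 0) * (1 + z powr min (\<alpha> + 1/2) 0) * (1 + y powr min (\<alpha> + 1/2) 0)\<^sup>2"
proof -
  let ?b = "min (\<alpha> + 1/2) 0"
  obtain C where C: "C > 0" "\<And>s. s > 0 \<Longrightarrow> \<bar>psi \<alpha> s\<bar> \<le> C * (1 + s powr ?b)"
    "\<And>s. s > 0 \<Longrightarrow> \<bar>s * dpsi \<alpha> s\<bar> \<le> C * (s + s powr ?b)"
    by (rule psi_bound[OF assms]) (rule that)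
  show thesis
  proof (rule that[of "C\<^sup>2"])
    fix y w z :: real assume p: "y > 0" "w > 0" "z > 0"
    have *: "\<bar>psi \<alpha> (y * v)\<bar> \<le> C * ((1 + y powr ?b) * (1 + v powr ?b))" if "v > 0" for v
    proof -
      have "\<bar>psi \<alpha> (y * v)\<bar> \<le> C * (1 + (y * v) powr ?b)"
        using C(2)[of "y * v"] p that by simp
      also have "\<dots> \<le> C * ((1 + y powr ?b) * (1 + v powr ?b))"
        using C(1) p that by (intro mult_left_mono one_plus_powr_mult_le) auto
      finally show ?thesis .
    qed
    have "\<bar>psi \<alpha> (y * w) * psi \<alpha> (y * z)\<bar> \<le> (C * ((1 + y powr ?b) * (1 + w powr ?b))) * (C * ((1 + y powr ?b) * (1 + z powr ?b)))"
      unfolding abs_mult using C(1) *[OF p(2)] *[OF p(3)] by (intro mult_mono) auto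
    also have "\<dots> = C\<^sup>2 * (1 + w powr ?b) * (1 + z powr ?b) * (1 + y powr ?b)\<^sup>2"
      unfolding power2_eq_square by (simp only: mult_ac)
    finally show "\<bar>psi \<alpha> (y * w) * psi \<alpha> (y * z)\<bar> \<le>
      C\<^sup>2 * (1 + w powr ?b) * (1 + z powr ?b) * (1 + y powr ?b)\<^sup>2" .
  qed (use C in simp)
qed

lemma psi_product_integrable:
  assumes "\<alpha> > -1" "w > 0" "z > 0"
  shows "set_integrable lborel {0<..R} (\<lambda>y. psi \<alpha> (y * w) * psi \<alpha> (y * z))"
proof -
  let ?b = "min (\<alpha> + 1/2) 0"
  note [measurable] = borel_measurable_psi[OF assms(1)]
  obtain C where C: "C > 0" "\<And>y w z. y > 0 \<Longrightarrow> w > 0 \<Longrightarrow> z > 0 \<Longrightarrow>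
    \<bar>psi \<alpha> (y * w) * psi \<alpha> (y * z)\<bar> \<le> C * (1 + w powr ?b) * (1 + z powr ?b) * (1 + y powr ?b)\<^sup>2"
    by (rule psi_product_bound[OF assms(1)]) (rule that)
  show ?thesis
  proof (rule set_integrable_bound)
    show "set_integrable lborel {0<..R} (\<lambda>y. C * (1 + w powr ?b) * (1 + z powr ?b) * (1 + y powr ?b)\<^sup>2)"
      using assms by (intro set_integrable_mult_right set_integrable_one_plus_powr_square) auto
    show "AE y in lborel. y \<in> {0<..R} \<longrightarrow> norm (psi \<alpha> (y * w) * psi \<alpha> (y * z)) \<le>
       norm (C * (1 + w powr ?b) * (1 + z powr ?b) * (1 + y powr ?b)\<^sup>2)"
      using C(2) assms(2,3) by (auto intro!: order_trans[OF C(2)])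
  qed (simp add: set_borel_measurable_def)
qed

text \<open>The equation of \<open>psi\<close> makes the right-hand side, as a function of R, a
  primitive of the weighted integrand: the terms q/y^2 from w and from z cancel, leaving w^2 - z^2.
  It is the analogue of the Dirichlet kernel for the truncated Hankel transform.\<close>

lemma lommel_integral:
  assumes "\<alpha> > -1" "w > 0" "z > 0" "R > 0"
  shows "(w\<^sup>2 - z\<^sup>2) * (LBINT y:{0<..R}. psi \<alpha> (y * w) * psi \<alpha> (y * z))
    = z * psi \<alpha> (R * w) * dpsi \<alpha> (R * z) - w * dpsi \<alpha> (R * w) * psi \<alpha> (R * z)"
proof -
  define F where "F y = z * psi \<alpha> (y * w) * dpsi \<alpha> (y * z) - w * dpsi \<alpha> (y * w) * psi \<alpha> (y * z)" for y
  define f where "f y = (w\<^sup>2 - z\<^sup>2) * (psi \<alpha> (y * w) * psi \<alpha> (y * z))" for y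
  let ?q = "\<alpha>\<^sup>2 - 1/4"
  have dF: "(F has_real_derivative f y) (at y)" if "y > 0" for y
  proof -
    have y: "((\<lambda>y. y * v) has_real_derivative v) (at y)" for v
      by (auto intro!: derivative_eq_intros)
    have d: "((\<lambda>y. psi \<alpha> (y * v)) has_real_derivative dpsi \<alpha> (y * v) * v) (at y)"
      "((\<lambda>y. dpsi \<alpha> (y * v)) has_real_derivative (?q / (y * v)\<^sup>2 - 1) * psi \<alpha> (y * v) * v) (at y)" if "v > 0" for v
    proof -
      have "y * v > 0" using \<open>y > 0\<close> that by simp
      then show "((\<lambda>y. psi \<alpha> (y * v)) has_real_derivative dpsi \<alpha> (y * v) * v) (at y)"
        "((\<lambda>y. dpsi \<alpha> (y * v)) has_real_derivative (?q / (y * v)\<^sup>2 - 1) * psi \<alpha> (y * v) * v) (at y)"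
        by (rule DERIV_chain2[OF has_real_derivative_psi[OF assms(1)] y]
          DERIV_chain2[OF has_real_derivative_dpsi[OF assms(1)] y])+
    qed
    have D: "(F has_real_derivative
       (z * (dpsi \<alpha> (y * w) * w)) * dpsi \<alpha> (y * z) + ((?q / (y * z)\<^sup>2 - 1) * psi \<alpha> (y * z) * z) * (z * psi \<alpha> (y * w))
       - ((w * ((?q / (y * w)\<^sup>2 - 1) * psi \<alpha> (y * w) * w)) * psi \<alpha> (y * z) + (dpsi \<alpha> (y * z) * z) * (w * dpsi \<alpha> (y * w)))) (at y)"
      unfolding F_def[abs_def]
      by (rule DERIV_diff[OF DERIV_mult[OF DERIV_cmult[OF d(1)[OF assms(2)]] d(2)[OF assms(3)]]
          DERIV_mult[OF DERIV_cmult[OF d(2)[OF assms(2)]] d(1)[OF assms(3)]]])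
    have alg: "(z * (P1 * w)) * Q1 + ((Az * Q) * z) * (z * P) - ((w * ((Aw * P) * w)) * Q + (Q1 * z) * (w * P1))
      = (z\<^sup>2 * Az - w\<^sup>2 * Aw) * (P * Q)" for P P1 Q Q1 Aw Az :: real
      by (simp add: power2_eq_square algebra_simps)
    have cancel: "V * (Q / (Y * V) - 1) = Q / Y - V" if "V \<noteq> 0" for V Q Y :: real
      using that by (simp add: right_diff_distrib)
    have "v\<^sup>2 * (?q / (y * v)\<^sup>2 - 1) = ?q / y\<^sup>2 - v\<^sup>2" if "v > 0" for v
      unfolding power_mult_distrib by (rule cancel) (use that in simp)
    from this[OF assms(2)] this[OF assms(3)]
    have eq: "z\<^sup>2 * (?q / (y * z)\<^sup>2 - 1) - w\<^sup>2 * (?q / (y * w)\<^sup>2 - 1) = w\<^sup>2 - z\<^sup>2"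
      by linarith
    show ?thesis
      by (rule DERIV_cong[OF D]) (simp only: alg eq f_def)
  qed
  have int: "set_integrable lborel {0<..R} f"
    unfolding f_def by (intro set_integrable_mult_right psi_product_integrable assms)
  \<comment> \<open>The fundamental theorem is used with one-sided limits: \<open>psi\<close> may be
    unbounded at 0, but \<open>F\<close> tends to 0 there.\<close>
  have "(LBINT y=ereal 0..ereal R. f y) = F R - 0"
  proof (rule interval_integral_FTC_integrable)
    show "(F has_vector_derivative f y) (at y)" if "ereal 0 < ereal y" "ereal y < ereal R" for y
      using dF[of y] that by (simp add: has_real_derivative_iff_has_vector_derivative)
    show "isCont f y" if "ereal 0 < ereal y" "ereal y < ereal R" for y
    proof -
      have "isCont (\<lambda>y. psi \<alpha> (y * v)) y" if "v > 0" for v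
      proof (rule isCont_o2[where f = "\<lambda>y. y * v" and g = "psi \<alpha>"])
        show "isCont (psi \<alpha>) (y * v)"
          by (rule DERIV_isCont[OF has_real_derivative_psi[OF assms(1)]])
            (use \<open>ereal 0 < ereal y\<close> that in simp)
      qed simp
      then show ?thesis unfolding f_def[abs_def] using assms(2,3) by simp
    qed
    show "set_integrable lborel (einterval (ereal 0) (ereal R)) f"
      by (rule set_integrable_subset[OF int]) (auto simp: einterval_iff)
    show "((F \<circ> real_of_ereal) \<longlongrightarrow> 0) (at_right (ereal 0))"
      unfolding ereal_tendsto_simps1 F_def using assms by (intro tendsto_lommel_0)
    have "isCont F R" using dF[OF assms(4)] by (rule DERIV_isCont)
    then show "((F \<circ> real_of_ereal) \<longlongrightarrow> F R) (at_left (ereal R))"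
      unfolding ereal_tendsto_simps1 by (metis isCont_def tendsto_within_subset top_greatest)
  qed (use assms in simp)
  also have "(LBINT y=ereal 0..ereal R. f y) = (LBINT y:{0<..R}. f y)"
    using assms by (intro interval_integral_Ioc) simp
  finally show ?thesis unfolding f_def F_def by simp
qed

section \<open>Oscillatory integrals of \<open>psi\<close> and \<open>dpsi\<close>\<close>

text \<open>The trigonometric part of f is handled by the Riemann-Lebesgue lemma, the remainder
  \<open>e\<close> by dominated convergence, since R w tends to infinity for each w > 0. As
  \<open>e\<close> need not be bounded near 0, its majorant is taken from the given bound on h w f(R
  w).\<close>

lemma oscillatory_integral_tendsto_0:
  fixes f h G :: "real \<Rightarrow> real"
  assumes h: "integrable lborel h" and h0: "\<And>w. w \<le> 0 \<Longrightarrow> h w = 0"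
    and f [measurable]: "f \<in> borel_measurable borel"
    and lim: "((\<lambda>s. f s - (A * cos s + B * sin s)) \<longlongrightarrow> 0) at_top"
    and G: "integrable lborel G" "\<And>R w. R \<ge> 1 \<Longrightarrow> w > 0 \<Longrightarrow> \<bar>h w * f (R * w)\<bar> \<le> G w"
  shows "((\<lambda>R. LINT w|lborel. h w * f (R * w)) \<longlongrightarrow> 0) at_top"
proof -
  have [measurable]: "h \<in> borel_measurable borel" using h by auto
  define e where "e s = f s - (A * cos s + B * sin s)" for s
  have [measurable]: "e \<in> borel_measurable borel" unfolding e_def[abs_def] by measurable
  have rl: "riemann_lebesgue h" by (rule riemann_lebesgue_lemma[OF h])
  have c: "((\<lambda>R. LINT w|lborel. h w * cos (R * w)) \<longlongrightarrow> 0) at_top"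
    using rl[unfolded riemann_lebesgue_def, rule_format, of 0] by simp
  have s: "((\<lambda>R. LINT w|lborel. h w * sin (R * w)) \<longlongrightarrow> 0) at_top"
    using rl[unfolded riemann_lebesgue_def, rule_format, of "- pi / 2"] by (simp add: cos_diff)
  have ci: "integrable lborel (\<lambda>w. h w * cos (R * w))" and si: "integrable lborel (\<lambda>w. h w * sin (R * w))" for R
    using integrable_mult_cos[OF h, of R 0] integrable_mult_cos[OF h, of R "- pi / 2"] by (simp_all add: cos_diff)
  have bd: "\<bar>h w * e (R * w)\<bar> \<le> \<bar>G w\<bar> + (\<bar>A\<bar> + \<bar>B\<bar>) * \<bar>h w\<bar>" if "R \<ge> 1" for R w
  proof (cases "w > 0")
    case True
    have "\<bar>A * cos (R * w)\<bar> \<le> \<bar>A\<bar>" "\<bar>B * sin (R * w)\<bar> \<le> \<bar>B\<bar>"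
      by (auto simp: abs_mult intro!: mult_left_le)
    then have "\<bar>A * cos (R * w) + B * sin (R * w)\<bar> \<le> \<bar>A\<bar> + \<bar>B\<bar>" by linarith
    then have "\<bar>h w\<bar> * \<bar>A * cos (R * w) + B * sin (R * w)\<bar> \<le> \<bar>h w\<bar> * (\<bar>A\<bar> + \<bar>B\<bar>)"
      by (rule mult_left_mono) simp
    then have "\<bar>h w * (A * cos (R * w) + B * sin (R * w))\<bar> \<le> (\<bar>A\<bar> + \<bar>B\<bar>) * \<bar>h w\<bar>"
      by (simp only: abs_mult mult.commute)
    moreover have "h w * e (R * w) = h w * f (R * w) - h w * (A * cos (R * w) + B * sin (R * w))"
      by (simp add: e_def algebra_simps)
    ultimately show ?thesis using G(2)[OF that True] by linarith
  qed (use h0 in simp)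
  have ei: "((\<lambda>R. LINT w|lborel. h w * e (R * w)) \<longlongrightarrow> integral\<^sup>L lborel (\<lambda>w::real. 0 :: real)) at_top"
  proof (rule integral_dominated_convergence_at_top[where w = "\<lambda>w. \<bar>G w\<bar> + (\<bar>A\<bar> + \<bar>B\<bar>) * \<bar>h w\<bar>"])
    show "integrable lborel (\<lambda>w. \<bar>G w\<bar> + (\<bar>A\<bar> + \<bar>B\<bar>) * \<bar>h w\<bar>)"
      by (intro Bochner_Integration.integrable_add integrable_mult_right integrable_abs G h)
    show "\<forall>\<^sub>F R in at_top. AE w in lborel. norm (h w * e (R * w)) \<le> \<bar>G w\<bar> + (\<bar>A\<bar> + \<bar>B\<bar>) * \<bar>h w\<bar>"
      using eventually_ge_at_top[of 1] by eventually_elim (simp add: bd)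
    show "AE w in lborel. ((\<lambda>R. h w * e (R * w)) \<longlongrightarrow> 0) at_top"
    proof (rule AE_I2)
      fix w :: real
      show "((\<lambda>R. h w * e (R * w)) \<longlongrightarrow> 0) at_top"
      proof (cases "w > 0")
        case True
        have "filterlim (\<lambda>R. w * R) at_top at_top"
          by (rule filterlim_tendsto_pos_mult_at_top[OF tendsto_const True filterlim_ident])
        then have "filterlim (\<lambda>R. R * w) at_top at_top" by (simp add: mult.commute)
        then have "((\<lambda>R. e (R * w)) \<longlongrightarrow> 0) at_top"
          by (rule filterlim_compose[OF lim[folded e_def]])
        then show ?thesis by (rule tendsto_mult_right_zero)
      qed (use h0 in simp)
    qed
  qed measurable
  have hei: "integrable lborel (\<lambda>w. h w * e (R * w))" if "R \<ge> 1" for R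
  proof (rule Bochner_Integration.integrable_bound)
    show "integrable lborel (\<lambda>w. \<bar>G w\<bar> + (\<bar>A\<bar> + \<bar>B\<bar>) * \<bar>h w\<bar>)"
      by (intro Bochner_Integration.integrable_add integrable_mult_right integrable_abs G h)
    show "AE w in lborel. norm (h w * e (R * w)) \<le> norm (\<bar>G w\<bar> + (\<bar>A\<bar> + \<bar>B\<bar>) * \<bar>h w\<bar>)"
      using bd[OF that] by (auto intro: order_trans[OF _ abs_ge_self])
  qed measurable
  have "((\<lambda>R. (LINT w|lborel. h w * e (R * w)) + (A * (LINT w|lborel. h w * cos (R * w))
      + B * (LINT w|lborel. h w * sin (R * w)))) \<longlongrightarrow> 0 + (A * 0 + B * 0)) at_top"
    using ei by (intro tendsto_add tendsto_mult tendsto_const c s) simp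
  then have "((\<lambda>R. (LINT w|lborel. h w * e (R * w)) + (A * (LINT w|lborel. h w * cos (R * w))
      + B * (LINT w|lborel. h w * sin (R * w)))) \<longlongrightarrow> 0) at_top" by simp
  then show ?thesis
  proof (rule Lim_transform_eventually)
    show "\<forall>\<^sub>F R in at_top. (LINT w|lborel. h w * e (R * w)) + (A * (LINT w|lborel. h w * cos (R * w))
      + B * (LINT w|lborel. h w * sin (R * w))) = (LINT w|lborel. h w * f (R * w))"
      using eventually_ge_at_top[of 1]
    proof eventually_elim
      case (elim R)
      have "(LINT w|lborel. h w * f (R * w)) =
        (LINT w|lborel. h w * e (R * w) + (A * (h w * cos (R * w)) + B * (h w * sin (R * w))))"
        by (intro Bochner_Integration.integral_cong) (auto simp: e_def algebra_simps)
      also have "\<dots> = (LINT w|lborel. h w * e (R * w)) + (LINT w|lborel. A * (h w * cos (R * w)) + B * (h w * sin (R * w)))"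
        using hei[OF elim] ci si by (intro Bochner_Integration.integral_add Bochner_Integration.integrable_add integrable_mult_right)
      also have "(LINT w|lborel. A * (h w * cos (R * w)) + B * (h w * sin (R * w)))
        = A * (LINT w|lborel. h w * cos (R * w)) + B * (LINT w|lborel. h w * sin (R * w))"
        using ci si by (subst Bochner_Integration.integral_add) auto
      finally show ?case by simp
    qed
  qed
qed

lemma powr_mult_nonpos_le:
  fixes R w b :: real
  assumes "R \<ge> 1" "w > 0" "b \<le> 0"
  shows "(R * w) powr b \<le> w powr b"
proof -
  have "R powr b \<le> R powr 0" using assms by (intro powr_mono) auto
  then show ?thesis using assms by (simp add: powr_mult mult_le_cancel_right1)
qed

text \<open>The bounds are uniform in R \<ge> 1, as dominated convergence requires: dilation by R
  only decreases a nonpositive power, and w times the derivative equals s dpsi(s)/R at s = R w, so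
  the growth in s is compensated.\<close>

lemma psi_oscillatory_bound:
  assumes "\<alpha> > -1"
  obtains C where "C > 0"
    "\<And>R w. R \<ge> 1 \<Longrightarrow> w > 0 \<Longrightarrow> \<bar>psi \<alpha> (R * w)\<bar> \<le> C * (1 + w + w powr min (\<alpha> + 1/2) 0)"
    "\<And>R w. R \<ge> 1 \<Longrightarrow> w > 0 \<Longrightarrow> \<bar>w * dpsi \<alpha> (R * w)\<bar> \<le> C * (1 + w + w powr min (\<alpha> + 1/2) 0)"
proof -
  let ?b = "min (\<alpha> + 1/2) 0"
  obtain C where C: "C > 0"
    "\<And>s. s > 0 \<Longrightarrow> \<bar>psi \<alpha> s\<bar> \<le> C * (1 + s powr ?b)"
    "\<And>s. s > 0 \<Longrightarrow> \<bar>s * dpsi \<alpha> s\<bar> \<le> C * (s + s powr ?b)"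
    by (rule psi_bound[OF assms(1)]) (rule that)
  show thesis
  proof (rule that[OF C(1)])
    fix R w :: real assume R: "R \<ge> 1" "w > 0"
    have "\<bar>psi \<alpha> (R * w)\<bar> \<le> C * (1 + (R * w) powr ?b)" using R by (intro C(2)) auto
    also have "\<dots> \<le> C * (1 + w + w powr ?b)"
      using C(1) R powr_mult_nonpos_le[of R w ?b] by (intro mult_left_mono) auto
    finally show "\<bar>psi \<alpha> (R * w)\<bar> \<le> C * (1 + w + w powr ?b)" .
    have "\<bar>w * dpsi \<alpha> (R * w)\<bar> = \<bar>(R * w) * dpsi \<alpha> (R * w)\<bar> / R"
      using R by (simp add: abs_mult)
    also have "\<dots> \<le> C * (R * w + (R * w) powr ?b) / R"
      using R by (intro divide_right_mono C(3)) auto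
    also have "\<dots> = C * (w + (R * w) powr ?b / R)"
      using R by (simp add: distrib_left add_divide_distrib)
    also have "\<dots> \<le> C * (1 + w + w powr ?b)"
    proof (rule mult_left_mono)
      have "(R * w) powr ?b / R \<le> (R * w) powr ?b / 1" using R by (intro divide_left_mono) auto
      then show "w + (R * w) powr ?b / R \<le> 1 + w + w powr ?b"
        using powr_mult_nonpos_le[of R w ?b] R by simp
    qed (use C in simp)
    finally show "\<bar>w * dpsi \<alpha> (R * w)\<bar> \<le> C * (1 + w + w powr ?b)" .
  qed
qed

lemma psi_oscillatory_integrable:
  assumes "\<alpha> > -1" and h0: "\<And>w. w \<le> 0 \<Longrightarrow> h w = 0" and [measurable]: "h \<in> borel_measurable borel"
    and int: "integrable lborel (\<lambda>w. \<bar>h w\<bar> * (1 + w + w powr min (\<alpha> + 1/2) 0))"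
    and R: "R \<ge> 1"
  shows "integrable lborel (\<lambda>w. h w * psi \<alpha> (R * w))"
    and "integrable lborel (\<lambda>w. h w * (w * dpsi \<alpha> (R * w)))"
proof -
  let ?b = "min (\<alpha> + 1/2) 0"
  obtain C where C: "C > 0"
    "\<And>R w. R \<ge> 1 \<Longrightarrow> w > 0 \<Longrightarrow> \<bar>psi \<alpha> (R * w)\<bar> \<le> C * (1 + w + w powr ?b)"
    "\<And>R w. R \<ge> 1 \<Longrightarrow> w > 0 \<Longrightarrow> \<bar>w * dpsi \<alpha> (R * w)\<bar> \<le> C * (1 + w + w powr ?b)"
    by (rule psi_oscillatory_bound[OF assms(1)]) (rule that)
  note [measurable] = borel_measurable_psi[OF assms(1)] borel_measurable_dpsi[OF assms(1)]
  have i: "integrable lborel (\<lambda>w. h w * f w)"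
    if [measurable]: "f \<in> borel_measurable borel" and b: "\<And>w. w > 0 \<Longrightarrow> \<bar>f w\<bar> \<le> C * (1 + w + w powr ?b)" for f
  proof (rule Bochner_Integration.integrable_bound[OF integrable_mult_right[OF int, of C]])
    show "AE w in lborel. norm (h w * f w) \<le> norm (C * (\<bar>h w\<bar> * (1 + w + w powr ?b)))"
    proof (rule AE_I2)
      fix w
      show "norm (h w * f w) \<le> norm (C * (\<bar>h w\<bar> * (1 + w + w powr ?b)))"
      proof (cases "w > 0")
        case True
        have "norm (h w * f w) \<le> \<bar>h w\<bar> * (C * (1 + w + w powr ?b))"
          using mult_left_mono[OF b[OF True], of "\<bar>h w\<bar>"] by (simp add: abs_mult)
        also have "\<dots> = norm (C * (\<bar>h w\<bar> * (1 + w + w powr ?b)))"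
          using True C(1) by (simp add: abs_mult)
        finally show ?thesis .
      qed (use h0 in simp)
    qed
  qed measurable
  show "integrable lborel (\<lambda>w. h w * psi \<alpha> (R * w))"
    and "integrable lborel (\<lambda>w. h w * (w * dpsi \<alpha> (R * w)))"
    by (rule i; use C R in simp)+
qed

lemma psi_oscillatory_integrals:
  assumes "\<alpha> > -1" and h0: "\<And>w. w \<le> 0 \<Longrightarrow> h w = 0" and [measurable]: "h \<in> borel_measurable borel"
    and int: "integrable lborel (\<lambda>w. \<bar>h w\<bar> * (1 + w + w powr min (\<alpha> + 1/2) 0))"
  shows "((\<lambda>R. LINT w|lborel. h w * psi \<alpha> (R * w)) \<longlongrightarrow> 0) at_top"
    and "((\<lambda>R. LINT w|lborel. h w * (w * dpsi \<alpha> (R * w))) \<longlongrightarrow> 0) at_top"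
proof -
  let ?b = "min (\<alpha> + 1/2) 0"
  obtain A B where AB: "((\<lambda>s. psi \<alpha> s - (A * cos s + B * sin s)) \<longlongrightarrow> 0) at_top"
    "((\<lambda>s. dpsi \<alpha> s - (B * cos s - A * sin s)) \<longlongrightarrow> 0) at_top"
    by (rule psi_asymptotics[OF assms(1)]) (rule that)
  obtain C where C: "C > 0"
    "\<And>R w. R \<ge> 1 \<Longrightarrow> w > 0 \<Longrightarrow> \<bar>psi \<alpha> (R * w)\<bar> \<le> C * (1 + w + w powr ?b)"
    "\<And>R w. R \<ge> 1 \<Longrightarrow> w > 0 \<Longrightarrow> \<bar>w * dpsi \<alpha> (R * w)\<bar> \<le> C * (1 + w + w powr ?b)"
    by (rule psi_oscillatory_bound[OF assms(1)]) (rule that)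
  note [measurable] = borel_measurable_psi[OF assms(1)] borel_measurable_dpsi[OF assms(1)]
  let ?G = "\<lambda>w. \<bar>h w\<bar> * (1 + w + w powr ?b)"
  have h_int: "integrable lborel h"
  proof (rule Bochner_Integration.integrable_bound[OF int])
    show "AE w in lborel. norm (h w) \<le> norm (?G w)"
    proof (rule AE_I2)
      fix w
      show "norm (h w) \<le> norm (?G w)"
        using h0[of w] by (cases "w > 0") (auto simp: abs_mult mult_le_cancel_left1)
    qed
  qed measurable
  have hw_int: "integrable lborel (\<lambda>w. h w * w)"
  proof (rule Bochner_Integration.integrable_bound[OF int])
    show "AE w in lborel. norm (h w * w) \<le> norm (?G w)"
    proof (rule AE_I2)
      fix w
      show "norm (h w * w) \<le> norm (?G w)"
        using h0[of w] by (cases "w > 0") (auto simp: abs_mult intro!: mult_left_mono)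
    qed
  qed measurable
  have GC: "integrable lborel (\<lambda>w. C * ?G w)" by (rule integrable_mult_right[OF int])
  show "((\<lambda>R. LINT w|lborel. h w * psi \<alpha> (R * w)) \<longlongrightarrow> 0) at_top"
  proof (rule oscillatory_integral_tendsto_0[OF h_int h0 _ AB(1) GC])
    fix R w :: real assume R: "R \<ge> 1" "w > 0"
    from C(2)[OF R] have "\<bar>h w\<bar> * \<bar>psi \<alpha> (R * w)\<bar> \<le> \<bar>h w\<bar> * (C * (1 + w + w powr ?b))"
      by (rule mult_left_mono) simp
    then show "\<bar>h w * psi \<alpha> (R * w)\<bar> \<le> C * ?G w" by (simp only: abs_mult mult.left_commute)
  qed measurable
  have "((\<lambda>R. LINT w|lborel. (h w * w) * dpsi \<alpha> (R * w)) \<longlongrightarrow> 0) at_top"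
  \<comment> \<open>Differentiating A cos + B sin gives the amplitude pair (B, -A). The factor w is
    moved into the integrable function h w w.\<close>
  proof (rule oscillatory_integral_tendsto_0[OF hw_int _ _ _ GC, of _ B "- A"])
    fix R w :: real assume R: "R \<ge> 1" "w > 0"
    from C(3)[OF R] have "\<bar>h w\<bar> * \<bar>w * dpsi \<alpha> (R * w)\<bar> \<le> \<bar>h w\<bar> * (C * (1 + w + w powr ?b))"
      by (rule mult_left_mono) simp
    then show "\<bar>(h w * w) * dpsi \<alpha> (R * w)\<bar> \<le> C * ?G w"
      by (simp only: abs_mult mult.assoc mult.left_commute)
  qed (use AB(2) h0 in simp_all)
  then show "((\<lambda>R. LINT w|lborel. h w * (w * dpsi \<alpha> (R * w))) \<longlongrightarrow> 0) at_top"
    by (simp add: mult.assoc)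
qed

section \<open>Fubini and pointwise inversion\<close>

lemma integrable_lborel_prod:
  fixes u v :: "real \<Rightarrow> real"
  assumes u: "integrable lborel u" and v: "integrable lborel v"
  shows "integrable (lborel \<Otimes>\<^sub>M lborel) (\<lambda>p. u (fst p) * v (snd p))"
proof -
  have [measurable]: "u \<in> borel_measurable borel" "v \<in> borel_measurable borel" using u v by auto
  show ?thesis
  proof (rule lborel_pair.Fubini_integrable)
    show "integrable lborel (\<lambda>x. LINT y|lborel. norm (u (fst (x, y)) * v (snd (x, y))))"
      using u by (simp add: abs_mult)
    show "AE x in lborel. integrable lborel (\<lambda>y. u (fst (x, y)) * v (snd (x, y)))"
      using v by simp
  qed measurable
qed

text \<open>The truncation at R makes the double integral absolutely convergent: the majorant u(y)
  v(w) is integrable in y near 0 but has no decay at infinity.\<close>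

lemma hankel_fubini:
  fixes k :: "real \<Rightarrow> real"
  assumes "\<alpha> > -1" "z > 0" and [measurable]: "k \<in> borel_measurable borel"
    and k: "set_integrable lborel {0<..} (\<lambda>w. k w * (1 + w powr min (\<alpha> + 1/2) 0))"
  shows "set_integrable lborel {0<..R} (\<lambda>y. (LBINT w:{0<..}. k w * psi \<alpha> (y * w)) * psi \<alpha> (y * z))"
    and "(LBINT y:{0<..R}. (LBINT w:{0<..}. k w * psi \<alpha> (y * w)) * psi \<alpha> (y * z))
      = (LBINT w:{0<..}. k w * (LBINT y:{0<..R}. psi \<alpha> (y * w) * psi \<alpha> (y * z)))"
    and "set_integrable lborel {0<..} (\<lambda>w. k w * (LBINT y:{0<..R}. psi \<alpha> (y * w) * psi \<alpha> (y * z)))"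
proof -
  let ?b = "min (\<alpha> + 1/2) 0"
  note [measurable] = borel_measurable_psi[OF assms(1)]
  obtain C where C: "C > 0" "\<And>y w z. y > 0 \<Longrightarrow> w > 0 \<Longrightarrow> z > 0 \<Longrightarrow>
    \<bar>psi \<alpha> (y * w) * psi \<alpha> (y * z)\<bar> \<le> C * (1 + w powr ?b) * (1 + z powr ?b) * (1 + y powr ?b)\<^sup>2"
    by (rule psi_product_bound[OF assms(1)]) (rule that)
  define f where "f y w = (indicator {0<..R} y *\<^sub>R (indicator {0<..} w *\<^sub>R
    (k w * (psi \<alpha> (y * w) * psi \<alpha> (y * z)))) :: real)" for y w
  define u where "u y = (C * (1 + z powr ?b)) * (indicator {0<..R} y *\<^sub>R (1 + y powr ?b)\<^sup>2)" for y
  define v where "v w = indicator {0<..} w *\<^sub>R (k w * (1 + w powr ?b))" for w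
  have "set_integrable lborel {0<..R} (\<lambda>y. (1 + y powr ?b)\<^sup>2)"
    using assms by (intro set_integrable_one_plus_powr_square) auto
  then have u_int: "integrable lborel u"
    unfolding u_def set_integrable_def by (rule integrable_mult_right)
  have v_int: "integrable lborel v"
    using k unfolding v_def set_integrable_def .
  have f_int: "integrable (lborel \<Otimes>\<^sub>M lborel) (\<lambda>p. f (fst p) (snd p))"
  proof (rule Bochner_Integration.integrable_bound[OF integrable_lborel_prod[OF u_int v_int]])
    show "AE p in lborel \<Otimes>\<^sub>M lborel. norm (f (fst p) (snd p)) \<le> norm (u (fst p) * v (snd p))"
    proof (rule AE_I2)
      fix p :: "real \<times> real"
      obtain y w where p: "p = (y, w)" by (cases p)
      show "norm (f (fst p) (snd p)) \<le> norm (u (fst p) * v (snd p))"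
      proof (cases "y \<in> {0<..R} \<and> w > 0")
        case True
        then have "\<bar>psi \<alpha> (y * w) * psi \<alpha> (y * z)\<bar> \<le> C * (1 + w powr ?b) * (1 + z powr ?b) * (1 + y powr ?b)\<^sup>2"
          using assms by (intro C) auto
        then have "\<bar>k w\<bar> * \<bar>psi \<alpha> (y * w) * psi \<alpha> (y * z)\<bar> \<le> \<bar>k w\<bar> * (C * (1 + w powr ?b) * (1 + z powr ?b) * (1 + y powr ?b)\<^sup>2)"
          by (rule mult_left_mono) simp
        moreover have "\<bar>1 + t powr ?b\<bar> = 1 + t powr ?b" for t :: real by simp
        ultimately show ?thesis using True C(1) unfolding p f_def u_def v_def
          by (simp add: abs_mult mult_ac)
      qed (auto simp: p f_def)
    qed
    show "(\<lambda>p. f (fst p) (snd p)) \<in> borel_measurable (lborel \<Otimes>\<^sub>M lborel)"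
      unfolding f_def by measurable
  qed
  have in1: "(LINT w|lborel. f y w) = indicator {0<..R} y *\<^sub>R ((LBINT w:{0<..}. k w * psi \<alpha> (y * w)) * psi \<alpha> (y * z))" for y
  proof -
    have "(LINT w|lborel. f y w) = (LINT w|lborel. (indicator {0<..R} y * psi \<alpha> (y * z)) * (indicator {0<..} w *\<^sub>R (k w * psi \<alpha> (y * w))))"
      unfolding f_def by (intro Bochner_Integration.integral_cong) (auto simp: mult_ac)
    also have "\<dots> = (indicator {0<..R} y * psi \<alpha> (y * z)) * (LBINT w:{0<..}. k w * psi \<alpha> (y * w))"
      unfolding set_lebesgue_integral_def by (rule integral_mult_right_zero)
    finally show ?thesis by simp
  qed
  have in2: "(LINT y|lborel. f y w) = indicator {0<..} w *\<^sub>R (k w * (LBINT y:{0<..R}. psi \<alpha> (y * w) * psi \<alpha> (y * z)))" for w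
  proof -
    have "(LINT y|lborel. f y w) = (LINT y|lborel. (indicator {0<..} w * k w) * (indicator {0<..R} y *\<^sub>R (psi \<alpha> (y * w) * psi \<alpha> (y * z))))"
      unfolding f_def by (intro Bochner_Integration.integral_cong) (auto simp: mult_ac)
    also have "\<dots> = (indicator {0<..} w * k w) * (LBINT y:{0<..R}. psi \<alpha> (y * w) * psi \<alpha> (y * z))"
      unfolding set_lebesgue_integral_def by (rule integral_mult_right_zero)
    finally show ?thesis by simp
  qed
  have f_int': "integrable (lborel \<Otimes>\<^sub>M lborel) (case_prod f)"
    using f_int by (simp add: split_def)
  show "set_integrable lborel {0<..R} (\<lambda>y. (LBINT w:{0<..}. k w * psi \<alpha> (y * w)) * psi \<alpha> (y * z))"
    unfolding set_integrable_def in1[symmetric] by (rule lborel_pair.integrable_fst[OF f_int'])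
  show "set_integrable lborel {0<..} (\<lambda>w. k w * (LBINT y:{0<..R}. psi \<alpha> (y * w) * psi \<alpha> (y * z)))"
    unfolding set_integrable_def in2[symmetric] by (rule lborel_pair.integrable_snd[OF f_int'])
  have "(LBINT y:{0<..R}. (LBINT w:{0<..}. k w * psi \<alpha> (y * w)) * psi \<alpha> (y * z))
      = (LINT y|lborel. (LINT w|lborel. f y w))"
    unfolding in1 by (rule meta_eq_to_obj_eq[OF set_lebesgue_integral_def])
  also have "\<dots> = (LINT w|lborel. (LINT y|lborel. f y w))"
    by (rule lborel_pair.Fubini_integral[OF f_int', symmetric])
  also have "\<dots> = (LBINT w:{0<..}. k w * (LBINT y:{0<..R}. psi \<alpha> (y * w) * psi \<alpha> (y * z)))"
    unfolding in2 by (rule meta_eq_to_obj_eq[OF set_lebesgue_integral_def, symmetric])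
  finally show "(LBINT y:{0<..R}. (LBINT w:{0<..}. k w * psi \<alpha> (y * w)) * psi \<alpha> (y * z))
      = (LBINT w:{0<..}. k w * (LBINT y:{0<..R}. psi \<alpha> (y * w) * psi \<alpha> (y * z)))" .
qed

text \<open>A Dini-type argument. Fubini and Lommel's formula turn the truncated inverse transform
  into boundary values at R times oscillatory integrals against h = k / (w^2 - z^2). As k vanishes
  at z to first order, h is integrable; the oscillatory integrals tend to 0 while the boundary
  values stay bounded.\<close>

lemma hankel_localization:
  fixes k :: "real \<Rightarrow> real"
  assumes "\<alpha> > -1" "z > 0" and [measurable]: "k \<in> borel_measurable borel"
    and k: "set_integrable lborel {0<..} (\<lambda>w. k w * (1 + w powr min (\<alpha> + 1/2) 0))"
    and loc: "\<delta> > 0" "\<And>w. \<bar>w - z\<bar> < \<delta> \<Longrightarrow> \<bar>k w\<bar> \<le> L * \<bar>w - z\<bar>"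
  shows "((\<lambda>R. LBINT y:{0<..R}. (LBINT w:{0<..}. k w * psi \<alpha> (y * w)) * psi \<alpha> (y * z)) \<longlongrightarrow> 0) at_top"
proof -
  let ?b = "min (\<alpha> + 1/2) 0"
  \<comment> \<open>The cap z/2 keeps the window around z between z/2 and 2z, away from the
    singularity of the weight at 0.\<close>
  define d where "d = min \<delta> (z / 2)"
  have d: "0 < d" "d \<le> \<delta>" "d \<le> z / 2" using loc(1) assms(2) by (auto simp: d_def)
  have "0 \<le> \<bar>k (z + \<delta> / 2)\<bar>" by simp
  also have "\<dots> \<le> L * (\<delta> / 2)" using loc(2)[of "z + \<delta> / 2"] loc(1) by simp
  finally have L: "0 \<le> L" using loc(1) by (simp add: zero_le_mult_iff)
  define h where "h w = indicator {0<..} w * k w / (w\<^sup>2 - z\<^sup>2)" for w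
  have [measurable]: "h \<in> borel_measurable borel" unfolding h_def[abs_def] by measurable
  have h0: "h w = 0" if "w \<le> 0" for w using that by (simp add: h_def)
  \<comment> \<open>\<open>K1\<close> serves |w - z| \<ge> d, where |w^2 - z^2| is at least d (w +
    z): the part 1/(d z) controls 1 + w^b and the part 1/d controls w. \<open>K2\<close> serves |w -
    z| < d, where |h| is at most L/z.\<close>
  define K1 where "K1 = 1 / (d * z) + 1 / d"
  define K2 where "K2 = L / z * (1 + 2 * z + (z / 2) powr ?b)"
  have K: "K1 \<ge> 0" "K2 \<ge> 0" using d assms(2) L by (auto simp: K1_def K2_def)
  have bd: "\<bar>h w\<bar> * (1 + w + w powr ?b) \<le>
      K1 * \<bar>indicator {0<..} w *\<^sub>R (k w * (1 + w powr ?b))\<bar> + K2 * indicator {0..2 * z} w" if w: "w > 0" for w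
  proof -
    have fac: "\<bar>w\<^sup>2 - z\<^sup>2\<bar> = \<bar>w - z\<bar> * (w + z)"
      using w assms(2) by (simp add: power2_eq_square square_diff_square_factored abs_mult)
    show ?thesis
    proof (cases "\<bar>w - z\<bar> < d")
      case True
      have hL: "\<bar>h w\<bar> \<le> L / z"
      proof (cases "w = z")
        case False
        have "\<bar>h w\<bar> = \<bar>k w\<bar> / (\<bar>w - z\<bar> * (w + z))"
          using w by (simp add: h_def abs_mult fac)
        also have "\<dots> \<le> (L * \<bar>w - z\<bar>) / (\<bar>w - z\<bar> * (w + z))"
          using loc(2)[of w] True d w assms(2) by (intro divide_right_mono) auto
        also have "\<dots> = L / (w + z)" using False by simp
        also have "\<dots> \<le> L / z" using L w assms(2) by (intro divide_left_mono) auto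
        finally show ?thesis .
      qed (use L assms(2) in \<open>simp add: h_def\<close>)
      have w2: "z / 2 \<le> w" "w \<le> 2 * z" using True d by linarith+
      have "w powr ?b \<le> (z / 2) powr ?b"
        using w2 assms(2) by (intro powr_mono2') auto
      then have "1 + w + w powr ?b \<le> 1 + 2 * z + (z / 2) powr ?b" using w2 by simp
      then have "\<bar>h w\<bar> * (1 + w + w powr ?b) \<le> K2"
        unfolding K2_def using hL w L assms(2) by (intro mult_mono) auto
      moreover have "0 \<le> K1 * \<bar>indicator {0<..} w *\<^sub>R (k w * (1 + w powr ?b))\<bar>" using K by simp
      moreover have "K2 * indicator {0..2 * z} w = K2" using w w2 by simp
      ultimately show ?thesis by linarith
    next
      case False
      have "\<bar>h w\<bar> = \<bar>k w\<bar> / (\<bar>w - z\<bar> * (w + z))"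
        using w by (simp add: h_def abs_mult fac)
      also have "\<dots> \<le> \<bar>k w\<bar> / (d * (w + z))"
        using False d w assms(2) by (intro divide_left_mono mult_right_mono mult_pos_pos) auto
      finally have "\<bar>h w\<bar> * (1 + w + w powr ?b) \<le> \<bar>k w\<bar> / (d * (w + z)) * (1 + w + w powr ?b)"
        using w by (intro mult_right_mono) auto
      also have "\<dots> = \<bar>k w\<bar> * ((1 + w powr ?b) / (d * (w + z)) + w / (d * (w + z)))"
      proof -
        have "a / X * (1 + w + P) = a * ((1 + P) / X + w / X)" for a X P :: real
          unfolding divide_inverse by (simp add: algebra_simps)
        then show ?thesis .
      qed
      also have "\<dots> \<le> \<bar>k w\<bar> * ((1 + w powr ?b) / (d * z) + (1 + w powr ?b) / d)"
      proof (rule mult_left_mono)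
        have "(1 + w powr ?b) / (d * (w + z)) \<le> (1 + w powr ?b) / (d * z)"
          using w d assms(2) by (intro divide_left_mono) auto
        moreover have "w / (d * (w + z)) \<le> 1 / d"
          using w d assms(2) by (simp add: divide_simps)
        moreover have "1 / d \<le> (1 + w powr ?b) / d"
          using d by (intro divide_right_mono) auto
        ultimately show "(1 + w powr ?b) / (d * (w + z)) + w / (d * (w + z))
          \<le> (1 + w powr ?b) / (d * z) + (1 + w powr ?b) / d" by linarith
      qed simp
      also have "\<dots> = K1 * (\<bar>k w\<bar> * (1 + w powr ?b))"
      proof -
        have "a * (P / X + P / d) = (1 / X + 1 / d) * (a * P)" for a X P :: real
          unfolding divide_inverse by (simp add: algebra_simps)
        then show ?thesis unfolding K1_def .
      qed
      also have "\<dots> = K1 * \<bar>indicator {0<..} w *\<^sub>R (k w * (1 + w powr ?b))\<bar>"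
        using w by (simp add: abs_mult)
      also have "\<dots> \<le> \<dots> + K2 * indicator {0..2 * z} w"
        using K by (simp only: le_add_same_cancel1) simp
      finally show ?thesis .
    qed
  qed
  have h_int: "integrable lborel (\<lambda>w. \<bar>h w\<bar> * (1 + w + w powr ?b))"
  proof (rule Bochner_Integration.integrable_bound)
    have "integrable lborel (indicator {0..2 * z} :: real \<Rightarrow> real)"
      by (intro integrable_real_indicator) (auto simp: emeasure_lborel_Icc_eq)
    then show "integrable lborel (\<lambda>w. K1 * \<bar>indicator {0<..} w *\<^sub>R (k w * (1 + w powr ?b))\<bar> + K2 * indicator {0..2 * z} w)"
      by (intro Bochner_Integration.integrable_add integrable_mult_right integrable_abs k[unfolded set_integrable_def])
    show "AE w in lborel. norm (\<bar>h w\<bar> * (1 + w + w powr ?b)) \<le>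
      norm (K1 * \<bar>indicator {0<..} w *\<^sub>R (k w * (1 + w powr ?b))\<bar> + K2 * indicator {0..2 * z} w)"
    proof (rule AE_I2)
      fix w :: real
      show "norm (\<bar>h w\<bar> * (1 + w + w powr ?b)) \<le>
        norm (K1 * \<bar>indicator {0<..} w *\<^sub>R (k w * (1 + w powr ?b))\<bar> + K2 * indicator {0..2 * z} w)"
      proof (cases "w > 0")
        case True
        then have "norm (\<bar>h w\<bar> * (1 + w + w powr ?b)) = \<bar>h w\<bar> * (1 + w + w powr ?b)"
          by (simp add: abs_mult)
        also note bd[OF True]
        finally show ?thesis by (simp only: real_norm_def) (rule order_trans[OF _ abs_ge_self])
      qed (simp add: h0)
    qed
  qed measurable
  note [measurable] = borel_measurable_psi[OF assms(1)] borel_measurable_dpsi[OF assms(1)]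
  have eq: "(LBINT y:{0<..R}. (LBINT w:{0<..}. k w * psi \<alpha> (y * w)) * psi \<alpha> (y * z))
     = z * dpsi \<alpha> (R * z) * (LINT w|lborel. h w * psi \<alpha> (R * w))
       - psi \<alpha> (R * z) * (LINT w|lborel. h w * (w * dpsi \<alpha> (R * w)))"
    if R: "R \<ge> 1" and i1: "integrable lborel (\<lambda>w. h w * psi \<alpha> (R * w))"
      and i2: "integrable lborel (\<lambda>w. h w * (w * dpsi \<alpha> (R * w)))" for R
  proof -
    have "(LBINT y:{0<..R}. (LBINT w:{0<..}. k w * psi \<alpha> (y * w)) * psi \<alpha> (y * z))
      = (LBINT w:{0<..}. k w * (LBINT y:{0<..R}. psi \<alpha> (y * w) * psi \<alpha> (y * z)))"
      by (rule hankel_fubini(2)[OF assms(1,2,3) k])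
    also have "\<dots> = (LINT w|lborel. z * dpsi \<alpha> (R * z) * (h w * psi \<alpha> (R * w))
       - psi \<alpha> (R * z) * (h w * (w * dpsi \<alpha> (R * w))))"
      unfolding set_lebesgue_integral_def[of _ "{0<..}"]
    \<comment> \<open>At w = z Lommel's formula cannot be divided by w^2 - z^2, and \<open>h\<close>
      has the default value 0 there; a single point does not affect the integral.\<close>
    proof (rule integral_discrete_difference[of "{z}"])
      fix w assume "w \<notin> {z}"
      show "indicator {0<..} w *\<^sub>R (k w * (LBINT y:{0<..R}. psi \<alpha> (y * w) * psi \<alpha> (y * z)))
        = z * dpsi \<alpha> (R * z) * (h w * psi \<alpha> (R * w)) - psi \<alpha> (R * z) * (h w * (w * dpsi \<alpha> (R * w)))"
      proof (cases "w > 0")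
        case True
        then have nz: "w\<^sup>2 - z\<^sup>2 \<noteq> 0" using \<open>w \<notin> {z}\<close> assms(2) by (simp add: power2_eq_iff)
        have "(LBINT y:{0<..R}. psi \<alpha> (y * w) * psi \<alpha> (y * z))
          = (z * psi \<alpha> (R * w) * dpsi \<alpha> (R * z) - w * dpsi \<alpha> (R * w) * psi \<alpha> (R * z)) / (w\<^sup>2 - z\<^sup>2)"
          using lommel_integral[OF assms(1) True assms(2), of R] R nz by (simp add: nonzero_eq_divide_eq mult.commute)
        then show ?thesis using True by (simp add: h_def diff_divide_distrib right_diff_distrib mult_ac)
      qed (simp add: h0)
    qed auto
    also have "\<dots> = z * dpsi \<alpha> (R * z) * (LINT w|lborel. h w * psi \<alpha> (R * w))
       - psi \<alpha> (R * z) * (LINT w|lborel. h w * (w * dpsi \<alpha> (R * w)))"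
      using i1 i2 by (subst Bochner_Integration.integral_diff) auto
    finally show ?thesis .
  qed
  obtain M where M: "\<And>s. s \<ge> 1 \<Longrightarrow> \<bar>psi \<alpha> s\<bar> \<le> M" "\<And>s. s \<ge> 1 \<Longrightarrow> \<bar>dpsi \<alpha> s\<bar> \<le> M"
    by (rule psi_bounded_at_top[OF assms(1)]) (rule that)
  have ev: "\<forall>\<^sub>F R in at_top. R * z \<ge> 1 \<and> R \<ge> 1"
    using eventually_ge_at_top[of "1 / z"] eventually_ge_at_top[of 1]
    by eventually_elim (use assms(2) in \<open>simp add: divide_simps\<close>)
  note l = psi_oscillatory_integrals[OF assms(1) h0 _ h_int]
  have "((\<lambda>R. z * dpsi \<alpha> (R * z) * (LINT w|lborel. h w * psi \<alpha> (R * w))) \<longlongrightarrow> 0) at_top"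
  proof (rule Lim_null_comparison)
    show "((\<lambda>R. z * M * \<bar>LINT w|lborel. h w * psi \<alpha> (R * w)\<bar>) \<longlongrightarrow> 0) at_top"
      using l(1) by (intro tendsto_mult_right_zero tendsto_rabs_zero) auto
    show "\<forall>\<^sub>F R in at_top. norm (z * dpsi \<alpha> (R * z) * (LINT w|lborel. h w * psi \<alpha> (R * w)))
      \<le> z * M * \<bar>LINT w|lborel. h w * psi \<alpha> (R * w)\<bar>"
      using ev by eventually_elim (use M(2) assms(2) in \<open>auto simp: abs_mult intro!: mult_right_mono mult_left_mono\<close>)
  qed
  moreover have "((\<lambda>R. psi \<alpha> (R * z) * (LINT w|lborel. h w * (w * dpsi \<alpha> (R * w)))) \<longlongrightarrow> 0) at_top"
  proof (rule Lim_null_comparison)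
    show "((\<lambda>R. M * \<bar>LINT w|lborel. h w * (w * dpsi \<alpha> (R * w))\<bar>) \<longlongrightarrow> 0) at_top"
      using l(2) by (intro tendsto_mult_right_zero tendsto_rabs_zero) auto
    show "\<forall>\<^sub>F R in at_top. norm (psi \<alpha> (R * z) * (LINT w|lborel. h w * (w * dpsi \<alpha> (R * w))))
      \<le> M * \<bar>LINT w|lborel. h w * (w * dpsi \<alpha> (R * w))\<bar>"
      using ev by eventually_elim (use M(1) in \<open>auto simp: abs_mult intro!: mult_right_mono\<close>)
  qed
  ultimately have "((\<lambda>R. z * dpsi \<alpha> (R * z) * (LINT w|lborel. h w * psi \<alpha> (R * w))
       - psi \<alpha> (R * z) * (LINT w|lborel. h w * (w * dpsi \<alpha> (R * w)))) \<longlongrightarrow> 0 - 0) at_top"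
    by (rule tendsto_diff)
  then have "((\<lambda>R. z * dpsi \<alpha> (R * z) * (LINT w|lborel. h w * psi \<alpha> (R * w))
       - psi \<alpha> (R * z) * (LINT w|lborel. h w * (w * dpsi \<alpha> (R * w)))) \<longlongrightarrow> 0) at_top" by simp
  then show ?thesis
  proof (rule Lim_transform_eventually)
    show "\<forall>\<^sub>F R in at_top. z * dpsi \<alpha> (R * z) * (LINT w|lborel. h w * psi \<alpha> (R * w))
       - psi \<alpha> (R * z) * (LINT w|lborel. h w * (w * dpsi \<alpha> (R * w)))
       = (LBINT y:{0<..R}. (LBINT w:{0<..}. k w * psi \<alpha> (y * w)) * psi \<alpha> (y * z))"
      using eventually_ge_at_top[of 1]
    proof eventually_elim
      case (elim R)
      show ?case
        using psi_oscillatory_integrable[OF assms(1) h0 _ h_int elim] elim by (intro eq[symmetric]) auto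
    qed
  qed
qed

lemma DERIV_imp_local_Lipschitz:
  fixes f :: "real \<Rightarrow> real"
  assumes "(f has_real_derivative D) (at z)"
  obtains \<delta> where "\<delta> > 0" "\<And>w. \<bar>w - z\<bar> < \<delta> \<Longrightarrow> \<bar>f w - f z\<bar> \<le> (\<bar>D\<bar> + 1) * \<bar>w - z\<bar>"
proof -
  have "((\<lambda>w. (f w - f z) / (w - z)) \<longlongrightarrow> D) (at z)"
    using assms by (simp add: has_field_derivative_iff)
  from tendstoD[OF this, of 1] obtain \<delta> where \<delta>: "\<delta> > 0"
    "\<And>w. w \<noteq> z \<Longrightarrow> dist w z < \<delta> \<Longrightarrow> dist ((f w - f z) / (w - z)) D < 1"
    by (auto simp: eventually_at)
  show thesis
  proof (rule that[OF \<delta>(1)])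
    fix w assume w: "\<bar>w - z\<bar> < \<delta>"
    show "\<bar>f w - f z\<bar> \<le> (\<bar>D\<bar> + 1) * \<bar>w - z\<bar>"
    proof (cases "w = z")
      case False
      then have "\<bar>(f w - f z) / (w - z) - D\<bar> < 1" using \<delta>(2)[of w] w by (simp add: dist_real_def)
      then have "\<bar>(f w - f z) / (w - z)\<bar> \<le> \<bar>D\<bar> + 1" by linarith
      then show ?thesis using False by (simp add: abs_divide pos_divide_le_eq)
    qed simp
  qed
qed

text \<open>Subtracting a multiple of the self-reciprocal Gaussian reduces to \<open>k z = 0\<close>, where
  \<open>k w / (w\<^sup>2 - z\<^sup>2)\<close> is integrable.\<close>
lemma hankel_inversion:
  fixes k :: "real \<Rightarrow> real"
  assumes "\<alpha> > -1" "z > 0" and [measurable]: "k \<in> borel_measurable borel"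
    and k: "set_integrable lborel {0<..} (\<lambda>w. k w * (1 + w powr min (\<alpha> + 1/2) 0))"
    and loc: "\<delta> > 0" "\<And>w. \<bar>w - z\<bar> < \<delta> \<Longrightarrow> \<bar>k w - k z\<bar> \<le> L * \<bar>w - z\<bar>"
  shows "((\<lambda>R. LBINT y:{0<..R}. (LBINT w:{0<..}. k w * psi \<alpha> (y * w)) * psi \<alpha> (y * z)) \<longlongrightarrow> k z) at_top"
proof -
  let ?a = "\<alpha> + 1/2" let ?b = "min ?a 0"
  define \<gamma> where "\<gamma> w = w powr ?a * exp (- w\<^sup>2 / 2)" for w
  have [measurable]: "\<gamma> \<in> borel_measurable borel" unfolding \<gamma>_def[abs_def] by measurable
  note [measurable] = borel_measurable_psi[OF assms(1)]
  have \<gamma>z: "\<gamma> z > 0" using assms(2) by (simp add: \<gamma>_def)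
  \<comment> \<open>The multiple for which \<open>\<kappa>\<close> vanishes at z, as localization
    demands.\<close>
  define c where "c = k z / \<gamma> z"
  have \<gamma>_int: "set_integrable lborel {0<..} (\<lambda>w. \<gamma> w * (1 + w powr ?b))"
  proof -
    have g: "set_integrable lborel {0<..} (\<lambda>w. w powr p * exp (- w\<^sup>2 / 2))" if "p > -1" for p :: real
      using gaussian_moment(1)[of "(p + 1) / 2"] that by (simp add: add_divide_distrib)
    have "set_integrable lborel {0<..} (\<lambda>w. w powr ?a * exp (- w\<^sup>2 / 2) + w powr (?a + ?b) * exp (- w\<^sup>2 / 2))"
      using assms(1) by (intro set_integral_add(1) g) (auto simp: min_def)
    then show ?thesis
      by (rule set_integrable_cong[THEN iffD1, rotated -1]) (auto simp: \<gamma>_def powr_add algebra_simps)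
  qed
  have \<gamma>_h: "(LBINT w:{0<..}. \<gamma> w * psi \<alpha> (y * w)) = \<gamma> y" if "y > 0" for y
    using psi_gaussian(2)[OF assms(1) that] unfolding \<gamma>_def .
  have \<gamma>_hi: "set_integrable lborel {0<..} (\<lambda>w. \<gamma> w * psi \<alpha> (y * w))" if "y > 0" for y
    using psi_gaussian(1)[OF assms(1) that] unfolding \<gamma>_def .
  define \<kappa> where "\<kappa> w = k w - c * \<gamma> w" for w
  have [measurable]: "\<kappa> \<in> borel_measurable borel" unfolding \<kappa>_def[abs_def] by measurable
  have \<kappa>_int: "set_integrable lborel {0<..} (\<lambda>w. \<kappa> w * (1 + w powr ?b))"
  proof -
    have "set_integrable lborel {0<..} (\<lambda>w. k w * (1 + w powr ?b) - c * (\<gamma> w * (1 + w powr ?b)))"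
      by (intro set_integral_diff(1) set_integrable_mult_right k \<gamma>_int)
    then show ?thesis by (simp add: \<kappa>_def algebra_simps)
  qed
  have "((\<lambda>s::real. exp (- s\<^sup>2 / 2)) has_real_derivative exp (- z\<^sup>2 / 2) * (- z)) (at z)"
    by (rule DERIV_chain2[OF DERIV_exp]) (auto intro!: derivative_eq_intros)
  from DERIV_mult[OF has_real_derivative_powr[OF assms(2), of ?a] this]
  have "(\<gamma> has_real_derivative ?a * z powr (?a - 1) * exp (- z\<^sup>2 / 2) + exp (- z\<^sup>2 / 2) * (- z) * z powr ?a) (at z)"
    unfolding \<gamma>_def[abs_def] .
  then obtain \<delta>' D where \<delta>': "\<delta>' > 0" "\<And>w. \<bar>w - z\<bar> < \<delta>' \<Longrightarrow> \<bar>\<gamma> w - \<gamma> z\<bar> \<le> (\<bar>D\<bar> + 1) * \<bar>w - z\<bar>"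
    by (rule DERIV_imp_local_Lipschitz) (rule that)
  have \<kappa>_loc: "\<bar>\<kappa> w\<bar> \<le> (L + \<bar>c\<bar> * (\<bar>D\<bar> + 1)) * \<bar>w - z\<bar>" if "\<bar>w - z\<bar> < min \<delta> \<delta>'" for w
  proof -
    have "c * \<gamma> z = k z" using \<gamma>z by (simp add: c_def)
    then have "\<kappa> w = (k w - k z) - c * (\<gamma> w - \<gamma> z)" by (simp add: \<kappa>_def algebra_simps)
    then have "\<bar>\<kappa> w\<bar> \<le> \<bar>k w - k z\<bar> + \<bar>c\<bar> * \<bar>\<gamma> w - \<gamma> z\<bar>"
      using abs_triangle_ineq4[of "k w - k z" "c * (\<gamma> w - \<gamma> z)"] by (simp add: abs_mult)
    also have "\<dots> \<le> L * \<bar>w - z\<bar> + \<bar>c\<bar> * ((\<bar>D\<bar> + 1) * \<bar>w - z\<bar>)"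
      using that by (intro add_mono mult_left_mono loc(2) \<delta>'(2)) auto
    finally show ?thesis by (simp add: algebra_simps)
  qed
  have k_hi: "set_integrable lborel {0<..} (\<lambda>w. k w * psi \<alpha> (y * w))" if y: "y > 0" for y
  proof -
    obtain C where C: "C > 0" "\<And>s. s > 0 \<Longrightarrow> \<bar>psi \<alpha> s\<bar> \<le> C * (1 + s powr ?b)"
      "\<And>s. s > 0 \<Longrightarrow> \<bar>s * dpsi \<alpha> s\<bar> \<le> C * (s + s powr ?b)"
      by (rule psi_bound[OF assms(1)]) (rule that)
    show ?thesis
    proof (rule set_integrable_bound)
      show "set_integrable lborel {0<..} (\<lambda>w. (C * (1 + y powr ?b)) * (k w * (1 + w powr ?b)))"
        by (intro set_integrable_mult_right k)
      show "AE w in lborel. w \<in> {0<..} \<longrightarrow> norm (k w * psi \<alpha> (y * w)) \<le> norm ((C * (1 + y powr ?b)) * (k w * (1 + w powr ?b)))"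
      proof (intro AE_I2 impI)
        fix w :: real assume w: "w \<in> {0<..}"
        have "\<bar>psi \<alpha> (y * w)\<bar> \<le> C * (1 + (y * w) powr ?b)" using C(2)[of "y * w"] w y by simp
        also have "\<dots> \<le> C * ((1 + y powr ?b) * (1 + w powr ?b))"
          using w y C(1) by (intro mult_left_mono one_plus_powr_mult_le) auto
        finally have "\<bar>k w\<bar> * \<bar>psi \<alpha> (y * w)\<bar> \<le> \<bar>k w\<bar> * (C * ((1 + y powr ?b) * (1 + w powr ?b)))"
          by (rule mult_left_mono) simp
        moreover have "\<bar>1 + t powr ?b\<bar> = 1 + t powr ?b" for t :: real by simp
        ultimately show "norm (k w * psi \<alpha> (y * w)) \<le> norm ((C * (1 + y powr ?b)) * (k w * (1 + w powr ?b)))"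
          using C(1) by (simp add: abs_mult mult_ac)
      qed
    qed (simp add: set_borel_measurable_def)
  qed
  have \<kappa>_h: "(LBINT w:{0<..}. \<kappa> w * psi \<alpha> (y * w)) = (LBINT w:{0<..}. k w * psi \<alpha> (y * w)) - c * \<gamma> y" if "y > 0" for y
  proof -
    have "(LBINT w:{0<..}. \<kappa> w * psi \<alpha> (y * w)) = (LBINT w:{0<..}. k w * psi \<alpha> (y * w) - c * (\<gamma> w * psi \<alpha> (y * w)))"
      by (simp add: \<kappa>_def algebra_simps)
    also have "\<dots> = (LBINT w:{0<..}. k w * psi \<alpha> (y * w)) - (LBINT w:{0<..}. c * (\<gamma> w * psi \<alpha> (y * w)))"
      by (intro set_integral_diff(2) set_integrable_mult_right k_hi \<gamma>_hi that)
    finally show ?thesis using \<gamma>_h[OF that] by simp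
  qed
  \<comment> \<open>As \<open>\<gamma>\<close> is its own transform, inverting it at z is the same
    formula once more, with z in the place of y, and the integral converges absolutely.\<close>
  have \<gamma>_inv: "set_integrable lborel {0<..} (\<lambda>y. \<gamma> y * psi \<alpha> (y * z))"
    "(LBINT y:{0<..}. \<gamma> y * psi \<alpha> (y * z)) = \<gamma> z"
    using \<gamma>_hi[OF assms(2)] \<gamma>_h[OF assms(2)] by (simp_all add: mult.commute[of z])
  have \<gamma>_lim: "((\<lambda>R. LBINT y:{0<..R}. \<gamma> y * psi \<alpha> (y * z)) \<longlongrightarrow> \<gamma> z) at_top"
    unfolding \<gamma>_inv(2)[symmetric] set_lebesgue_integral_def
  proof (rule integral_dominated_convergence_at_top)
    show "integrable lborel (\<lambda>y. norm (indicator {0<..} y *\<^sub>R (\<gamma> y * psi \<alpha> (y * z))))"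
      using \<gamma>_inv(1) unfolding set_integrable_def by (rule integrable_norm)
    show "\<forall>\<^sub>F R in at_top. AE y in lborel. norm (indicator {0<..R} y *\<^sub>R (\<gamma> y * psi \<alpha> (y * z)))
      \<le> norm (indicator {0<..} y *\<^sub>R (\<gamma> y * psi \<alpha> (y * z)))"
      by (intro always_eventually allI AE_I2) (auto simp: indicator_def)
    show "AE y in lborel. ((\<lambda>R. indicator {0<..R} y *\<^sub>R (\<gamma> y * psi \<alpha> (y * z))) \<longlongrightarrow>
      indicator {0<..} y *\<^sub>R (\<gamma> y * psi \<alpha> (y * z))) at_top"
    proof (rule AE_I2)
      fix y :: real
      show "((\<lambda>R. indicator {0<..R} y *\<^sub>R (\<gamma> y * psi \<alpha> (y * z))) \<longlongrightarrow>
        indicator {0<..} y *\<^sub>R (\<gamma> y * psi \<alpha> (y * z))) at_top"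
        by (rule tendsto_eventually, rule eventually_mono[OF eventually_ge_at_top[of y]])
          (auto simp: indicator_def)
    qed
  qed measurable
  have \<kappa>_lim: "((\<lambda>R. LBINT y:{0<..R}. (LBINT w:{0<..}. \<kappa> w * psi \<alpha> (y * w)) * psi \<alpha> (y * z)) \<longlongrightarrow> 0) at_top"
    by (rule hankel_localization[where \<delta> = "min \<delta> \<delta>'", OF assms(1,2) _ \<kappa>_int _ \<kappa>_loc])
      (use loc(1) \<delta>'(1) in simp_all)
  have "((\<lambda>R. (LBINT y:{0<..R}. (LBINT w:{0<..}. \<kappa> w * psi \<alpha> (y * w)) * psi \<alpha> (y * z))
     + c * (LBINT y:{0<..R}. \<gamma> y * psi \<alpha> (y * z))) \<longlongrightarrow> 0 + c * \<gamma> z) at_top"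
    by (intro tendsto_add tendsto_mult tendsto_const \<gamma>_lim \<kappa>_lim)
  moreover have "(LBINT y:{0<..R}. (LBINT w:{0<..}. \<kappa> w * psi \<alpha> (y * w)) * psi \<alpha> (y * z))
     + c * (LBINT y:{0<..R}. \<gamma> y * psi \<alpha> (y * z))
     = (LBINT y:{0<..R}. (LBINT w:{0<..}. k w * psi \<alpha> (y * w)) * psi \<alpha> (y * z))" for R
  proof -
    have i: "set_integrable lborel {0<..R} (\<lambda>y. \<gamma> y * psi \<alpha> (y * z))"
      by (rule set_integrable_subset[OF \<gamma>_inv(1)]) auto
    have "(LBINT y:{0<..R}. (LBINT w:{0<..}. \<kappa> w * psi \<alpha> (y * w)) * psi \<alpha> (y * z))
      = (LBINT y:{0<..R}. (LBINT w:{0<..}. k w * psi \<alpha> (y * w)) * psi \<alpha> (y * z) - c * (\<gamma> y * psi \<alpha> (y * z)))"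
      by (rule set_lebesgue_integral_cong) (auto simp: \<kappa>_h algebra_simps)
    also have "\<dots> = (LBINT y:{0<..R}. (LBINT w:{0<..}. k w * psi \<alpha> (y * w)) * psi \<alpha> (y * z))
      - (LBINT y:{0<..R}. c * (\<gamma> y * psi \<alpha> (y * z)))"
      by (intro set_integral_diff(2) set_integrable_mult_right i hankel_fubini(1)[OF assms(1,2,3) k])
    finally show ?thesis by simp
  qed
  ultimately show ?thesis using \<gamma>z by (simp add: c_def)
qed

section \<open>Transmutation to the cosine\<close>

text \<open>With \<open>q = n (n + 1)\<close> this is the power series of the Legendre function
  \<open>P\<^sub>n (1 - 2 r)\<close> around \<open>r = 0\<close>.\<close>
fun legendre_coeff :: "real \<Rightarrow> nat \<Rightarrow> real" where
  "legendre_coeff q 0 = 1"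
| "legendre_coeff q (Suc k) = legendre_coeff q k * (real k * (real k + 1) - q) / (real k + 1)\<^sup>2"

definition legendre :: "real \<Rightarrow> real \<Rightarrow> real" where
  "legendre q r = (\<Sum>k. legendre_coeff q k * r ^ k)"

definition legendre1 :: "real \<Rightarrow> real \<Rightarrow> real" where
  "legendre1 q r = (\<Sum>k. diffs (legendre_coeff q) k * r ^ k)"

definition legendre2 :: "real \<Rightarrow> real \<Rightarrow> real" where
  "legendre2 q r = (\<Sum>k. diffs (diffs (legendre_coeff q)) k * r ^ k)"

lemma summable_legendre_coeff:
  fixes r :: real
  assumes "norm r < 1"
  shows "summable (\<lambda>k. legendre_coeff q k * r ^ k)"
proof -
  \<comment> \<open>This makes |q|/(n + 1) at most (1 - |r|)/2, so the ratio of terms stays below (1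
    + |r|)/2, the midpoint of |r| and 1.\<close>
  obtain N :: nat where N: "real N > 2 * \<bar>q\<bar> / (1 - \<bar>r\<bar>)"
    using reals_Archimedean2 by blast
  have r: "\<bar>r\<bar> < 1" using assms by simp
  show ?thesis
  proof (rule summable_ratio_test[of "(1 + \<bar>r\<bar>) / 2" N])
    show "(1 + \<bar>r\<bar>) / 2 < 1" using r by simp
    fix n assume n: "N \<le> n"
    have "2 * \<bar>q\<bar> / (1 - \<bar>r\<bar>) < real n + 1" using N n by linarith
    then have "2 * \<bar>q\<bar> < (real n + 1) * (1 - \<bar>r\<bar>)" using r by (simp add: pos_divide_less_eq)
    then have *: "\<bar>q\<bar> / (real n + 1) \<le> (1 - \<bar>r\<bar>) / 2" by (simp add: pos_divide_le_eq mult.commute)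
    have "\<bar>real n * (real n + 1) - q\<bar> \<le> real n * (real n + 1) + \<bar>q\<bar>"
      using abs_triangle_ineq4[of "real n * (real n + 1)" q] by simp
    also have "\<dots> \<le> (real n + 1) * (real n + 1) + \<bar>q\<bar> * (real n + 1)"
      by (simp add: algebra_simps)
    also have "\<dots> = (1 + \<bar>q\<bar> / (real n + 1)) * (real n + 1)\<^sup>2"
      by (simp add: power2_eq_square field_simps)
    finally have "\<bar>real n * (real n + 1) - q\<bar> / (real n + 1)\<^sup>2 \<le> 1 + \<bar>q\<bar> / (real n + 1)"
      by (simp add: pos_divide_le_eq)
    then have "\<bar>r\<bar> * (\<bar>real n * (real n + 1) - q\<bar> / (real n + 1)\<^sup>2) \<le> \<bar>r\<bar> * (1 + \<bar>q\<bar> / (real n + 1))"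
      by (rule mult_left_mono) simp
    also have "\<dots> \<le> \<bar>r\<bar> + 1 * ((1 - \<bar>r\<bar>) / 2)"
      unfolding distrib_left using r * by (intro add_mono mult_mono) auto
    also have "\<dots> = (1 + \<bar>r\<bar>) / 2" by (simp add: field_simps)
    finally have "\<bar>legendre_coeff q n\<bar> * \<bar>r\<bar> ^ n * (\<bar>r\<bar> * (\<bar>real n * (real n + 1) - q\<bar> / (real n + 1)\<^sup>2))
      \<le> \<bar>legendre_coeff q n\<bar> * \<bar>r\<bar> ^ n * ((1 + \<bar>r\<bar>) / 2)"
      by (rule mult_left_mono) simp
    then show "norm (legendre_coeff q (Suc n) * r ^ Suc n) \<le> (1 + \<bar>r\<bar>) / 2 * norm (legendre_coeff q n * r ^ n)"
      by (simp add: abs_mult power_abs mult_ac)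
  qed
qed

lemma summable_diffs_legendre_coeff:
  fixes r :: real
  assumes "norm r < 1"
  shows "summable (\<lambda>k. diffs (legendre_coeff q) k * r ^ k)"
  by (rule termdiff_converges[OF assms summable_legendre_coeff])

lemma summable_diffs2_legendre_coeff:
  fixes r :: real
  assumes "norm r < 1"
  shows "summable (\<lambda>k. diffs (diffs (legendre_coeff q)) k * r ^ k)"
  by (rule termdiff_converges[OF assms summable_diffs_legendre_coeff])

lemma has_real_derivative_legendre:
  "\<bar>r\<bar> < 1 \<Longrightarrow> (legendre q has_real_derivative legendre1 q r) (at r)"
  unfolding legendre_def[abs_def] legendre1_def
  by (rule termdiffs_strong'[OF summable_legendre_coeff]) auto

lemma has_real_derivative_legendre1:
  "\<bar>r\<bar> < 1 \<Longrightarrow> (legendre1 q has_real_derivative legendre2 q r) (at r)"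
  unfolding legendre1_def[abs_def] legendre2_def
  by (rule termdiffs_strong'[OF summable_diffs_legendre_coeff]) auto

lemma legendre_0: "legendre q 0 = 1"
  unfolding legendre_def by (simp add: powser_zero)

lemma continuous_on_legendre2: "continuous_on {-1<..<1} (legendre2 q)"
proof (rule DERIV_continuous_on)
  fix r :: real assume "r \<in> {-1<..<1}"
  then have "(legendre2 q has_real_derivative (\<Sum>k. diffs (diffs (diffs (legendre_coeff q))) k * r ^ k)) (at r)"
    unfolding legendre2_def[abs_def] by (intro termdiffs_strong'[OF summable_diffs2_legendre_coeff]) auto
  then show "(legendre2 q has_real_derivative (\<Sum>k. diffs (diffs (diffs (legendre_coeff q))) k * r ^ k)) (at r within {-1<..<1})"
    by (rule has_field_derivative_at_within)
qed

lemma continuous_on_legendre: "continuous_on {-1<..<1} (legendre q)"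
  and continuous_on_legendre1: "continuous_on {-1<..<1} (legendre1 q)"
  by (rule DERIV_continuous_on, rule has_field_derivative_at_within,
      rule has_real_derivative_legendre has_real_derivative_legendre1, simp add: abs_less_iff)+

text \<open>The coefficient of r^k on the left is (k + 1)^2 c(k+1) - (k (k + 1) - q) c(k), which is
  zero by the recursion. Multiplication by r shifts the index, and the lost term has a factor that
  vanishes at k = 0.\<close>

lemma legendre_ode:
  assumes "\<bar>r\<bar> < 1"
  shows "r * (1 - r) * legendre2 q r + (1 - 2 * r) * legendre1 q r + q * legendre q r = 0"
proof -
  let ?c = "legendre_coeff q"
  have r: "norm r < 1" using assms by simp
  have 0: "(\<lambda>k. ?c k * r ^ k) sums legendre q r"
    unfolding legendre_def by (rule summable_sums[OF summable_legendre_coeff[OF r]])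
  have 1: "(\<lambda>k. diffs ?c k * r ^ k) sums legendre1 q r"
    unfolding legendre1_def by (rule summable_sums[OF summable_diffs_legendre_coeff[OF r]])
  from sums_mult[OF this, of r] have "(\<lambda>k. real (Suc k) * ?c (Suc k) * r ^ Suc k) sums (r * legendre1 q r)"
    by (simp add: diffs_def mult_ac)
  then have r1: "(\<lambda>k. real k * ?c k * r ^ k) sums (r * legendre1 q r)"
    by (subst (asm) sums_Suc_iff) simp
  have "(\<lambda>k. diffs (diffs ?c) k * r ^ k) sums legendre2 q r"
    unfolding legendre2_def by (rule summable_sums[OF summable_diffs2_legendre_coeff[OF r]])
  from sums_mult[OF this, of r]
  have "(\<lambda>k. real (Suc k) * diffs ?c (Suc k) * r ^ Suc k) sums (r * legendre2 q r)"
    by (simp add: diffs_def mult_ac)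
  then have r2: "(\<lambda>k. real k * diffs ?c k * r ^ k) sums (r * legendre2 q r)"
    by (subst (asm) sums_Suc_iff) simp
  from sums_mult[OF this, of r]
  have "(\<lambda>k. (real (Suc k) - 1) * real (Suc k) * ?c (Suc k) * r ^ Suc k) sums (r * (r * legendre2 q r))"
    by (simp add: diffs_def mult_ac)
  then have rr2: "(\<lambda>k. (real k - 1) * real k * ?c k * r ^ k) sums (r * (r * legendre2 q r))"
    by (subst (asm) sums_Suc_iff) simp
  have "(\<lambda>k. real k * diffs ?c k * r ^ k - (real k - 1) * real k * ?c k * r ^ k
      + (diffs ?c k * r ^ k - 2 * (real k * ?c k * r ^ k)) + q * (?c k * r ^ k))
    sums (r * legendre2 q r - r * (r * legendre2 q r) + (legendre1 q r - 2 * (r * legendre1 q r)) + q * legendre q r)"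
    by (intro sums_add sums_diff sums_mult 0 1 r1 r2 rr2)
  also have "(\<lambda>k. real k * diffs ?c k * r ^ k - (real k - 1) * real k * ?c k * r ^ k
      + (diffs ?c k * r ^ k - 2 * (real k * ?c k * r ^ k)) + q * (?c k * r ^ k)) = (\<lambda>k. 0)"
  proof
    fix k
    have "real k * diffs ?c k * r ^ k - (real k - 1) * real k * ?c k * r ^ k
      + (diffs ?c k * r ^ k - 2 * (real k * ?c k * r ^ k)) + q * (?c k * r ^ k)
      = ((real k + 1)\<^sup>2 * ?c (Suc k) - (real k * (real k + 1) - q) * ?c k) * r ^ k"
      unfolding diffs_def by (simp add: power2_eq_square algebra_simps del: legendre_coeff.simps)
    also have "(real k + 1)\<^sup>2 * ?c (Suc k) = (real k * (real k + 1) - q) * ?c k"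
      by simp
    finally show "real k * diffs ?c k * r ^ k - (real k - 1) * real k * ?c k * r ^ k
      + (diffs ?c k * r ^ k - 2 * (real k * ?c k * r ^ k)) + q * (?c k * r ^ k) = 0" by simp
  qed
  finally have "r * legendre2 q r - r * (r * legendre2 q r) + (legendre1 q r - 2 * (r * legendre1 q r)) + q * legendre q r = 0"
    using sums_unique2[OF _ sums_zero] by blast
  then show ?thesis by (simp add: algebra_simps)
qed

text \<open>With \<open>z = x + \<tau> u\<close> this is \<open>(\<tau>\<^sup>2 - (z - x)\<^sup>2) / (4 x z)\<close>; \<open>legendre q\<close> of it is the Riemann
  function of the wave operator \<open>\<partial>\<^sup>2/\<partial>\<tau>\<^sup>2 - \<partial>\<^sup>2/\<partial>z\<^sup>2 + q / z\<^sup>2\<close>.\<close>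
definition trho :: "real \<Rightarrow> real \<Rightarrow> real \<Rightarrow> real" where
  "trho x \<tau> u = \<tau>\<^sup>2 * ((1 - u\<^sup>2) / (4 * x * (x + \<tau> * u)))"

section \<open>The Riemann function and the wave equation\<close>

text \<open>The condition |\<tau>| < x/2 gives z > x/2, so 4 x z > 2 x^2 exceeds the numerator,
  which is at most \<tau>^2 < x^2/4. Hence the Legendre series is evaluated inside its disc of
  convergence.\<close>

lemma trho_bounds:
  assumes "x > 0" "\<bar>\<tau>\<bar> < x / 2" "\<bar>u\<bar> \<le> 1"
  shows "x + \<tau> * u > x / 2" "0 \<le> trho x \<tau> u" "trho x \<tau> u < 1"
proof -
  have "\<bar>\<tau> * u\<bar> \<le> \<bar>\<tau>\<bar> * 1" unfolding abs_mult using assms by (intro mult_left_mono) auto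
  then show z: "x + \<tau> * u > x / 2" using assms by linarith
  have u: "0 \<le> 1 - u\<^sup>2" "1 - u\<^sup>2 \<le> 1" using assms(3) by (auto simp: abs_square_le_1)
  show "0 \<le> trho x \<tau> u"
    unfolding trho_def using u z assms by (intro mult_nonneg_nonneg divide_nonneg_nonneg) auto
  have "\<tau>\<^sup>2 * (1 - u\<^sup>2) \<le> \<tau>\<^sup>2 * 1" using u by (intro mult_left_mono) auto
  also have "\<tau>\<^sup>2 * 1 < (x / 2)\<^sup>2" using power_strict_mono[OF assms(2), of 2] by simp
  also have "\<dots> < 4 * x * (x / 2)" using assms by (simp add: power2_eq_square)
  also have "\<dots> < 4 * x * (x + \<tau> * u)" using z assms by (intro mult_strict_left_mono) auto
  finally show "trho x \<tau> u < 1" unfolding trho_def using z assms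
    by (simp add: pos_divide_less_eq)
qed

text \<open>In this identity and the next \<open>j = 1/x\<close>, \<open>i = 1/(x + \<tau> u)\<close>, \<open>\<tau>\<^sup>2 e = trho x \<tau> u\<close> with
  partial derivatives \<open>\<rho>\<tau>\<close> and \<open>\<rho>u\<close>, and \<open>P\<close>, \<open>P1\<close>, \<open>P2\<close> stand for the Legendre function and its
  derivatives at \<open>trho x \<tau> u\<close>. They express a \<open>\<tau>\<close>-derivative as a \<open>u\<close>-derivative, which is then
  integrated away.\<close>
lemma transmutation_identity1:
  fixes P P1 f f1 \<tau> u i j e \<rho>\<tau> \<rho>u :: real
  assumes "e = (1 - u\<^sup>2) * j * i / 4" "\<rho>\<tau> = 2 * \<tau> * e - \<tau>\<^sup>2 * (e * u * i)" "\<rho>u = - (\<tau>\<^sup>2 * u * j * i / 2) - \<tau>^3 * e * i"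
  shows "(P * f + \<tau> * (P1 * \<rho>\<tau> * f + P * (f1 * u))) - \<tau>\<^sup>2 * j * i / 2 * P1 * f
    = P * f + u * (P1 * \<rho>u * f + P * (f1 * \<tau>))"
proof -
  have "\<tau> * \<rho>\<tau> - u * \<rho>u = \<tau>\<^sup>2 * j * i / 2"
  proof -
    have "\<tau> * \<rho>\<tau> - u * \<rho>u = \<tau>\<^sup>2 / 2 * (4 * e + u\<^sup>2 * j * i)"
      unfolding assms(2,3) by (simp add: algebra_simps power2_eq_square power3_eq_cube)
    also have "4 * e + u\<^sup>2 * j * i = j * i"
      unfolding assms(1) by (simp add: algebra_simps diff_divide_distrib)
    finally show ?thesis by simp
  qed
  then have "(\<tau> * \<rho>\<tau> - u * \<rho>u) * (P1 * f) = \<tau>\<^sup>2 * j * i / 2 * (P1 * f)" by simp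
  then show ?thesis by (simp add: algebra_simps)
qed

lemma transmutation_identity2:
  fixes P P1 P2 f f1 \<tau> u i j e r \<rho>\<tau> \<rho>u q y :: real
  assumes r: "r = \<tau>\<^sup>2 * e" and t: "\<rho>\<tau> = 2 * \<tau> * e - \<tau>\<^sup>2 * (e * u * i)"
    and u: "\<rho>u = - (\<tau>\<^sup>2 * u * j * i / 2) - \<tau>^3 * e * i"
    and rel: "j = i + \<tau> * u * i * j" and ode: "r * (1 - r) * P2 + (1 - 2 * r) * P1 + q * P = 0"
  shows "- ((\<rho>u * i - r * \<tau> * i\<^sup>2) * (P1 * f) + r * i * (P2 * \<rho>u * f + P1 * (f1 * \<tau>)))
      - (P1 * \<rho>u * f1 + P * ((q * i\<^sup>2 - y\<^sup>2) * f * \<tau>))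
    = ((\<tau> * j * i - \<tau>\<^sup>2 * u * j * i\<^sup>2 / 2) * (P1 * f) + \<tau>\<^sup>2 * j * i / 2 * (P2 * \<rho>\<tau> * f + P1 * (f1 * u)))
      + y\<^sup>2 * (\<tau> * (P * f))"
proof -
  have "(- ((\<rho>u * i - r * \<tau> * i\<^sup>2) * (P1 * f) + r * i * (P2 * \<rho>u * f + P1 * (f1 * \<tau>)))
      - (P1 * \<rho>u * f1 + P * ((q * i\<^sup>2 - y\<^sup>2) * f * \<tau>)))
    - (((\<tau> * j * i - \<tau>\<^sup>2 * u * j * i\<^sup>2 / 2) * (P1 * f) + \<tau>\<^sup>2 * j * i / 2 * (P2 * \<rho>\<tau> * f + P1 * (f1 * u)))
      + y\<^sup>2 * (\<tau> * (P * f)))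
    = - (\<tau> * i * f * (P1 + r * P2) * (j - i - \<tau> * u * i * j))
      - f * \<tau> * i\<^sup>2 * (r * (1 - r) * P2 + (1 - 2 * r) * P1 + q * P)"
    unfolding t u r by (simp add: field_simps power2_eq_square power3_eq_cube)
  also have "\<dots> = 0" using rel ode by simp
  finally show ?thesis by simp
qed

text \<open>The right-hand side solves the wave equation with even initial value \<open>f\<close>. As \<open>f\<close> is an
  eigenfunction, the primitive \<open>V\<close> of this solution \<open>W\<close> satisfies \<open>V' = W\<close> and \<open>W' = - y\<^sup>2 V\<close>.\<close>
lemma transmutation:
  fixes f f1 :: "real \<Rightarrow> real" and x y q \<tau> :: real
  assumes x: "x > 0"
    and f: "\<And>z. z > 0 \<Longrightarrow> (f has_real_derivative f1 z) (at z)"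
    and f1: "\<And>z. z > 0 \<Longrightarrow> (f1 has_real_derivative (q / z\<^sup>2 - y\<^sup>2) * f z) (at z)"
    and \<tau>: "\<bar>\<tau>\<bar> < x / 2"
  shows "f x * cos (y * \<tau>) = (f (x + \<tau>) + f (x - \<tau>)) / 2
    + integral {-1..1} (\<lambda>u. \<tau>\<^sup>2 / (2 * x * (x + \<tau> * u)) * legendre1 q (trho x \<tau> u) * f (x + \<tau> * u)) / 2"
proof -
  let ?U = "{- x / 2<..<x / 2}" and ?I = "{-1..1::real}"
  let ?S = "?U \<times> ?I"
  let ?P = "legendre q" and ?P1 = "legendre1 q" and ?P2 = "legendre2 q"
  define z where "z \<tau> u = x + \<tau> * u" for \<tau> u
  define i where "i \<tau> u = 1 / z \<tau> u" for \<tau> u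
  define j where "j = 1 / x"
  define e where "e \<tau> u = (1 - u\<^sup>2) * j * i \<tau> u / 4" for \<tau> u
  define r where "r = trho x"
  define rt where "rt \<tau> u = 2 * \<tau> * e \<tau> u - \<tau>\<^sup>2 * (e \<tau> u * u * i \<tau> u)" for \<tau> u
  define ru where "ru \<tau> u = - (\<tau>\<^sup>2 * u * j * i \<tau> u / 2) - \<tau>^3 * e \<tau> u * i \<tau> u" for \<tau> u
  have zp: "z \<tau> u > 0" "0 \<le> r \<tau> u" "r \<tau> u < 1" "\<bar>r \<tau> u\<bar> < 1" if "\<tau> \<in> ?U" "u \<in> ?I" for \<tau> u
  proof -
    have "\<bar>\<tau>\<bar> < x / 2" "\<bar>u\<bar> \<le> 1" using that by auto
    from trho_bounds[OF x this] x
    show "z \<tau> u > 0" "0 \<le> r \<tau> u" "r \<tau> u < 1" "\<bar>r \<tau> u\<bar> < 1"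
      unfolding z_def r_def by linarith+
  qed
  have req: "r \<tau> u = \<tau>\<^sup>2 * e \<tau> u" for \<tau> u
    by (simp add: r_def trho_def e_def i_def j_def z_def)
  have rel: "j = i \<tau> u + \<tau> * u * i \<tau> u * j" if "\<tau> \<in> ?U" "u \<in> ?I" for \<tau> u
    using zp(1)[OF that] x by (simp add: j_def i_def z_def divide_simps)
  have zt: "((\<lambda>\<tau>. z \<tau> u) has_real_derivative u) (at \<tau>)" and zu: "((\<lambda>u. z \<tau> u) has_real_derivative \<tau>) (at u)" for \<tau> u
    unfolding z_def by (auto intro!: derivative_eq_intros)
  have it: "((\<lambda>\<tau>. i \<tau> u) has_real_derivative - (u * (i \<tau> u)\<^sup>2)) (at \<tau>)"
    and iu: "((\<lambda>u. i \<tau> u) has_real_derivative - (\<tau> * (i \<tau> u)\<^sup>2)) (at u)" if "\<tau> \<in> ?U" "u \<in> ?I" for \<tau> u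
    using zp(1)[OF that] zt[of u \<tau>] zu[of \<tau> u] unfolding i_def
    by (auto intro!: derivative_eq_intros simp: power2_eq_square)
  have rt: "((\<lambda>\<tau>. r \<tau> u) has_real_derivative rt \<tau> u) (at \<tau>)"
    and ru: "((\<lambda>u. r \<tau> u) has_real_derivative ru \<tau> u) (at u)" if "\<tau> \<in> ?U" "u \<in> ?I" for \<tau> u
  proof -
    have D: "((\<lambda>\<tau>. \<tau>\<^sup>2 * ((1 - u\<^sup>2) * j * i \<tau> u / 4)) has_real_derivative
      2 * \<tau> * ((1 - u\<^sup>2) * j * i \<tau> u / 4) + ((1 - u\<^sup>2) * j * (- (u * (i \<tau> u)\<^sup>2)) / 4) * \<tau>\<^sup>2) (at \<tau>)"
      by (rule DERIV_mult[OF _ DERIV_cdivide[OF DERIV_cmult[OF it[OF that]]]]) (auto intro!: derivative_eq_intros)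
    have E: "2 * \<tau> * (E * I / 4) + (E * (- (u * I\<^sup>2)) / 4) * \<tau>\<^sup>2 = 2 * \<tau> * (E * I / 4) - \<tau>\<^sup>2 * (E * I / 4 * u * I)" for E I :: real
      by (simp add: algebra_simps power2_eq_square)
    show "((\<lambda>\<tau>. r \<tau> u) has_real_derivative rt \<tau> u) (at \<tau>)"
      unfolding req e_def rt_def by (rule DERIV_cong[OF D E])
    have "((\<lambda>u. (1 - u\<^sup>2) * j) has_real_derivative - (2 * u * j)) (at u)"
      by (auto intro!: derivative_eq_intros)
    from DERIV_cmult[OF DERIV_cdivide[OF DERIV_mult[OF this iu[OF that]]], of "\<tau>\<^sup>2" 4]
    have D: "((\<lambda>u. \<tau>\<^sup>2 * ((1 - u\<^sup>2) * j * i \<tau> u / 4)) has_real_derivative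
      \<tau>\<^sup>2 * ((- (2 * u * j) * i \<tau> u + - (\<tau> * (i \<tau> u)\<^sup>2) * ((1 - u\<^sup>2) * j)) / 4)) (at u)" .
    have E: "\<tau>\<^sup>2 * ((- (2 * u * j) * I + - (\<tau> * I\<^sup>2) * E) / 4) = - (\<tau>\<^sup>2 * u * j * I / 2) - \<tau>^3 * (E * I / 4) * I" for E I :: real
      by (simp add: algebra_simps power2_eq_square power3_eq_cube diff_divide_distrib)
    show "((\<lambda>u. r \<tau> u) has_real_derivative ru \<tau> u) (at u)"
      unfolding req e_def ru_def by (rule DERIV_cong[OF D E])
  qed
  define F where "F \<tau> u = f (z \<tau> u)" for \<tau> u
  define F1 where "F1 \<tau> u = f1 (z \<tau> u)" for \<tau> u
  define A where "A \<tau> u = ?P (r \<tau> u)" for \<tau> u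
  define A1 where "A1 \<tau> u = ?P1 (r \<tau> u)" for \<tau> u
  define A2 where "A2 \<tau> u = ?P2 (r \<tau> u)" for \<tau> u
  have Ft: "((\<lambda>\<tau>. F \<tau> u) has_real_derivative F1 \<tau> u * u) (at \<tau>)"
    and Fu: "((\<lambda>u. F \<tau> u) has_real_derivative F1 \<tau> u * \<tau>) (at u)"
    and F1u: "((\<lambda>u. F1 \<tau> u) has_real_derivative (q * (i \<tau> u)\<^sup>2 - y\<^sup>2) * F \<tau> u * \<tau>) (at u)"
    and At: "((\<lambda>\<tau>. A \<tau> u) has_real_derivative A1 \<tau> u * rt \<tau> u) (at \<tau>)"
    and Au: "((\<lambda>u. A \<tau> u) has_real_derivative A1 \<tau> u * ru \<tau> u) (at u)"
    and A1t: "((\<lambda>\<tau>. A1 \<tau> u) has_real_derivative A2 \<tau> u * rt \<tau> u) (at \<tau>)"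
    and A1u: "((\<lambda>u. A1 \<tau> u) has_real_derivative A2 \<tau> u * ru \<tau> u) (at u)"
    if s: "\<tau> \<in> ?U" "u \<in> ?I" for \<tau> u
  proof -
    show "((\<lambda>\<tau>. F \<tau> u) has_real_derivative F1 \<tau> u * u) (at \<tau>)"
      unfolding F_def F1_def by (rule DERIV_chain2[OF f[OF zp(1)[OF s]] zt])
    show "((\<lambda>u. F \<tau> u) has_real_derivative F1 \<tau> u * \<tau>) (at u)"
      unfolding F_def F1_def by (rule DERIV_chain2[OF f[OF zp(1)[OF s]] zu])
    have "q * (i \<tau> u)\<^sup>2 = q / (z \<tau> u)\<^sup>2" by (simp add: i_def power_divide)
    then show "((\<lambda>u. F1 \<tau> u) has_real_derivative (q * (i \<tau> u)\<^sup>2 - y\<^sup>2) * F \<tau> u * \<tau>) (at u)"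
      unfolding F_def F1_def using DERIV_chain2[OF f1[OF zp(1)[OF s]] zu] by simp
    note p = has_real_derivative_legendre[OF zp(4)[OF s], of q] has_real_derivative_legendre1[OF zp(4)[OF s], of q]
    show "((\<lambda>\<tau>. A \<tau> u) has_real_derivative A1 \<tau> u * rt \<tau> u) (at \<tau>)"
      "((\<lambda>\<tau>. A1 \<tau> u) has_real_derivative A2 \<tau> u * rt \<tau> u) (at \<tau>)"
      unfolding A_def A1_def A2_def by (rule DERIV_chain2[OF p(1) rt[OF s]] DERIV_chain2[OF p(2) rt[OF s]])+
    show "((\<lambda>u. A \<tau> u) has_real_derivative A1 \<tau> u * ru \<tau> u) (at u)"
      "((\<lambda>u. A1 \<tau> u) has_real_derivative A2 \<tau> u * ru \<tau> u) (at u)"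
      unfolding A_def A1_def A2_def by (rule DERIV_chain2[OF p(1) ru[OF s]] DERIV_chain2[OF p(2) ru[OF s]])+
  qed
  have cz: "continuous_on ?S (\<lambda>p. z (fst p) (snd p))"
    unfolding z_def by (intro continuous_intros)
  have ci: "continuous_on ?S (\<lambda>p. i (fst p) (snd p))"
    unfolding i_def by (intro continuous_intros cz) (use zp(1) in force)
  have ce: "continuous_on ?S (\<lambda>p. e (fst p) (snd p))"
    unfolding e_def by (intro continuous_intros ci) auto
  have cr: "continuous_on ?S (\<lambda>p. r (fst p) (snd p))"
    unfolding req by (intro continuous_intros ce)
  have crt: "continuous_on ?S (\<lambda>p. rt (fst p) (snd p))"
    unfolding rt_def by (intro continuous_intros ci ce)
  have r_in: "(\<lambda>p. r (fst p) (snd p)) ` ?S \<subseteq> {-1<..<1}"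
  proof (intro image_subsetI)
    fix p assume "p \<in> ?S"
    then have "\<bar>r (fst p) (snd p)\<bar> < 1" by (intro zp(4)) auto
    then show "r (fst p) (snd p) \<in> {-1<..<1}" by (simp add: abs_less_iff)
  qed
  have z_in: "(\<lambda>p. z (fst p) (snd p)) ` ?S \<subseteq> {0<..}"
  proof (intro image_subsetI)
    fix p assume "p \<in> ?S"
    then have "0 < z (fst p) (snd p)" by (intro zp(1)) auto
    then show "z (fst p) (snd p) \<in> {0<..}" by simp
  qed
  have cf: "continuous_on {0<..} f" "continuous_on {0<..} f1"
    by (rule DERIV_continuous_on, rule has_field_derivative_at_within, rule f f1, simp)+
  have cA: "continuous_on ?S (\<lambda>p. A (fst p) (snd p))" "continuous_on ?S (\<lambda>p. A1 (fst p) (snd p))"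
    "continuous_on ?S (\<lambda>p. A2 (fst p) (snd p))"
    unfolding A_def A1_def A2_def
    by (rule continuous_on_compose2[OF continuous_on_legendre cr r_in]
        continuous_on_compose2[OF continuous_on_legendre1 cr r_in] continuous_on_compose2[OF continuous_on_legendre2 cr r_in])+
  have cF: "continuous_on ?S (\<lambda>p. F (fst p) (snd p))" "continuous_on ?S (\<lambda>p. F1 (fst p) (snd p))"
    unfolding F_def F1_def by (rule continuous_on_compose2[OF cf(1) cz z_in] continuous_on_compose2[OF cf(2) cz z_in])+
  have slice: "(\<lambda>u. G \<tau> u) integrable_on ?I" if "continuous_on ?S (\<lambda>p. G (fst p) (snd p))" "\<tau> \<in> ?U" for G :: "real \<Rightarrow> real \<Rightarrow> real" and \<tau>
  proof (rule integrable_continuous_interval)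
    show "continuous_on ?I (\<lambda>u. G \<tau> u)"
      using continuous_on_compose2[OF that(1), of ?I "\<lambda>u. (\<tau>, u)"] that(2) by (force intro!: continuous_intros)
  qed
  \<comment> \<open>With z = x + \<tau> u the range of integration is fixed, so differentiation in
    \<tau> yields no boundary terms. The integrals of \<open>g\<close> and \<open>h\<close> over u
    are \<open>V\<close> and the non-local part of \<open>W\<close>; \<open>dg\<close> and
    \<open>dh\<close> are the \<tau>-derivatives.\<close>
  define g where "g \<tau> u = \<tau> * (A \<tau> u * F \<tau> u)" for \<tau> u
  define dg where "dg \<tau> u = A \<tau> u * F \<tau> u + \<tau> * (A1 \<tau> u * rt \<tau> u * F \<tau> u + A \<tau> u * (F1 \<tau> u * u))" for \<tau> u
  define h where "h \<tau> u = \<tau>\<^sup>2 * j * i \<tau> u / 2 * A1 \<tau> u * F \<tau> u" for \<tau> u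
  define dh where "dh \<tau> u = (\<tau> * j * i \<tau> u - \<tau>\<^sup>2 * u * j * (i \<tau> u)\<^sup>2 / 2) * (A1 \<tau> u * F \<tau> u)
     + \<tau>\<^sup>2 * j * i \<tau> u / 2 * (A2 \<tau> u * rt \<tau> u * F \<tau> u + A1 \<tau> u * (F1 \<tau> u * u))" for \<tau> u
  have gt: "((\<lambda>\<tau>. g \<tau> u) has_real_derivative dg \<tau> u) (at \<tau>)" if s: "\<tau> \<in> ?U" "u \<in> ?I" for \<tau> u
    unfolding g_def dg_def
    by (rule DERIV_cong[OF DERIV_mult[OF DERIV_ident DERIV_mult[OF At[OF s] Ft[OF s]]]]) (simp add: algebra_simps)
  have ht: "((\<lambda>\<tau>. h \<tau> u) has_real_derivative dh \<tau> u) (at \<tau>)" if s: "\<tau> \<in> ?U" "u \<in> ?I" for \<tau> u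
  proof -
    have 1: "((\<lambda>\<tau>. \<tau>\<^sup>2 * j) has_real_derivative 2 * \<tau> * j) (at \<tau>)"
      by (auto intro!: derivative_eq_intros)
    note 2 = DERIV_cdivide[OF DERIV_mult[OF 1 it[OF s]], of 2]
    have 3: "(2 * \<tau> * j * i \<tau> u + - (u * (i \<tau> u)\<^sup>2) * (\<tau>\<^sup>2 * j)) / 2 = \<tau> * j * i \<tau> u - \<tau>\<^sup>2 * u * j * (i \<tau> u)\<^sup>2 / 2"
      by (simp add: field_simps)
    note 4 = DERIV_mult[OF DERIV_mult[OF 2[unfolded 3] A1t[OF s]] Ft[OF s]]
    show ?thesis
      unfolding h_def dh_def by (rule DERIV_cong[OF 4]) (simp add: algebra_simps)
  qed
  have cg: "continuous_on ?S (\<lambda>p. g (fst p) (snd p))" "continuous_on ?S (\<lambda>p. dg (fst p) (snd p))"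
    "continuous_on ?S (\<lambda>p. h (fst p) (snd p))" "continuous_on ?S (\<lambda>p. dh (fst p) (snd p))"
    unfolding g_def dg_def h_def dh_def by (intro continuous_intros cA cF crt ci; simp)+
  \<comment> \<open>Fluxes: \<open>dg - h\<close> and \<open>dh + y\<^sup>2 * g\<close> are the
    u-derivatives of \<open>B1\<close> and \<open>B2\<close>. At u = 1 and u = -1 the Legendre
    argument vanishes and the Riemann function is 1, so only values of f and f1 at x + \<tau> and x
    - \<tau> survive.\<close>
  define B1 where "B1 \<tau> u = u * (A \<tau> u * F \<tau> u)" for \<tau> u
  define B2 where "B2 \<tau> u = - (r \<tau> u * i \<tau> u * (A1 \<tau> u * F \<tau> u)) - A \<tau> u * F1 \<tau> u" for \<tau> u
  have B1: "((\<lambda>u. B1 \<tau> u) has_real_derivative dg \<tau> u - h \<tau> u) (at u)" if s: "\<tau> \<in> ?U" "u \<in> ?I" for \<tau> u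
  proof -
    have "((\<lambda>u. B1 \<tau> u) has_real_derivative A \<tau> u * F \<tau> u + u * (A1 \<tau> u * ru \<tau> u * F \<tau> u + A \<tau> u * (F1 \<tau> u * \<tau>))) (at u)"
      unfolding B1_def
      by (rule DERIV_cong[OF DERIV_mult[OF DERIV_ident DERIV_mult[OF Au[OF s] Fu[OF s]]]]) (simp add: algebra_simps)
    then show ?thesis unfolding dg_def h_def
      transmutation_identity1[OF e_def[of \<tau> u] rt_def[of \<tau> u] ru_def[of \<tau> u]] .
  qed
  have B2: "((\<lambda>u. B2 \<tau> u) has_real_derivative dh \<tau> u + y\<^sup>2 * g \<tau> u) (at u)" if s: "\<tau> \<in> ?U" "u \<in> ?I" for \<tau> u
  proof -
    have ri: "((\<lambda>u. r \<tau> u * i \<tau> u) has_real_derivative ru \<tau> u * i \<tau> u - r \<tau> u * \<tau> * (i \<tau> u)\<^sup>2) (at u)"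
      by (rule DERIV_cong[OF DERIV_mult[OF ru[OF s] iu[OF s]]]) (simp add: algebra_simps)
    have "((\<lambda>u. B2 \<tau> u) has_real_derivative
      - ((ru \<tau> u * i \<tau> u - r \<tau> u * \<tau> * (i \<tau> u)\<^sup>2) * (A1 \<tau> u * F \<tau> u) + r \<tau> u * i \<tau> u * (A2 \<tau> u * ru \<tau> u * F \<tau> u + A1 \<tau> u * (F1 \<tau> u * \<tau>)))
      - (A1 \<tau> u * ru \<tau> u * F1 \<tau> u + A \<tau> u * ((q * (i \<tau> u)\<^sup>2 - y\<^sup>2) * F \<tau> u * \<tau>))) (at u)"
      unfolding B2_def
      by (rule DERIV_cong[OF DERIV_diff[OF DERIV_minus[OF DERIV_mult[OF ri DERIV_mult[OF A1u[OF s] Fu[OF s]]]]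
           DERIV_mult[OF Au[OF s] F1u[OF s]]]]) (simp add: algebra_simps)
    moreover have "r \<tau> u * (1 - r \<tau> u) * A2 \<tau> u + (1 - 2 * r \<tau> u) * A1 \<tau> u + q * A \<tau> u = 0"
      unfolding A_def A1_def A2_def by (rule legendre_ode[OF zp(4)[OF s]])
    note transmutation_identity2[OF req rt_def[of \<tau> u] ru_def[of \<tau> u] rel[OF s] this, of "F \<tau> u" "F1 \<tau> u" y]
    ultimately show ?thesis unfolding dh_def g_def by (simp only:)
  qed
  have bd: "B1 \<tau> 1 - B1 \<tau> (-1) = f (x + \<tau>) + f (x - \<tau>)" "B2 \<tau> 1 - B2 \<tau> (-1) = f1 (x - \<tau>) - f1 (x + \<tau>)" for \<tau>
  proof -
    have "r \<tau> 1 = 0" "r \<tau> (-1) = 0" by (simp_all add: r_def trho_def)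
    then show "B1 \<tau> 1 - B1 \<tau> (-1) = f (x + \<tau>) + f (x - \<tau>)" "B2 \<tau> 1 - B2 \<tau> (-1) = f1 (x - \<tau>) - f1 (x + \<tau>)"
      by (simp_all add: B1_def B2_def A_def F_def F1_def z_def legendre_0)
  qed
  have ftc: "integral ?I k = K 1 - K (-1)" if "\<And>u. u \<in> ?I \<Longrightarrow> (K has_real_derivative k u) (at u)" for K k :: "real \<Rightarrow> real"
  proof (rule integral_unique, rule fundamental_theorem_of_calculus)
    show "(K has_vector_derivative k u) (at u within ?I)" if "u \<in> ?I" for u
      using \<open>\<And>u. u \<in> ?I \<Longrightarrow> (K has_real_derivative k u) (at u)\<close>[OF that]
      by (simp add: has_real_derivative_iff_has_vector_derivative has_vector_derivative_at_within)
  qed simp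
  define V where "V \<tau> = integral ?I (g \<tau>)" for \<tau>
  define W where "W \<tau> = f (x + \<tau>) + f (x - \<tau>) + integral ?I (h \<tau>)" for \<tau>
  have leib: "((\<lambda>\<tau>. integral ?I (G \<tau>)) has_real_derivative integral ?I (dG \<tau>)) (at \<tau>)"
    if "\<And>\<tau> u. \<tau> \<in> ?U \<Longrightarrow> u \<in> ?I \<Longrightarrow> ((\<lambda>\<tau>. G \<tau> u) has_real_derivative dG \<tau> u) (at \<tau>)"
      "continuous_on ?S (\<lambda>p. G (fst p) (snd p))" "continuous_on ?S (\<lambda>p. dG (fst p) (snd p))" "\<tau> \<in> ?U" for G dG \<tau>
  proof -
    have "((\<lambda>\<tau>. integral (cbox (-1) 1) (G \<tau>)) has_real_derivative integral (cbox (-1) 1) (dG \<tau>)) (at \<tau> within ?U)"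
      by (rule leibniz_rule_field_derivative)
        (use that slice[OF that(2)] in \<open>auto simp: split_def intro: has_field_derivative_at_within\<close>)
    then show ?thesis by (simp only: at_within_open[OF that(4) open_greaterThanLessThan] box_real)
  qed
  have dV: "(V has_real_derivative W \<tau>) (at \<tau>)" if s: "\<tau> \<in> ?U" for \<tau>
  proof -
    have "integral ?I (\<lambda>u. dg \<tau> u - h \<tau> u) = f (x + \<tau>) + f (x - \<tau>)"
      using ftc[OF B1[OF s]] bd(1) by simp
    moreover have "integral ?I (\<lambda>u. dg \<tau> u - h \<tau> u) = integral ?I (dg \<tau>) - integral ?I (h \<tau>)"
      by (rule integral_diff[OF slice[OF cg(2) s] slice[OF cg(3) s]])
    ultimately have "integral ?I (dg \<tau>) = W \<tau>" unfolding W_def by simp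
    with leib[OF gt cg(1,2) s] show ?thesis unfolding V_def[abs_def] by simp
  qed
  have dW: "(W has_real_derivative - y\<^sup>2 * V \<tau>) (at \<tau>)" if s: "\<tau> \<in> ?U" for \<tau>
  proof -
    have "integral ?I (\<lambda>u. dh \<tau> u + y\<^sup>2 * g \<tau> u) = f1 (x - \<tau>) - f1 (x + \<tau>)"
      using ftc[OF B2[OF s]] bd(2) by simp
    moreover have "integral ?I (\<lambda>u. dh \<tau> u + y\<^sup>2 * g \<tau> u) = integral ?I (dh \<tau>) + integral ?I (\<lambda>u. y\<^sup>2 * g \<tau> u)"
      using integrable_cmul[OF slice[OF cg(1) s], of "y\<^sup>2"]
      by (intro integral_add slice[OF cg(4) s]) simp
    ultimately have i: "integral ?I (dh \<tau>) = f1 (x - \<tau>) - f1 (x + \<tau>) - y\<^sup>2 * V \<tau>"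
      unfolding V_def by simp
    have p: "x + \<tau> > 0" "x - \<tau> > 0" using s x by auto
    have 1: "((\<lambda>\<tau>. x + \<tau>) has_real_derivative 1) (at \<tau>)" and 2: "((\<lambda>\<tau>. x - \<tau>) has_real_derivative -1) (at \<tau>)"
      by (auto intro!: derivative_eq_intros)
    have "(W has_real_derivative f1 (x + \<tau>) * 1 + f1 (x - \<tau>) * (-1) + integral ?I (dh \<tau>)) (at \<tau>)"
      unfolding W_def[abs_def]
      by (rule DERIV_add[OF DERIV_add[OF DERIV_chain2[OF f[OF p(1)] 1] DERIV_chain2[OF f[OF p(2)] 2]] leib[OF ht cg(3,4) s]])
    then show ?thesis unfolding i by simp
  qed
  \<comment> \<open>The pair (W, y V) rotates with speed y; \<open>X\<close> and \<open>Y\<close>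
    are its coordinates in the rotating frame and therefore constant. This takes the place of a
    uniqueness theorem for W'' = - y^2 W.\<close>
  define X where "X \<tau> = W \<tau> * cos (y * \<tau>) + y * V \<tau> * sin (y * \<tau>)" for \<tau>
  define Y where "Y \<tau> = W \<tau> * sin (y * \<tau>) - y * V \<tau> * cos (y * \<tau>)" for \<tau>
  have cd: "((\<lambda>\<tau>. cos (y * \<tau>)) has_real_derivative - sin (y * \<tau>) * y) (at \<tau>)"
    and sd: "((\<lambda>\<tau>. sin (y * \<tau>)) has_real_derivative cos (y * \<tau>) * y) (at \<tau>)" for \<tau>
    by (auto intro!: derivative_eq_intros)
  have dX: "(X has_real_derivative 0) (at \<tau>)" and dY: "(Y has_real_derivative 0) (at \<tau>)" if s: "\<tau> \<in> ?U" for \<tau>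
  proof -
    show "(X has_real_derivative 0) (at \<tau>)" unfolding X_def[abs_def]
      by (rule DERIV_cong[OF DERIV_add[OF DERIV_mult[OF dW[OF s] cd] DERIV_mult[OF DERIV_cmult[OF dV[OF s]] sd]]])
        (simp add: algebra_simps power2_eq_square)
    show "(Y has_real_derivative 0) (at \<tau>)" unfolding Y_def[abs_def]
      by (rule DERIV_cong[OF DERIV_diff[OF DERIV_mult[OF dW[OF s] sd] DERIV_mult[OF DERIV_cmult[OF dV[OF s]] cd]]])
        (simp add: algebra_simps power2_eq_square)
  qed
  have \<tau>U: "\<tau> \<in> ?U" "0 \<in> ?U" using \<tau> x by auto
  have const: "K \<tau> = K 0" if "\<And>\<tau>. \<tau> \<in> ?U \<Longrightarrow> (K has_real_derivative 0) (at \<tau>)" for K :: "real \<Rightarrow> real"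
  proof -
    have "\<exists>c. \<forall>t\<in>?U. K t = c"
      by (rule has_field_derivative_zero_constant[OF convex_real_interval(8)])
        (rule has_field_derivative_at_within, rule that)
    then show ?thesis using \<tau>U by metis
  qed
  \<comment> \<open>At \<tau> = 0 the factors \<tau> of \<open>g\<close> and \<tau>^2 of
    \<open>h\<close> annihilate both integrals.\<close>
  have "X 0 = 2 * f x" "Y 0 = 0"
    unfolding X_def Y_def W_def V_def h_def g_def by simp_all
  then have XY: "X \<tau> = 2 * f x" "Y \<tau> = 0" using const[OF dX] const[OF dY] by simp_all
  have "X \<tau> * cos (y * \<tau>) + Y \<tau> * sin (y * \<tau>) = W \<tau> * (cos (y * \<tau>) * cos (y * \<tau>) + sin (y * \<tau>) * sin (y * \<tau>))"
    unfolding X_def Y_def by (simp only: algebra_simps)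
  then have W: "W \<tau> = 2 * f x * cos (y * \<tau>)" using XY by simp
  have h: "h \<tau> = (\<lambda>u. \<tau>\<^sup>2 / (2 * x * (x + \<tau> * u)) * legendre1 q (trho x \<tau> u) * f (x + \<tau> * u))"
    by (simp add: h_def fun_eq_iff j_def i_def z_def A1_def r_def F_def)
  have "F * c = (a + b) / 2 + I / 2" if "a + b + I = 2 * F * c" for a b I F c :: real
    using that by (simp add: field_simps)
  from this[OF W[unfolded W_def h]] show ?thesis .
qed

section \<open>Poisson's integral\<close>

definition bump :: "real \<Rightarrow> real \<Rightarrow> real" where
  "bump m \<sigma> = (if \<bar>\<sigma>\<bar> < 1 then (1 - \<sigma>\<^sup>2) powr m else 0)"

lemma bump_nonneg: "bump m \<sigma> \<ge> 0"
  by (simp add: bump_def)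

lemma bump_pos: "\<bar>\<sigma>\<bar> < 1 \<Longrightarrow> bump m \<sigma> > 0"
  using abs_square_less_1[of \<sigma>] by (simp add: bump_def)

lemma bump_eq_0: "\<bar>\<sigma>\<bar> \<ge> 1 \<Longrightarrow> bump m \<sigma> = 0"
  by (simp add: bump_def)

lemma borel_measurable_bump [measurable]: "bump m \<in> borel_measurable borel"
  unfolding bump_def[abs_def] by measurable

text \<open>For m < 0 the inequality 1 - \<sigma>^2 \<ge> 1 - |\<sigma>| reduces the singularities
  at 1 and -1 to the power (1 - |\<sigma>|)^m, integrable as m > -1.\<close>

lemma integrable_bump:
  assumes "m > -1"
  shows "integrable lborel (bump m)"
proof -
  define h where "h w = indicator {0<..1} w *\<^sub>R w powr m" for w :: real
  have h: "integrable lborel h"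
    using set_integrable_powr_Ioc[OF assms, of 1] unfolding h_def set_integrable_def by simp
  have h': "integrable lborel (\<lambda>\<sigma>. h (1 + (-1) * \<sigma>))" "integrable lborel (\<lambda>\<sigma>. h (1 + 1 * \<sigma>))"
    by (rule lborel_integrable_real_affine[OF h]; simp)+
  show ?thesis
  proof (rule Bochner_Integration.integrable_bound)
    have "integrable lborel (indicator {-1..1} :: real \<Rightarrow> real)"
      by (intro integrable_real_indicator) (auto simp: emeasure_lborel_Icc_eq)
    then show "integrable lborel (\<lambda>\<sigma>. indicator {-1..1} \<sigma> + (h (1 + (-1) * \<sigma>) + h (1 + 1 * \<sigma>)))"
      by (intro Bochner_Integration.integrable_add h')
    show "AE \<sigma> in lborel. norm (bump m \<sigma>) \<le> norm (indicator {-1..1} \<sigma> + (h (1 + (-1) * \<sigma>) + h (1 + 1 * \<sigma>)))"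
    proof (rule AE_I2)
      fix \<sigma> :: real
      have hn: "h w \<ge> 0" for w by (simp add: h_def)
      show "norm (bump m \<sigma>) \<le> norm (indicator {-1..1} \<sigma> + (h (1 + (-1) * \<sigma>) + h (1 + 1 * \<sigma>)))"
      proof (cases "\<bar>\<sigma>\<bar> < 1")
        case True
        have s: "0 < 1 - \<sigma>\<^sup>2" "1 - \<sigma>\<^sup>2 \<le> 1" using True by (auto simp: abs_square_less_1)
        have "bump m \<sigma> \<le> 1 + (h (1 - \<sigma>) + h (1 + \<sigma>))"
        proof (cases "m \<ge> 0")
          case m: True
          have "(1 - \<sigma>\<^sup>2) powr m \<le> 1 powr m" using s m by (intro powr_mono2) auto
          then show ?thesis using True hn[of "1 - \<sigma>"] hn[of "1 + \<sigma>"] by (simp add: bump_def)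
        next
          case m: False
          have a: "1 - \<sigma>\<^sup>2 = (1 - \<bar>\<sigma>\<bar>) * (1 + \<bar>\<sigma>\<bar>)" by (simp add: algebra_simps power2_eq_square)
          have "1 - \<bar>\<sigma>\<bar> \<le> 1 - \<sigma>\<^sup>2"
            unfolding a using True mult_left_mono[of 1 "1 + \<bar>\<sigma>\<bar>" "1 - \<bar>\<sigma>\<bar>"] by simp
          then have "(1 - \<sigma>\<^sup>2) powr m \<le> (1 - \<bar>\<sigma>\<bar>) powr m"
            using True m by (intro powr_mono2') auto
          also have "\<dots> \<le> h (1 - \<sigma>) + h (1 + \<sigma>)"
            using True hn[of "1 - \<sigma>"] hn[of "1 + \<sigma>"] by (cases "\<sigma> \<ge> 0") (auto simp: h_def)
          finally show ?thesis using True by (simp add: bump_def)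
        qed
        moreover have "indicator {-1..1} \<sigma> = (1::real)" using True by (auto simp: abs_less_iff)
        ultimately show ?thesis
          using hn[of "1 - \<sigma>"] hn[of "1 + \<sigma>"] bump_nonneg[of m \<sigma>] by (simp add: abs_le_iff)
      qed (simp add: bump_def)
    qed
  qed measurable
qed

text \<open>This is the Beta value B(1/2, m + 1). It is never evaluated: it serves as normaliser and
  cancels.\<close>

definition bump_mass :: "real \<Rightarrow> real" where
  "bump_mass m = (LINT \<sigma>|lborel. bump m \<sigma>)"

lemma integrable_bump_power:
  assumes "m > -1"
  shows "integrable lborel (\<lambda>\<sigma>. \<sigma> ^ k * bump m \<sigma>)"
proof (rule Bochner_Integration.integrable_bound[OF integrable_bump[OF assms]])
  show "AE \<sigma> in lborel. norm (\<sigma> ^ k * bump m \<sigma>) \<le> norm (bump m \<sigma>)"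
  proof (rule AE_I2)
    fix \<sigma> :: real
    show "norm (\<sigma> ^ k * bump m \<sigma>) \<le> norm (bump m \<sigma>)"
    proof (cases "\<bar>\<sigma>\<bar> < 1")
      case True
      then have "\<bar>\<sigma>\<bar> ^ k * \<bar>bump m \<sigma>\<bar> \<le> 1 * \<bar>bump m \<sigma>\<bar>"
        by (intro mult_right_mono power_le_one) auto
      then show ?thesis by (simp add: abs_mult power_abs)
    qed (simp add: bump_eq_0)
  qed
qed measurable

lemma bump_mass_pos:
  assumes "m > -1"
  shows "bump_mass m > 0"
proof -
  have "bump_mass m \<ge> 0" unfolding bump_mass_def by (intro Bochner_Integration.integral_nonneg bump_nonneg)
  moreover have "bump_mass m \<noteq> 0"
  proof
    assume "bump_mass m = 0"
    then have "AE \<sigma> in lborel. bump m \<sigma> = 0"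
      unfolding bump_mass_def using integral_nonneg_eq_0_iff_AE[OF integrable_bump[OF assms]] bump_nonneg by simp
    then have "AE \<sigma> in lborel. \<sigma> \<notin> {-1<..<1::real}"
    proof eventually_elim
      case (elim \<sigma>)
      then show ?case using bump_pos[of \<sigma> m] by (auto simp: abs_less_iff)
    qed
    then have "{-1<..<1::real} \<in> null_sets lborel" by (subst AE_iff_null_sets) auto
    then have "emeasure lborel {-1<..<1::real} = 0" by auto
    then show False by simp
  qed
  ultimately show ?thesis by simp
qed

text \<open>Integration by parts: the difference of the two integrands is the derivative of
  \<sigma>^(2k+1) (1 - \<sigma>^2)^(m+1), which vanishes at 1 and -1 because m + 1 > 0. The
  coefficient 2k + 2m + 3 is (2k + 1) + 2(m + 1).\<close>

lemma bump_moment_Suc: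
  assumes "m > -1"
  shows "(2 * real k + 2 * m + 3) * (LINT \<sigma>|lborel. \<sigma> ^ (2 * Suc k) * bump m \<sigma>)
    = (2 * real k + 1) * (LINT \<sigma>|lborel. \<sigma> ^ (2 * k) * bump m \<sigma>)"
proof -
  define F where "F \<sigma> = \<sigma> ^ (2 * k + 1) * (1 - \<sigma>\<^sup>2) powr (m + 1)" for \<sigma> :: real
  define f where "f \<sigma> = (2 * real k + 1) * (\<sigma> ^ (2 * k) * bump m \<sigma>) - (2 * real k + 2 * m + 3) * (\<sigma> ^ (2 * Suc k) * bump m \<sigma>)" for \<sigma>
  have f_int: "integrable lborel f"
    unfolding f_def by (intro Bochner_Integration.integrable_diff integrable_mult_right integrable_bump_power assms)
  have e: "einterval (ereal (-1)) (ereal 1) = {-1<..<1}" by (auto simp: einterval_iff)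
  have fI: "(LBINT \<sigma>=ereal (-1)..ereal 1. f \<sigma>) = integral\<^sup>L lborel f"
    unfolding interval_lebesgue_integral_def e set_lebesgue_integral_def
    by (simp, rule Bochner_Integration.integral_cong) (auto simp: indicator_def f_def bump_def)
  have lim0: "(F \<longlongrightarrow> 0) (at a within S)"
    if a: "a\<^sup>2 = 1" and ev: "\<forall>\<^sub>F \<sigma> in at a within S. 0 \<le> 1 - \<sigma>\<^sup>2" for a :: real and S
  proof -
    have "(F \<longlongrightarrow> a ^ (2 * k + 1) * (1 - a\<^sup>2) powr (m + 1)) (at a within S)"
      unfolding F_def using assms ev a
      by (intro tendsto_mult tendsto_power tendsto_ident_at tendsto_powr' tendsto_diff tendsto_const) auto
    then show ?thesis using a by simp
  qed
  have sq: "0 \<le> 1 - \<sigma>\<^sup>2" if "-1 < \<sigma>" "\<sigma> < 1" for \<sigma> :: real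
    using that abs_square_le_1[of \<sigma>] by (simp add: abs_le_iff)
  have "(LBINT \<sigma>=ereal (-1)..ereal 1. f \<sigma>) = 0 - 0"
  proof (rule interval_integral_FTC_integrable)
    show "set_integrable lborel (einterval (ereal (-1)) (ereal 1)) f"
      unfolding set_integrable_def e by (rule integrable_mult_indicator[OF _ f_int]) simp
    fix \<sigma> assume "ereal (-1) < ereal \<sigma>" "ereal \<sigma> < ereal 1"
    then have s: "\<bar>\<sigma>\<bar> < 1" "0 < 1 - \<sigma>\<^sup>2" by (auto simp: abs_less_iff abs_square_less_1)
    have "((\<lambda>\<sigma>. 1 - \<sigma>\<^sup>2) has_real_derivative - 2 * \<sigma>) (at \<sigma>)"
      by (auto intro!: derivative_eq_intros)
    from DERIV_fun_powr[OF this s(2), of "m + 1"]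
    have 1: "((\<lambda>\<sigma>. (1 - \<sigma>\<^sup>2) powr (m + 1)) has_real_derivative (m + 1) * (1 - \<sigma>\<^sup>2) powr m * (- 2 * \<sigma>)) (at \<sigma>)"
      by simp
    have 2: "((\<lambda>\<sigma>. \<sigma> ^ (2 * k + 1)) has_real_derivative (2 * real k + 1) * \<sigma> ^ (2 * k)) (at \<sigma>)"
      by (rule DERIV_cong[OF DERIV_pow]) simp
    have 3: "(1 - \<sigma>\<^sup>2) powr (m + 1) = (1 - \<sigma>\<^sup>2) powr m * (1 - \<sigma>\<^sup>2)" using s by (simp add: powr_add)
    have "(F has_real_derivative f \<sigma>) (at \<sigma>)"
      unfolding F_def[abs_def]
      by (rule DERIV_cong[OF DERIV_mult[OF 2 1]], unfold 3 f_def bump_def)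
        (use s in \<open>simp add: algebra_simps power2_eq_square\<close>)
    then show "(F has_vector_derivative f \<sigma>) (at \<sigma>)"
      by (simp add: has_real_derivative_iff_has_vector_derivative)
    have ev: "\<forall>\<^sub>F \<sigma> in nhds \<sigma>. \<sigma> \<in> {-1<..<1}"
      using s by (intro eventually_nhds_in_open) (auto simp: abs_less_iff)
    have "isCont (\<lambda>\<sigma>. (2 * real k + 1) * (\<sigma> ^ (2 * k) * (1 - \<sigma>\<^sup>2) powr m) - (2 * real k + 2 * m + 3) * (\<sigma> ^ (2 * Suc k) * (1 - \<sigma>\<^sup>2) powr m)) \<sigma>"
      using s by (intro continuous_intros) auto
    also have "?this \<longleftrightarrow> isCont f \<sigma>"
      by (rule isCont_cong) (use ev in \<open>eventually_elim, auto simp: f_def bump_def\<close>)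
    finally show "isCont f \<sigma>" .
  next
    show "((F \<circ> real_of_ereal) \<longlongrightarrow> 0) (at_right (ereal (-1)))" "((F \<circ> real_of_ereal) \<longlongrightarrow> 0) (at_left (ereal 1))"
      unfolding ereal_tendsto_simps1
      using eventually_at_right_real[of "-1" 1] eventually_at_left_real[of "-1" 1]
      by (auto intro!: lim0 elim!: eventually_mono sq)
  qed simp
  then have "integral\<^sup>L lborel f = 0" using fI by simp
  moreover have "integral\<^sup>L lborel f = (2 * real k + 1) * (LINT \<sigma>|lborel. \<sigma> ^ (2 * k) * bump m \<sigma>)
      - (2 * real k + 2 * m + 3) * (LINT \<sigma>|lborel. \<sigma> ^ (2 * Suc k) * bump m \<sigma>)"
  proof -
    have "integral\<^sup>L lborel f = (LINT \<sigma>|lborel. (2 * real k + 1) * (\<sigma> ^ (2 * k) * bump m \<sigma>))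
      - (LINT \<sigma>|lborel. (2 * real k + 2 * m + 3) * (\<sigma> ^ (2 * Suc k) * bump m \<sigma>))"
      unfolding f_def
      by (rule Bochner_Integration.integral_diff; intro integrable_mult_right integrable_bump_power assms)
    then show ?thesis by (simp only: integral_mult_right_zero)
  qed
  ultimately show ?thesis by simp
qed

text \<open>Division by (2k)! anticipates the cosine series. Each step of the moment recursion then
  divides by (2k + 2)(2k + 2m + 3) = 4 (k + 1)(k + m + 3/2), which builds up k!, 4^k and the shifted
  Gamma argument without a duplication formula.\<close>

lemma bump_moment:
  assumes "m > -1"
  shows "(LINT \<sigma>|lborel. \<sigma> ^ (2 * k) * bump m \<sigma>) / fact (2 * k)
    = bump_mass m * Gamma (m + 3/2) * (rGamma (real k + m + 3/2) / (fact k * 4 ^ k))"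
proof (induction k)
  case 0
  have "Gamma (m + 3/2) > 0" using assms by (intro Gamma_real_pos) simp
  then show ?case by (simp add: bump_mass_def rGamma_inverse_Gamma)
next
  case (Suc k)
  define b where "b k = (LINT \<sigma>|lborel. \<sigma> ^ (2 * k) * bump m \<sigma>)" for k
  have r: "(real k + m + 3/2) * rGamma (real (Suc k) + m + 3/2) = rGamma (real k + m + 3/2)"
    using rGamma_plus1[of "real k + m + 3/2"] by (simp add: algebra_simps)
  have p: "2 * real k + 2 * m + 3 > 0" using assms by simp
  have "b (Suc k) = (2 * real k + 1) * b k / (2 * real k + 2 * m + 3)"
    using bump_moment_Suc[OF assms, of k] p unfolding b_def by (simp add: field_simps)
  moreover have "(fact (2 * Suc k) :: real) = (2 * real k + 2) * (2 * real k + 1) * fact (2 * k)"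
    by (simp add: algebra_simps)
  ultimately have "b (Suc k) / fact (2 * Suc k) = (b k / fact (2 * k)) / ((2 * real k + 2) * (2 * real k + 2 * m + 3))"
    using p by (simp add: divide_simps)
  also have "b k / fact (2 * k) = bump_mass m * Gamma (m + 3/2) * (((real k + m + 3/2) * rGamma (real (Suc k) + m + 3/2)) / (fact k * 4 ^ k))"
    unfolding r b_def by (rule Suc)
  also have "\<dots> / ((2 * real k + 2) * (2 * real k + 2 * m + 3))
    = bump_mass m * Gamma (m + 3/2) * (rGamma (real (Suc k) + m + 3/2) / (fact (Suc k) * 4 ^ Suc k))"
  proof -
    have *: "X * ((t * G) / (F * Q)) / ((2 * n + 2) * (2 * t)) = X * (G / (((n + 1) * F) * (4 * Q)))"
      if "t > 0" "n \<ge> 0" for X t G F Q n :: real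
      using that by (simp add: divide_simps)
    have **: "2 * real k + 2 * m + 3 = 2 * (real k + m + 3/2)" "(fact (Suc k) :: real) = (real k + 1) * fact k"
      "(4::real) ^ Suc k = 4 * 4 ^ k" by simp_all
    show ?thesis unfolding ** by (rule *) (use assms in simp_all)
  qed
  finally show ?case unfolding b_def .
qed

text \<open>The cosine series is integrated term by term; the moments of the bump turn its
  coefficients into those of the Bessel function of order m + 1/2. Even powers have a constant sign,
  so the norms integrate to the absolute values of the Bessel terms, which are summable.\<close>

lemma poisson_integral:
  assumes "m > -1"
  shows "(LINT \<sigma>|lborel. bump m \<sigma> * cos (s * \<sigma>)) = bump_mass m * (Gamma (m + 3/2) * bessel_entire (m + 1/2) (s\<^sup>2 / 4))"
proof -
  let ?\<mu> = "m + 1/2"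
  have \<mu>: "?\<mu> > -1" using assms by simp
  define f where "f k \<sigma> = (- 1) ^ k * s ^ (2 * k) / fact (2 * k) * (\<sigma> ^ (2 * k) * bump m \<sigma>)" for k \<sigma>
  have f_int: "integrable lborel (f k)" for k
    unfolding f_def by (intro integrable_mult_right integrable_bump_power assms)
  have nf: "norm (f k \<sigma>) = s ^ (2 * k) / fact (2 * k) * (\<sigma> ^ (2 * k) * bump m \<sigma>)" for k \<sigma>
    using bump_nonneg[of m \<sigma>] by (simp add: f_def abs_mult power_mult)
  define b where "b k = (LINT \<sigma>|lborel. \<sigma> ^ (2 * k) * bump m \<sigma>) / fact (2 * k)" for k
  have b: "b k = bump_mass m * Gamma (m + 3/2) * (rGamma (real k + m + 3/2) / (fact k * 4 ^ k))" for k
    unfolding b_def by (rule bump_moment[OF assms])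
  have fv: "integral\<^sup>L lborel (f k) = bump_mass m * Gamma (m + 3/2) * (bessel_coeff ?\<mu> k * (s\<^sup>2 / 4) ^ k)" for k
  proof -
    have "integral\<^sup>L lborel (f k) = (- 1) ^ k * s ^ (2 * k) * b k"
      unfolding f_def b_def by simp
    also have "\<dots> = bump_mass m * Gamma (m + 3/2) * (bessel_coeff ?\<mu> k * (s\<^sup>2 / 4) ^ k)"
      unfolding b bessel_coeff_def by (simp add: power_divide power_mult add_ac)
    finally show ?thesis .
  qed
  have nfv: "(LINT \<sigma>|lborel. norm (f k \<sigma>)) = \<bar>integral\<^sup>L lborel (f k)\<bar>" for k
  proof -
    have nn: "(LINT \<sigma>|lborel. \<sigma> ^ (2 * k) * bump m \<sigma>) \<ge> 0"
      by (intro Bochner_Integration.integral_nonneg mult_nonneg_nonneg bump_nonneg) (simp add: power_mult)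
    have "(LINT \<sigma>|lborel. norm (f k \<sigma>)) = s ^ (2 * k) / fact (2 * k) * (LINT \<sigma>|lborel. \<sigma> ^ (2 * k) * bump m \<sigma>)"
      unfolding nf by simp
    also have "\<dots> = \<bar>integral\<^sup>L lborel (f k)\<bar>"
      unfolding f_def using nn by (simp add: abs_mult power_mult)
    finally show ?thesis .
  qed
  have ab: "AE \<sigma> in lborel. summable (\<lambda>k. norm (f k \<sigma>))"
  proof (rule AE_I2)
    fix \<sigma> :: real
    have "summable (\<lambda>k. norm ((- 1) ^ k / fact (2 * k) * (s * \<sigma>) ^ (2 * k)))"
    proof (rule summable_comparison_test')
      show "summable (\<lambda>k. ((s * \<sigma>)\<^sup>2) ^ k /\<^sub>R fact k)" by (rule summable_exp_generic)
      fix k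
      define X where "X = (s * \<sigma>)\<^sup>2"
      have X: "X \<ge> 0" "(s * \<sigma>) ^ (2 * k) = X ^ k" by (simp_all add: X_def power_mult)
      have "norm (norm ((- 1) ^ k / fact (2 * k) * X ^ k)) = X ^ k / fact (2 * k)"
        using X(1) by (simp add: abs_mult)
      also have "\<dots> \<le> X ^ k / fact k"
        using X(1) by (intro divide_left_mono fact_mono) auto
      finally show "norm (norm ((- 1) ^ k / fact (2 * k) * (s * \<sigma>) ^ (2 * k))) \<le> ((s * \<sigma>)\<^sup>2) ^ k /\<^sub>R fact k"
        unfolding X(2) X_def[symmetric] by (simp add: divide_inverse mult.commute)
    qed
    then have "summable (\<lambda>k. norm ((- 1) ^ k / fact (2 * k) * (s * \<sigma>) ^ (2 * k)) * bump m \<sigma>)"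
      by (rule summable_mult2)
    then show "summable (\<lambda>k. norm (f k \<sigma>))"
      unfolding nf by (simp add: abs_mult power_mult power_mult_distrib mult_ac)
  qed
  have sm: "summable (\<lambda>k. LINT \<sigma>|lborel. norm (f k \<sigma>))"
    unfolding nfv fv abs_mult using summable_norm_bessel_coeff[OF \<mu>, of "s\<^sup>2 / 4"]
    by (intro summable_mult) (simp add: abs_mult)
  have eq: "(\<Sum>k. f k \<sigma>) = bump m \<sigma> * cos (s * \<sigma>)" for \<sigma>
  proof -
    have "(\<lambda>k. bump m \<sigma> * ((- 1) ^ k / fact (2 * k) * (s * \<sigma>) ^ (2 * k))) sums (bump m \<sigma> * cos (s * \<sigma>))"
      by (intro sums_mult cos_paired)
    then show ?thesis unfolding f_def by (simp add: sums_iff power_mult_distrib mult_ac)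
  qed
  have "(\<lambda>k. integral\<^sup>L lborel (f k)) sums (LINT \<sigma>|lborel. (\<Sum>k. f k \<sigma>))"
    by (rule sums_integral[OF f_int ab sm])
  moreover have "(\<lambda>k. integral\<^sup>L lborel (f k)) sums (bump_mass m * Gamma (m + 3/2) * bessel_entire ?\<mu> (s\<^sup>2 / 4))"
    unfolding fv bessel_entire_def by (intro sums_mult summable_sums summable_bessel_coeff \<mu>)
  ultimately show ?thesis unfolding eq by (simp add: sums_unique2 mult.assoc)
qed

section \<open>The averaged kernel\<close>

text \<open>The integrand of \<open>transmutation\<close> in the variable z = x + s u: the factor
  1/2 and du = dz/s turn s^2/(2 x z) into s/(4 x z), and the Legendre argument is
  \<open>trho\<close>.\<close>

definition wave_kernel :: "real \<Rightarrow> real \<Rightarrow> real \<Rightarrow> real \<Rightarrow> real" where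
  "wave_kernel q x s z = s / (4 * x * z) * legendre1 q ((s\<^sup>2 - (z - x)\<^sup>2) / (4 * x * z))"

text \<open>Averaging \<open>transmutation\<close> over \<open>\<tau> = t \<sigma>\<close> with weight \<open>bump m \<sigma>\<close>: the d'Alembert part gives the
  singular term of \<open>avg_kernel\<close>, the Riemann function the bounded term \<open>wave_corr\<close>.\<close>
definition wave_corr :: "real \<Rightarrow> real \<Rightarrow> real \<Rightarrow> real \<Rightarrow> real \<Rightarrow> real" where
  "wave_corr q m t x z =
     (LINT \<sigma>|lborel. bump m \<sigma> * (if \<bar>z - x\<bar> < t * \<bar>\<sigma>\<bar> then wave_kernel q x (t * \<bar>\<sigma>\<bar>) z else 0)) / bump_mass m"

definition avg_kernel :: "real \<Rightarrow> real \<Rightarrow> real \<Rightarrow> real \<Rightarrow> real \<Rightarrow> real" where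
  "avg_kernel q m t x z = bump m ((z - x) / t) / (t * bump_mass m) + wave_corr q m t x z"

lemma borel_measurable_legendre1 [measurable]: "legendre1 q \<in> borel_measurable borel"
  unfolding legendre1_def[abs_def] by measurable

lemma wave_kernel_measurable [measurable]:
  "(\<lambda>p. bump m (fst p) * (if \<bar>snd p - x\<bar> < t * \<bar>fst p\<bar> then wave_kernel q x (t * \<bar>fst p\<bar>) (snd p) else 0))
     \<in> borel_measurable (lborel \<Otimes>\<^sub>M lborel)"
  unfolding wave_kernel_def by measurable

text \<open>For s < x/2 and |z - x| < s the numerator of the Legendre argument is at most x^2/4 and
  its denominator at least 2 x^2. The argument thus lies between 0 and 1/8, where the derivatives of
  the Legendre function are bounded. The bound of order s makes the correction small; the Lipschitz
  bound is for Hankel inversion.\<close>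

lemma wave_kernel_bounds:
  assumes x: "x > 0"
  obtains C where "C \<ge> 0"
    "\<And>s z. s < x / 2 \<Longrightarrow> \<bar>z - x\<bar> < s \<Longrightarrow> \<bar>wave_kernel q x s z\<bar> \<le> C * s"
    "\<And>s z w. s < x / 2 \<Longrightarrow> \<bar>z - x\<bar> < s \<Longrightarrow> \<bar>w - x\<bar> < s \<Longrightarrow>
       \<bar>wave_kernel q x s w - wave_kernel q x s z\<bar> \<le> C * \<bar>w - z\<bar>"
proof -
  have "continuous_on {0..1/8} (legendre1 q)" "continuous_on {0..1/8} (legendre2 q)"
    by (rule continuous_on_subset[OF continuous_on_legendre1] continuous_on_subset[OF continuous_on_legendre2]; force)+
  then have "bounded (legendre1 q ` {0..1/8})" "bounded (legendre2 q ` {0..1/8})"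
    by (auto intro!: compact_imp_bounded compact_continuous_image)
  then obtain M1 M2 where M1: "\<And>r. r \<in> {0..1/8} \<Longrightarrow> \<bar>legendre1 q r\<bar> \<le> M1"
    and M2: "\<And>r. r \<in> {0..1/8} \<Longrightarrow> \<bar>legendre2 q r\<bar> \<le> M2"
    unfolding bounded_iff by (metis imageI real_norm_def)
  define M where "M = max M1 M2"
  have M: "\<bar>legendre1 q r\<bar> \<le> M" "\<bar>legendre2 q r\<bar> \<le> M" if "r \<in> {0..1/8}" for r
    using M1[OF that] M2[OF that] by (auto simp: M_def)
  have M0: "M \<ge> 0" using M(1)[of 0] by simp
  define r where "r s z = (s\<^sup>2 - (z - x)\<^sup>2) / (4 * x * z)" for s z
  have z: "z > x / 2" "z > 0" if "s < x / 2" "\<bar>z - x\<bar> < s" for s z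
    using that x by linarith+
  have r: "r s z \<in> {0..1/8}" if h: "s < x / 2" "\<bar>z - x\<bar> < s" for s z
  proof -
    have "(z - x)\<^sup>2 \<le> s\<^sup>2" using h by (intro abs_le_square_iff[THEN iffD1]) auto
    moreover have "s\<^sup>2 \<le> (x / 2)\<^sup>2" using h by (intro power_mono) auto
    moreover have "4 * x * z \<ge> 4 * x * (x / 2)" using z(1)[OF h] x by (intro mult_left_mono) auto
    ultimately have "s\<^sup>2 - (z - x)\<^sup>2 \<le> 1/8 * (4 * x * z)" "0 \<le> s\<^sup>2 - (z - x)\<^sup>2"
      using zero_le_power2[of "z - x"] by (auto simp: power2_eq_square field_simps)
    then show ?thesis using z(2)[OF h] x unfolding r_def by (simp add: pos_divide_le_eq)
  qed
  have lin: "s / (4 * x * z) \<le> s / (2 * x\<^sup>2)" if h: "s < x / 2" "\<bar>z - x\<bar> < s" for s z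
  proof (rule divide_left_mono)
    show "2 * x\<^sup>2 \<le> 4 * x * z"
      using mult_left_mono[of "x / 2" z "4 * x"] z(1)[OF h] x by (simp add: power2_eq_square)
  qed (use h z(2)[OF h] x in auto)
  show thesis
  proof (rule that[of "M / x\<^sup>2"])
    show "M / x\<^sup>2 \<ge> 0" using M0 by simp
  next
    fix s z assume h: "s < x / 2" "\<bar>z - x\<bar> < s"
    have "\<bar>wave_kernel q x s z\<bar> = s / (4 * x * z) * \<bar>legendre1 q (r s z)\<bar>"
      using h z(2)[OF h] x unfolding wave_kernel_def r_def by (simp add: abs_mult)
    also have "\<dots> \<le> s / (2 * x\<^sup>2) * M"
      using h x by (intro mult_mono lin[OF h] M r[OF h]) auto
    also have "\<dots> \<le> s / x\<^sup>2 * M"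
      using h x M0 by (intro mult_right_mono divide_left_mono) auto
    finally show "\<bar>wave_kernel q x s z\<bar> \<le> M / x\<^sup>2 * s" by (simp add: mult.commute)
  next
    fix s z w assume h: "s < x / 2" "\<bar>z - x\<bar> < s" "\<bar>w - x\<bar> < s"
    define rz where "rz z = - 2 * (z - x) / (4 * x * z) - r s z / z" for z
    define d where "d z = - (s / (4 * x * z\<^sup>2)) * legendre1 q (r s z) + legendre2 q (r s z) * rz z * (s / (4 * x * z))" for z
    have "norm (wave_kernel q x s w - wave_kernel q x s z) \<le> M / x\<^sup>2 * norm (w - z)"
    proof (rule field_differentiable_bound[where S = "{x - s<..<x + s}" and f' = d])
      fix v assume "v \<in> {x - s<..<x + s}"
      then have v: "\<bar>v - x\<bar> < s" by (auto simp: abs_less_iff)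
      note vp = z[OF h(1) v] and rv = r[OF h(1) v]
      have 1: "((\<lambda>v. s / (4 * x * v)) has_real_derivative - (s / (4 * x * v\<^sup>2))) (at v)"
        using vp x by (auto intro!: derivative_eq_intros simp: field_simps power2_eq_square)
      have n: "((\<lambda>v. s\<^sup>2 - (v - x)\<^sup>2) has_real_derivative - 2 * (v - x)) (at v)"
        and dn: "((\<lambda>v. 4 * x * v) has_real_derivative 4 * x) (at v)"
        by (auto intro!: derivative_eq_intros)
      have "((\<lambda>v. r s v) has_real_derivative ((- 2 * (v - x)) * (4 * x * v) - (s\<^sup>2 - (v - x)\<^sup>2) * (4 * x)) / ((4 * x * v) * (4 * x * v))) (at v)"
        unfolding r_def using vp x by (intro DERIV_divide n dn) auto
      moreover have "((- 2 * (v - x)) * (4 * x * v) - (s\<^sup>2 - (v - x)\<^sup>2) * (4 * x)) / ((4 * x * v) * (4 * x * v)) = rz v"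
      proof -
        have "(a * D - N * (4 * x)) / (D * D) = a / D - N / D / v" if "D = 4 * x * v" for a D N
          using vp x by (simp add: that divide_simps) (simp add: algebra_simps)
        then show ?thesis unfolding rz_def r_def by blast
      qed
      ultimately have 2: "((\<lambda>v. r s v) has_real_derivative rz v) (at v)" by simp
      have rl: "\<bar>r s v\<bar> < 1" using rv by auto
      note 3 = DERIV_chain2[OF has_real_derivative_legendre1[OF rl] 2, of q]
      have "((\<lambda>v. wave_kernel q x s v) has_real_derivative d v) (at v)"
        unfolding wave_kernel_def r_def[symmetric] d_def by (rule DERIV_mult[OF 1 3])
      then show "(wave_kernel q x s has_field_derivative d v) (at v within {x - s<..<x + s})"
        by (rule has_field_derivative_at_within)
      have sp: "s > 0" using v by linarith
      have a: "s / (4 * x * v\<^sup>2) \<le> 1 / (2 * x\<^sup>2)"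
      proof -
        have "s / (4 * x * v\<^sup>2) = s / (4 * x * v) / v" by (simp add: power2_eq_square)
        also have "\<dots> \<le> (s / (2 * x\<^sup>2)) / (x / 2)"
          using vp x sp by (intro frac_le lin[OF h(1) v]) auto
        also have "\<dots> \<le> ((x / 2) / (2 * x\<^sup>2)) / (x / 2)"
          using h x by (intro divide_right_mono) auto
        finally show ?thesis using x by simp
      qed
      have b: "\<bar>rz v\<bar> \<le> 1 / x"
      proof -
        have "\<bar>- 2 * (v - x) / (4 * x * v)\<bar> = 2 * \<bar>v - x\<bar> / (4 * x * v)"
          unfolding abs_divide abs_mult using vp x by simp
        also have "\<dots> \<le> 2 * (s / (4 * x * v))" using v vp x by (simp add: divide_right_mono)
        also have "\<dots> \<le> 2 * (s / (2 * x\<^sup>2))" using lin[OF h(1) v] by (intro mult_left_mono) auto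
        also have "\<dots> \<le> 2 * ((x / 2) / (2 * x\<^sup>2))" using h x by (intro mult_left_mono divide_right_mono) auto
        finally have b1: "\<bar>- 2 * (v - x) / (4 * x * v)\<bar> \<le> 1 / (2 * x)" using x by (simp add: power2_eq_square)
        have "\<bar>r s v / v\<bar> \<le> (1/8) / (x / 2)"
          using rv vp x by (simp only: abs_divide) (intro frac_le; simp)
        then have b2: "\<bar>r s v / v\<bar> \<le> 1 / (4 * x)" by simp
        have "1 / (2 * x) + 1 / (4 * x) \<le> 1 / x" using x by (simp add: field_simps)
        then show ?thesis unfolding rz_def
          using abs_triangle_ineq4[of "- 2 * (v - x) / (4 * x * v)" "r s v / v"] b1 b2 by linarith
      qed
      have c: "s / (4 * x * v) \<le> 1 / (4 * x)"
      proof -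
        have "s / (2 * x\<^sup>2) \<le> (x / 2) / (2 * x\<^sup>2)" using h x by (intro divide_right_mono) auto
        also have "\<dots> = 1 / (4 * x)" using x by (simp add: power2_eq_square)
        finally show ?thesis using lin[OF h(1) v] by linarith
      qed
      have "\<bar>d v\<bar> \<le> \<bar>s / (4 * x * v\<^sup>2)\<bar> * \<bar>legendre1 q (r s v)\<bar> + \<bar>legendre2 q (r s v)\<bar> * \<bar>rz v\<bar> * \<bar>s / (4 * x * v)\<bar>"
        unfolding d_def by (rule order_trans[OF abs_triangle_ineq]) (simp add: abs_mult)
      also have "\<dots> \<le> 1 / (2 * x\<^sup>2) * M + M * (1 / x) * (1 / (4 * x))"
        using a c sp vp x M0 by (intro add_mono mult_mono M rv b) auto
      also have "\<dots> \<le> M / x\<^sup>2"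
        using x M0 by (simp add: power2_eq_square field_simps)
      finally show "norm (d v) \<le> M / x\<^sup>2" by simp
    qed (use h in \<open>auto simp: abs_less_iff\<close>)
    then show "\<bar>wave_kernel q x s w - wave_kernel q x s z\<bar> \<le> M / x\<^sup>2 * \<bar>w - z\<bar>" by simp
  qed
qed

lemma wave_corr_integrand_integrable:
  assumes x: "x > 0" and t: "0 < t" "t < x / 2" and m: "m > -1"
  shows "integrable lborel (\<lambda>\<sigma>. bump m \<sigma> * (if \<bar>z - x\<bar> < t * \<bar>\<sigma>\<bar> then wave_kernel q x (t * \<bar>\<sigma>\<bar>) z else 0))"
proof -
  obtain C where C: "C \<ge> 0"
    "\<And>s z. s < x / 2 \<Longrightarrow> \<bar>z - x\<bar> < s \<Longrightarrow> \<bar>wave_kernel q x s z\<bar> \<le> C * s"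
    "\<And>s z w. s < x / 2 \<Longrightarrow> \<bar>z - x\<bar> < s \<Longrightarrow> \<bar>w - x\<bar> < s \<Longrightarrow>
       \<bar>wave_kernel q x s w - wave_kernel q x s z\<bar> \<le> C * \<bar>w - z\<bar>"
    by (rule wave_kernel_bounds[OF x, of q]) (rule that)
  show ?thesis
  proof (rule Bochner_Integration.integrable_bound[OF integrable_mult_right[OF integrable_bump[OF m], of "C * t"]])
    show "AE \<sigma> in lborel. norm (bump m \<sigma> * (if \<bar>z - x\<bar> < t * \<bar>\<sigma>\<bar> then wave_kernel q x (t * \<bar>\<sigma>\<bar>) z else 0)) \<le> norm (C * t * bump m \<sigma>)"
    proof (rule AE_I2)
      fix \<sigma> :: real
      show "norm (bump m \<sigma> * (if \<bar>z - x\<bar> < t * \<bar>\<sigma>\<bar> then wave_kernel q x (t * \<bar>\<sigma>\<bar>) z else 0)) \<le> norm (C * t * bump m \<sigma>)"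
      proof (cases "\<bar>\<sigma>\<bar> < 1 \<and> \<bar>z - x\<bar> < t * \<bar>\<sigma>\<bar>")
        case True
        have ts: "t * \<bar>\<sigma>\<bar> \<le> t" using mult_left_mono[of "\<bar>\<sigma>\<bar>" 1 t] True t by simp
        have "\<bar>wave_kernel q x (t * \<bar>\<sigma>\<bar>) z\<bar> \<le> C * (t * \<bar>\<sigma>\<bar>)" by (rule C(2)) (use True ts t in linarith)+
        also have "\<dots> \<le> C * t" using ts C(1) by (intro mult_left_mono) auto
        finally have "\<bar>bump m \<sigma>\<bar> * \<bar>wave_kernel q x (t * \<bar>\<sigma>\<bar>) z\<bar> \<le> \<bar>bump m \<sigma>\<bar> * (C * t)"
          by (rule mult_left_mono) simp
        then show ?thesis using True C(1) t by (simp add: abs_mult mult_ac)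
      next
        case False
        then show ?thesis by (auto simp: bump_eq_0)
      qed
    qed
    have "(\<lambda>\<sigma>. (\<sigma>, z)) \<in> lborel \<rightarrow>\<^sub>M lborel \<Otimes>\<^sub>M lborel" by measurable
    from measurable_compose[OF this wave_kernel_measurable[of m x t q]]
    show "(\<lambda>\<sigma>. bump m \<sigma> * (if \<bar>z - x\<bar> < t * \<bar>\<sigma>\<bar> then wave_kernel q x (t * \<bar>\<sigma>\<bar>) z else 0)) \<in> borel_measurable lborel"
      by (simp only: fst_conv snd_conv)
  qed
qed

lemma borel_measurable_wave_corr [measurable]: "wave_corr q m t x \<in> borel_measurable borel"
proof -
  have [measurable]: "(\<lambda>(z, \<sigma>). bump m \<sigma> * (if \<bar>z - x\<bar> < t * \<bar>\<sigma>\<bar> then wave_kernel q x (t * \<bar>\<sigma>\<bar>) z else 0))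
     \<in> borel_measurable (borel \<Otimes>\<^sub>M lborel)"
    unfolding wave_kernel_def by measurable
  show ?thesis unfolding wave_corr_def[abs_def] by measurable
qed

lemma borel_measurable_avg_kernel [measurable]: "avg_kernel q m t x \<in> borel_measurable borel"
  unfolding avg_kernel_def[abs_def] by measurable

lemma wave_corr_bound:
  assumes x: "x > 0" and m: "m > -1"
  obtains C where "C \<ge> 0" "\<And>t z. 0 < t \<Longrightarrow> t < x / 2 \<Longrightarrow> \<bar>wave_corr q m t x z\<bar> \<le> C * t"
proof -
  obtain C where C: "C \<ge> 0"
    "\<And>s z. s < x / 2 \<Longrightarrow> \<bar>z - x\<bar> < s \<Longrightarrow> \<bar>wave_kernel q x s z\<bar> \<le> C * s"
    "\<And>s z w. s < x / 2 \<Longrightarrow> \<bar>z - x\<bar> < s \<Longrightarrow> \<bar>w - x\<bar> < s \<Longrightarrow>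
       \<bar>wave_kernel q x s w - wave_kernel q x s z\<bar> \<le> C * \<bar>w - z\<bar>"
    by (rule wave_kernel_bounds[OF x, of q]) (rule that)
  show thesis
  proof (rule that[OF C(1)])
    fix t z :: real assume t: "0 < t" "t < x / 2"
    let ?f = "\<lambda>\<sigma>. bump m \<sigma> * (if \<bar>z - x\<bar> < t * \<bar>\<sigma>\<bar> then wave_kernel q x (t * \<bar>\<sigma>\<bar>) z else 0)"
    have "\<bar>integral\<^sup>L lborel ?f\<bar> \<le> (LINT \<sigma>|lborel. \<bar>?f \<sigma>\<bar>)" by (rule integral_abs_bound)
    also have "\<dots> \<le> (LINT \<sigma>|lborel. C * t * bump m \<sigma>)"
    proof (rule integral_mono)
      show "integrable lborel (\<lambda>\<sigma>. \<bar>?f \<sigma>\<bar>)"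
        by (rule integrable_abs[OF wave_corr_integrand_integrable[OF x t m]])
      show "integrable lborel (\<lambda>\<sigma>. C * t * bump m \<sigma>)" by (rule integrable_mult_right[OF integrable_bump[OF m]])
      fix \<sigma> :: real
      show "\<bar>?f \<sigma>\<bar> \<le> C * t * bump m \<sigma>"
      proof (cases "\<bar>\<sigma>\<bar> < 1 \<and> \<bar>z - x\<bar> < t * \<bar>\<sigma>\<bar>")
        case True
        have ts: "t * \<bar>\<sigma>\<bar> \<le> t" using mult_left_mono[of "\<bar>\<sigma>\<bar>" 1 t] True t by simp
        have "\<bar>wave_kernel q x (t * \<bar>\<sigma>\<bar>) z\<bar> \<le> C * (t * \<bar>\<sigma>\<bar>)" by (rule C(2)) (use True ts t in linarith)+
        also have "\<dots> \<le> C * t" using ts C(1) by (intro mult_left_mono) auto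
        finally have "bump m \<sigma> * \<bar>wave_kernel q x (t * \<bar>\<sigma>\<bar>) z\<bar> \<le> bump m \<sigma> * (C * t)"
          by (rule mult_left_mono[OF _ bump_nonneg])
        then show ?thesis using True bump_nonneg[of m \<sigma>] by (simp add: abs_mult mult_ac)
      next
        case False
        then show ?thesis using C(1) t bump_nonneg[of m \<sigma>] by (auto simp: bump_eq_0)
      qed
    qed
    also have "\<dots> = C * t * bump_mass m" by (simp add: bump_mass_def)
    finally show "\<bar>wave_corr q m t x z\<bar> \<le> C * t"
      unfolding wave_corr_def using bump_mass_pos[OF m] by (simp add: pos_divide_le_eq)
  qed
qed

lemma wave_corr_eq_0:
  assumes "\<bar>z - x\<bar> \<ge> t" "t > 0"
  shows "wave_corr q m t x z = 0"
proof -
  have *: "bump m \<sigma> * (if \<bar>z - x\<bar> < t * \<bar>\<sigma>\<bar> then wave_kernel q x (t * \<bar>\<sigma>\<bar>) z else 0) = 0" for \<sigma>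
  proof (cases "\<bar>\<sigma>\<bar> < 1")
    case True
    then have "t * \<bar>\<sigma>\<bar> \<le> t" using mult_left_mono[of "\<bar>\<sigma>\<bar>" 1 t] assms by simp
    then have "\<not> \<bar>z - x\<bar> < t * \<bar>\<sigma>\<bar>" using assms by linarith
    then show ?thesis by simp
  qed (simp add: bump_eq_0)
  show ?thesis unfolding wave_corr_def * by simp
qed

lemma avg_kernel_eq_0:
  assumes "\<bar>z - x\<bar> \<ge> t" "t > 0"
  shows "avg_kernel q m t x z = 0"
  unfolding avg_kernel_def using assms by (simp add: wave_corr_eq_0 bump_eq_0)

section \<open>Local Lipschitz continuity of the averaged kernel\<close>

lemma bump_differentiable:
  assumes "\<bar>\<sigma>\<bar> < 1"
  shows "(bump m has_real_derivative m * (1 - \<sigma>\<^sup>2) powr (m - 1) * (- 2 * \<sigma>)) (at \<sigma>)"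
proof (rule has_field_derivative_transform_within_open[where S = "{-1<..<1}"])
  have "((\<lambda>\<sigma>. 1 - \<sigma>\<^sup>2) has_real_derivative - 2 * \<sigma>) (at \<sigma>)"
    by (auto intro!: derivative_eq_intros)
  from DERIV_fun_powr[OF this, of m]
  show "((\<lambda>\<sigma>. (1 - \<sigma>\<^sup>2) powr m) has_real_derivative m * (1 - \<sigma>\<^sup>2) powr (m - 1) * (- 2 * \<sigma>)) (at \<sigma>)"
    using assms by (simp add: abs_square_less_1)
qed (use assms in \<open>auto simp: bump_def abs_less_iff\<close>)

lemma bump_le_inside:
  assumes "a < 1" "\<bar>\<sigma>\<bar> \<le> a"
  shows "bump m \<sigma> \<le> max 1 ((1 - a\<^sup>2) powr m)"
proof -
  have s: "\<bar>\<sigma>\<bar> < 1" using assms by linarith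
  have a0: "0 \<le> a" using assms by linarith
  have sq: "\<sigma>\<^sup>2 \<le> a\<^sup>2" using assms(2) a0 by (simp add: abs_le_square_iff[symmetric])
  have a1: "a\<^sup>2 < 1" using assms a0 by (simp add: abs_square_less_1)
  show ?thesis
  proof (cases "m \<ge> 0")
    case True
    have "(1 - \<sigma>\<^sup>2) powr m \<le> 1 powr m" using sq a1 True by (intro powr_mono2) auto
    then show ?thesis using s by (simp add: bump_def)
  next
    case False
    have "(1 - \<sigma>\<^sup>2) powr m \<le> (1 - a\<^sup>2) powr m" using sq a1 False by (intro powr_mono2') auto
    then show ?thesis using s by (simp add: bump_def)
  qed
qed

text \<open>The cutoff |z - x| < t |\<sigma>| moves with z, so the integrand jumps and is not
  Lipschitz for each \<sigma>. The set of \<sigma> on which exactly one of the cutoffs for w and z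
  is open has length of order |w - z|/t and stays away from 1 and -1, where the bump may be
  unbounded.\<close>

lemma wave_corr_Lipschitz:
  assumes x: "x > 0" and t: "0 < t" "t < x / 2" and m: "m > -1" and z: "\<bar>z - x\<bar> < t"
  obtains \<delta> L where "\<delta> > 0" "\<And>w. \<bar>w - z\<bar> < \<delta> \<Longrightarrow> \<bar>wave_corr q m t x w - wave_corr q m t x z\<bar> \<le> L * \<bar>w - z\<bar>"
proof -
  obtain C where C: "C \<ge> 0"
    "\<And>s z. s < x / 2 \<Longrightarrow> \<bar>z - x\<bar> < s \<Longrightarrow> \<bar>wave_kernel q x s z\<bar> \<le> C * s"
    "\<And>s z w. s < x / 2 \<Longrightarrow> \<bar>z - x\<bar> < s \<Longrightarrow> \<bar>w - x\<bar> < s \<Longrightarrow>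
       \<bar>wave_kernel q x s w - wave_kernel q x s z\<bar> \<le> C * \<bar>w - z\<bar>"
    by (rule wave_kernel_bounds[OF x, of q]) (rule that)
  define a0 where "a0 = \<bar>z - x\<bar> / t"
  \<comment> \<open>The midpoint of \<open>a0\<close> and 1: w may move a little while the affected
    \<sigma> stay in a region where \<open>V\<close> bounds the bump.\<close>
  define a1 where "a1 = (1 + a0) / 2"
  have "0 \<le> a0" "a0 < 1" using z t by (simp_all add: a0_def)
  then have a: "0 \<le> a0" "a0 < 1" "a0 < a1" "a1 < 1" by (simp_all add: a1_def)
  define V where "V = max 1 ((1 - a1\<^sup>2) powr m)"
  have V: "V \<ge> 0" "\<And>\<sigma>. \<bar>\<sigma>\<bar> \<le> a1 \<Longrightarrow> bump m \<sigma> \<le> V"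
    using bump_le_inside[OF a(4)] by (auto simp: V_def)
  define B where "B = bump_mass m"
  have B: "B > 0" using bump_mass_pos[OF m] by (simp add: B_def)
  define f where "f w \<sigma> = bump m \<sigma> * (if \<bar>w - x\<bar> < t * \<bar>\<sigma>\<bar> then wave_kernel q x (t * \<bar>\<sigma>\<bar>) w else 0)" for w \<sigma>
  have f_int: "integrable lborel (f w)" for w
    unfolding f_def by (rule wave_corr_integrand_integrable[OF x t m])
  define \<delta> where "\<delta> = t * (a1 - a0)"
  have \<delta>: "\<delta> > 0" using t a by (simp add: \<delta>_def)
  show thesis
  proof (rule that[OF \<delta>, of "C + 4 * C * V / B"])
    fix w assume w: "\<bar>w - z\<bar> < \<delta>"
    define d where "d = \<bar>w - z\<bar> / t"
    have d: "0 \<le> d" "d < a1 - a0" "t * d = \<bar>w - z\<bar>" using w t by (auto simp: d_def \<delta>_def pos_divide_less_eq mult.commute)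
    \<comment> \<open>The first term covers \<sigma> with both cutoffs open. If exactly one is open,
      |\<sigma>| is within \<open>d\<close> of \<open>a0\<close>; the two intervals have total
      length 4 d, the source of the 4 in the Lipschitz constant.\<close>
    define G where "G \<sigma> = C * \<bar>w - z\<bar> * bump m \<sigma> + C * t * V * (indicator {a0 - d..a0 + d} \<sigma> + indicator {- a0 - d..- a0 + d} \<sigma>)" for \<sigma> :: real
    have ind: "integrable lborel (indicator {a..b} :: real \<Rightarrow> real)" for a b :: real
      by (intro integrable_real_indicator) (auto simp: emeasure_lborel_Icc_eq)
    have G_int: "integrable lborel G"
      unfolding G_def by (intro Bochner_Integration.integrable_add integrable_mult_right integrable_bump m ind)
    have G_val: "integral\<^sup>L lborel G = C * \<bar>w - z\<bar> * B + C * t * V * (4 * d)"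
      unfolding G_def B_def bump_mass_def using integrable_bump[OF m] ind d(1) by simp
    have bd: "\<bar>f w \<sigma> - f z \<sigma>\<bar> \<le> G \<sigma>" for \<sigma>
    proof (cases "\<bar>\<sigma>\<bar> < 1")
      case True
      have tt: "t * \<bar>\<sigma>\<bar> \<le> t" using mult_left_mono[of "\<bar>\<sigma>\<bar>" 1 t] True t by simp
      then have ts: "t * \<bar>\<sigma>\<bar> < x / 2" using t by linarith
      have nn: "0 \<le> C * \<bar>w - z\<bar> * bump m \<sigma>" "0 \<le> C * t * V * (indicator {a0 - d..a0 + d} \<sigma> + indicator {- a0 - d..- a0 + d} \<sigma>)"
        using C(1) V(1) t bump_nonneg[of m \<sigma>] by (auto simp: indicator_def)
      have az: "\<bar>z - x\<bar> = t * a0" using t by (simp add: a0_def)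
      have wz: "\<bar>\<bar>w - x\<bar> - t * a0\<bar> \<le> t * d" unfolding az[symmetric] d(3) by linarith
      consider "\<bar>w - x\<bar> < t * \<bar>\<sigma>\<bar>" "\<bar>z - x\<bar> < t * \<bar>\<sigma>\<bar>" | "\<not> \<bar>w - x\<bar> < t * \<bar>\<sigma>\<bar>" "\<not> \<bar>z - x\<bar> < t * \<bar>\<sigma>\<bar>"
        | "\<bar>w - x\<bar> < t * \<bar>\<sigma>\<bar>" "\<not> \<bar>z - x\<bar> < t * \<bar>\<sigma>\<bar>" | "\<not> \<bar>w - x\<bar> < t * \<bar>\<sigma>\<bar>" "\<bar>z - x\<bar> < t * \<bar>\<sigma>\<bar>" by blast
      then show ?thesis
      proof cases
        case 1
        have "f w \<sigma> - f z \<sigma> = bump m \<sigma> * (wave_kernel q x (t * \<bar>\<sigma>\<bar>) w - wave_kernel q x (t * \<bar>\<sigma>\<bar>) z)"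
          unfolding f_def using 1 by (simp add: algebra_simps)
        also have "\<bar>\<dots>\<bar> = bump m \<sigma> * \<bar>wave_kernel q x (t * \<bar>\<sigma>\<bar>) w - wave_kernel q x (t * \<bar>\<sigma>\<bar>) z\<bar>"
          using bump_nonneg[of m \<sigma>] by (simp add: abs_mult)
        also have "\<dots> \<le> bump m \<sigma> * (C * \<bar>w - z\<bar>)"
          by (rule mult_left_mono[OF C(3)[OF ts 1(2,1)] bump_nonneg])
        finally show ?thesis using nn unfolding G_def by (simp add: mult_ac)
      next
        case 2
        then show ?thesis using nn unfolding f_def G_def by simp
      next
        case 3
        then have "t * \<bar>\<sigma>\<bar> \<le> t * a0" "t * (a0 - d) \<le> t * \<bar>\<sigma>\<bar>" using wz az by (auto simp: right_diff_distrib)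
        then have s: "\<bar>\<sigma>\<bar> \<le> a0" "a0 - d \<le> \<bar>\<sigma>\<bar>" using t by auto
        then have i: "1 \<le> indicator {a0 - d..a0 + d} \<sigma> + (indicator {- a0 - d..- a0 + d} \<sigma> :: real)"
          using d(1) by (cases "\<sigma> \<ge> 0") (auto simp: indicator_def)
        have "\<bar>f w \<sigma> - f z \<sigma>\<bar> = bump m \<sigma> * \<bar>wave_kernel q x (t * \<bar>\<sigma>\<bar>) w\<bar>"
          using 3 bump_nonneg[of m \<sigma>] by (simp add: f_def abs_mult)
        also have "\<dots> \<le> V * (C * (t * \<bar>\<sigma>\<bar>))"
          using s a V(1) by (intro mult_mono V(2) C(2)[OF ts 3(1)]) auto
        also have "\<dots> \<le> V * (C * t)" using V(1) C(1) tt by (intro mult_left_mono) auto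
        also have "\<dots> \<le> C * t * V * (indicator {a0 - d..a0 + d} \<sigma> + indicator {- a0 - d..- a0 + d} \<sigma>)"
          using mult_left_mono[OF i, of "C * t * V"] V(1) C(1) t by (simp add: mult_ac)
        finally show ?thesis using nn(1) unfolding G_def by linarith
      next
        case 4
        then have "t * \<bar>\<sigma>\<bar> \<le> t * (a0 + d)" "t * a0 \<le> t * \<bar>\<sigma>\<bar>" using wz az by (auto simp: distrib_left)
        then have s: "\<bar>\<sigma>\<bar> \<le> a0 + d" "a0 \<le> \<bar>\<sigma>\<bar>" using t by auto
        then have i: "1 \<le> indicator {a0 - d..a0 + d} \<sigma> + (indicator {- a0 - d..- a0 + d} \<sigma> :: real)"
          using d(1) by (cases "\<sigma> \<ge> 0") (auto simp: indicator_def)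
        have "\<bar>f w \<sigma> - f z \<sigma>\<bar> = bump m \<sigma> * \<bar>wave_kernel q x (t * \<bar>\<sigma>\<bar>) z\<bar>"
          using 4 bump_nonneg[of m \<sigma>] by (simp add: f_def abs_mult)
        also have "\<dots> \<le> V * (C * (t * \<bar>\<sigma>\<bar>))"
          using s d a V(1) by (intro mult_mono V(2) C(2)[OF ts 4(2)]) auto
        also have "\<dots> \<le> V * (C * t)" using V(1) C(1) tt by (intro mult_left_mono) auto
        also have "\<dots> \<le> C * t * V * (indicator {a0 - d..a0 + d} \<sigma> + indicator {- a0 - d..- a0 + d} \<sigma>)"
          using mult_left_mono[OF i, of "C * t * V"] V(1) C(1) t by (simp add: mult_ac)
        finally show ?thesis using nn(1) unfolding G_def by linarith
      qed
    next
      case False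
      then show ?thesis using C(1) V(1) t by (auto simp: f_def G_def bump_eq_0 indicator_def)
    qed
    have "\<bar>integral\<^sup>L lborel (f w) - integral\<^sup>L lborel (f z)\<bar> = \<bar>LINT \<sigma>|lborel. f w \<sigma> - f z \<sigma>\<bar>"
      using f_int by simp
    also have "\<dots> \<le> (LINT \<sigma>|lborel. \<bar>f w \<sigma> - f z \<sigma>\<bar>)" by (rule integral_abs_bound)
    also have "\<dots> \<le> integral\<^sup>L lborel G"
      by (rule integral_mono) (use f_int G_int bd in auto)
    also have "\<dots> = (C * B + 4 * C * V) * \<bar>w - z\<bar>" unfolding G_val d(3)[symmetric] by (simp add: algebra_simps)
    finally have "\<bar>integral\<^sup>L lborel (f w) - integral\<^sup>L lborel (f z)\<bar> / B \<le> (C * B + 4 * C * V) * \<bar>w - z\<bar> / B"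
      using B by (intro divide_right_mono) auto
    moreover have "(C * B + 4 * C * V) * \<bar>w - z\<bar> / B = (C + 4 * C * V / B) * \<bar>w - z\<bar>"
      using B by (simp add: add_divide_distrib distrib_right)
    moreover have "\<bar>wave_corr q m t x w - wave_corr q m t x z\<bar> = \<bar>integral\<^sup>L lborel (f w) - integral\<^sup>L lborel (f z)\<bar> / B"
      unfolding wave_corr_def f_def[abs_def] B_def[symmetric] using B by (simp add: abs_divide flip: diff_divide_distrib)
    ultimately show "\<bar>wave_corr q m t x w - wave_corr q m t x z\<bar> \<le> (C + 4 * C * V / B) * \<bar>w - z\<bar>" by simp
  qed
qed

text \<open>The exclusion of |z - x| = t is what makes this true: for m < 1 the bump is not
  Lipschitz at the edge of its support. Inside it is differentiable, and outside the kernel vanishes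
  on a neighbourhood of z.\<close>

lemma avg_kernel_Lipschitz:
  assumes x: "x > 0" and t: "0 < t" "t < x / 2" and m: "m > -1" and z: "\<bar>z - x\<bar> \<noteq> t"
  obtains \<delta> L where "\<delta> > 0" "\<And>w. \<bar>w - z\<bar> < \<delta> \<Longrightarrow> \<bar>avg_kernel q m t x w - avg_kernel q m t x z\<bar> \<le> L * \<bar>w - z\<bar>"
proof (cases "\<bar>z - x\<bar> < t")
  case True
  obtain \<delta>1 L1 where 1: "\<delta>1 > 0" "\<And>w. \<bar>w - z\<bar> < \<delta>1 \<Longrightarrow> \<bar>wave_corr q m t x w - wave_corr q m t x z\<bar> \<le> L1 * \<bar>w - z\<bar>"
    by (rule wave_corr_Lipschitz[OF x t m True, of q]) (rule that)
  define E where "E = m * (1 - ((z - x) / t)\<^sup>2) powr (m - 1) * (- 2 * ((z - x) / t)) * (1 / t) / (t * bump_mass m)"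
  have "\<bar>(z - x) / t\<bar> < 1" using True t by (simp add: abs_divide)
  from bump_differentiable[OF this, of m]
  have "((\<lambda>w. bump m ((w - x) / t) / (t * bump_mass m)) has_real_derivative E) (at z)"
    unfolding E_def using t
    by (intro DERIV_cdivide DERIV_chain2[where g = "\<lambda>w. (w - x) / t"]) (auto intro!: derivative_eq_intros)
  then obtain \<delta>2 where 2: "\<delta>2 > 0" "\<And>w. \<bar>w - z\<bar> < \<delta>2 \<Longrightarrow>
    \<bar>bump m ((w - x) / t) / (t * bump_mass m) - bump m ((z - x) / t) / (t * bump_mass m)\<bar> \<le> (\<bar>E\<bar> + 1) * \<bar>w - z\<bar>"
    by (rule DERIV_imp_local_Lipschitz) (rule that)
  show thesis
  proof (rule that[of "min \<delta>1 \<delta>2" "(\<bar>E\<bar> + 1) + L1"])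
    fix w assume "\<bar>w - z\<bar> < min \<delta>1 \<delta>2"
    then show "\<bar>avg_kernel q m t x w - avg_kernel q m t x z\<bar> \<le> ((\<bar>E\<bar> + 1) + L1) * \<bar>w - z\<bar>"
      using 1(2)[of w] 2(2)[of w] unfolding avg_kernel_def distrib_right[of "\<bar>E\<bar> + 1" L1] by linarith
  qed (use 1 2 in simp)
next
  case False
  then have f: "\<bar>z - x\<bar> > t" using z by simp
  show thesis
  proof (rule that[of "\<bar>z - x\<bar> - t" 0])
    fix w assume "\<bar>w - z\<bar> < \<bar>z - x\<bar> - t"
    then have "\<bar>w - x\<bar> \<ge> t" by linarith
    then show "\<bar>avg_kernel q m t x w - avg_kernel q m t x z\<bar> \<le> 0 * \<bar>w - z\<bar>"
      using f t by (simp add: avg_kernel_eq_0)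
  qed (use f in simp)
qed

section \<open>The averaged kernel acting on eigenfunctions\<close>

lemma wave_integral_substitution:
  fixes f :: "real \<Rightarrow> real"
  assumes x: "x > 0" and s: "0 \<le> s" "s < x / 2" and f: "continuous_on {0<..} f"
  shows "integral {-1..1} (\<lambda>u. s\<^sup>2 / (2 * x * (x + s * u)) * legendre1 q (trho x s u) * f (x + s * u)) / 2
    = (LINT z|lborel. (if \<bar>z - x\<bar> < s then wave_kernel q x s z else 0) * f z)"
proof (cases "s = 0")
  case False
  then have sp: "s > 0" using s by simp
  define g where "g u = s\<^sup>2 / (2 * x * (x + s * u)) * legendre1 q (trho x s u) * f (x + s * u)" for u
  have tb: "x + s * u > 0" "trho x s u \<in> {-1<..<1}" if "u \<in> {-1..1}" for u
  proof -
    have "\<bar>s\<bar> < x / 2" "\<bar>u\<bar> \<le> 1" using s that by auto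
    from trho_bounds[OF x this] x show "x + s * u > 0" "trho x s u \<in> {-1<..<1}" by auto
  qed
  have "continuous_on {-1..1} g"
    unfolding g_def
  proof (intro continuous_intros)
    show "continuous_on {-1..1} (\<lambda>u. legendre1 q (trho x s u))"
    proof (rule continuous_on_compose2[OF continuous_on_legendre1])
      show "continuous_on {-1..1} (trho x s)"
        unfolding trho_def[abs_def] by (intro continuous_intros) (use tb(1) x in force)+
    qed (use tb(2) in blast)
    show "continuous_on {-1..1} (\<lambda>u. f (x + s * u))"
      by (rule continuous_on_compose2[OF f]) (auto intro!: continuous_intros tb(1))
  qed (use tb(1) x in force)
  then have gi: "set_integrable lborel {-1..1} g" by (rule borel_integrable_atLeastAtMost')
  have "(LINT z|lborel. (if \<bar>z - x\<bar> < s then wave_kernel q x s z else 0) * f z)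
    = \<bar>s\<bar> *\<^sub>R (LINT u|lborel. (if \<bar>(x + s * u) - x\<bar> < s then wave_kernel q x s (x + s * u) else 0) * f (x + s * u))"
    by (rule lborel_integral_real_affine[OF False])
  also have "\<dots> = (LINT u|lborel. s * ((if \<bar>(x + s * u) - x\<bar> < s then wave_kernel q x s (x + s * u) else 0) * f (x + s * u)))"
    using sp by simp
  also have "\<dots> = (LINT u|lborel. indicator {-1<..<1} u *\<^sub>R (g u / 2))"
  proof (rule Bochner_Integration.integral_cong[OF refl])
    fix u :: real
    have "\<bar>(x + s * u) - x\<bar> < s \<longleftrightarrow> \<bar>u\<bar> < 1" using sp by (simp add: abs_mult)
    moreover have "s * (wave_kernel q x s (x + s * u) * f (x + s * u)) = g u / 2" if "\<bar>u\<bar> < 1"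
    proof -
      have "(s\<^sup>2 - (s * u)\<^sup>2) / (4 * x * (x + s * u)) = trho x s u"
        by (simp add: trho_def power_mult_distrib algebra_simps)
      then have "s * (wave_kernel q x s (x + s * u) * f (x + s * u))
        = (s * s / (4 * x * (x + s * u))) * legendre1 q (trho x s u) * f (x + s * u)"
        unfolding wave_kernel_def by simp
      also have "s * s / (4 * x * (x + s * u)) = s\<^sup>2 / (2 * x * (x + s * u)) / 2"
        by (simp add: power2_eq_square)
      finally show ?thesis unfolding g_def by simp
    qed
    ultimately show "s * ((if \<bar>(x + s * u) - x\<bar> < s then wave_kernel q x s (x + s * u) else 0) * f (x + s * u))
      = indicator {-1<..<1} u *\<^sub>R (g u / 2)"
      by (auto simp: indicator_def abs_less_iff)
  qed
  also have "\<dots> = (LBINT u:{-1<..<1}. g u) / 2" unfolding set_lebesgue_integral_def by simp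
  also have "(LBINT u:{-1<..<1}. g u) = (LBINT u:{-1..1}. g u)"
    by (rule set_integral_discrete_difference[where X = "{-1, 1}"]) auto
  also have "\<dots> = integral {-1..1} g" by (rule set_borel_integral_eq_integral(2)[OF gi])
  finally show ?thesis unfolding g_def by simp
qed simp

text \<open>Multiply \<open>transmutation\<close> at time t \<sigma> by the bump and integrate in
  \<sigma>. The d'Alembert terms become the dilated bump, Fubini turns the wave part into
  \<open>wave_corr\<close>, and the left-hand side becomes the Fourier cosine integral of the bump.
  On the compact support of the kernel f is bounded, which supplies the majorants.\<close>

lemma avg_kernel_transform:
  fixes f f1 :: "real \<Rightarrow> real" and y q :: real
  assumes x: "x > 0" and t: "0 < t" "t < x / 2" and m: "m > -1"
    and f: "\<And>z. z > 0 \<Longrightarrow> (f has_real_derivative f1 z) (at z)"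
    and f1: "\<And>z. z > 0 \<Longrightarrow> (f1 has_real_derivative (q / z\<^sup>2 - y\<^sup>2) * f z) (at z)"
    and [measurable]: "f \<in> borel_measurable borel"
  shows "integrable lborel (\<lambda>z. avg_kernel q m t x z * f z)"
    and "(LINT z|lborel. avg_kernel q m t x z * f z) = f x * (LINT \<sigma>|lborel. bump m \<sigma> * cos (y * t * \<sigma>)) / bump_mass m"
proof -
  obtain C where C: "C \<ge> 0"
    "\<And>s z. s < x / 2 \<Longrightarrow> \<bar>z - x\<bar> < s \<Longrightarrow> \<bar>wave_kernel q x s z\<bar> \<le> C * s"
    "\<And>s z w. s < x / 2 \<Longrightarrow> \<bar>z - x\<bar> < s \<Longrightarrow> \<bar>w - x\<bar> < s \<Longrightarrow>
       \<bar>wave_kernel q x s w - wave_kernel q x s z\<bar> \<le> C * \<bar>w - z\<bar>"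
    by (rule wave_kernel_bounds[OF x, of q]) (rule that)
  define B where "B = bump_mass m"
  have B: "B > 0" using bump_mass_pos[OF m] by (simp add: B_def)
  have cf: "continuous_on {0<..} f"
    by (rule DERIV_continuous_on, rule has_field_derivative_at_within, rule f, simp)
  have "continuous_on {x - t..x + t} f" by (rule continuous_on_subset[OF cf]) (use t x in auto)
  then have "bounded (f ` {x - t..x + t})" by (intro compact_imp_bounded compact_continuous_image) auto
  then obtain M where M: "\<And>z. z \<in> {x - t..x + t} \<Longrightarrow> \<bar>f z\<bar> \<le> M"
    unfolding bounded_iff by (metis imageI real_norm_def)
  have M0: "M \<ge> 0" using M[of x] t by auto
  have Mb: "\<bar>bump m ((z - x) / t) * f z\<bar> \<le> M * bump m ((z - x) / t)" for z
  proof (cases "\<bar>(z - x) / t\<bar> < 1")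
    case True
    then have "\<bar>z - x\<bar> < t" using t by (simp add: abs_divide)
    then have "\<bar>f z\<bar> \<le> M" by (intro M) (auto simp: abs_less_iff)
    then show ?thesis using mult_left_mono[of "\<bar>f z\<bar>" M "bump m ((z - x) / t)"] bump_nonneg[of m "(z - x) / t"]
      by (simp add: abs_mult mult.commute)
  qed (simp add: bump_eq_0)
  have "integrable lborel (\<lambda>z. bump m (- x / t + (1 / t) * z))"
    by (rule lborel_integrable_real_affine[OF integrable_bump[OF m]]) (use t in simp)
  then have bi: "integrable lborel (\<lambda>z. bump m ((z - x) / t))"
    by (simp add: diff_divide_distrib)
  have S_int: "integrable lborel (\<lambda>z. bump m ((z - x) / t) * f z)"
  proof (rule Bochner_Integration.integrable_bound[OF integrable_mult_right[OF bi, of M]])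
    show "AE z in lborel. norm (bump m ((z - x) / t) * f z) \<le> norm (M * bump m ((z - x) / t))"
      using Mb by (auto intro: order_trans[OF _ abs_ge_self])
  qed measurable
  have S_val: "(LINT z|lborel. bump m ((z - x) / t) * f z) = t * (LINT \<sigma>|lborel. bump m \<sigma> * f (x + t * \<sigma>))"
  proof -
    have "(LINT z|lborel. bump m ((z - x) / t) * f z) = \<bar>t\<bar> *\<^sub>R (LINT \<sigma>|lborel. bump m ((x + t * \<sigma> - x) / t) * f (x + t * \<sigma>))"
      by (rule lborel_integral_real_affine) (use t in simp)
    then show ?thesis using t by simp
  qed
  have P_int: "integrable lborel (\<lambda>\<sigma>. bump m \<sigma> * f (x + t * \<sigma>))"
  proof -
    have "integrable lborel (\<lambda>\<sigma>. bump m ((x + t * \<sigma> - x) / t) * f (x + t * \<sigma>))"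
      by (rule lborel_integrable_real_affine[OF S_int]) (use t in simp)
    then show ?thesis using t by simp
  qed
  \<comment> \<open>Evenness of the bump makes the averages of f(x + t \<sigma>) and f(x - t
    \<sigma>) coincide, so their half-sum is a single dilated bump.\<close>
  have be: "bump m (- \<sigma>) = bump m \<sigma>" for \<sigma> by (simp add: bump_def)
  have N_int: "integrable lborel (\<lambda>\<sigma>. bump m \<sigma> * f (x - t * \<sigma>))"
    using lborel_integrable_real_affine[OF P_int, of "-1" 0] by (simp add: be)
  have N_val: "(LINT \<sigma>|lborel. bump m \<sigma> * f (x - t * \<sigma>)) = (LINT \<sigma>|lborel. bump m \<sigma> * f (x + t * \<sigma>))"
    using lborel_integral_real_affine[of "-1" "\<lambda>\<sigma>. bump m \<sigma> * f (x + t * \<sigma>)" 0] by (simp add: be)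
  define h where "h \<sigma> z = bump m \<sigma> * (if \<bar>z - x\<bar> < t * \<bar>\<sigma>\<bar> then wave_kernel q x (t * \<bar>\<sigma>\<bar>) z else 0)" for \<sigma> z
  define H where "H \<sigma> z = h \<sigma> z * f z" for \<sigma> z
  have hm: "(\<lambda>p. h (fst p) (snd p)) \<in> borel_measurable (lborel \<Otimes>\<^sub>M lborel)"
    unfolding h_def by (rule wave_kernel_measurable)
  have H_bd: "\<bar>H \<sigma> z\<bar> \<le> bump m \<sigma> * (C * t * M * indicator {x - t..x + t} z)" for \<sigma> z
  proof (cases "\<bar>\<sigma>\<bar> < 1 \<and> \<bar>z - x\<bar> < t * \<bar>\<sigma>\<bar>")
    case True
    have ts: "t * \<bar>\<sigma>\<bar> \<le> t" using mult_left_mono[of "\<bar>\<sigma>\<bar>" 1 t] True t by simp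
    have "\<bar>wave_kernel q x (t * \<bar>\<sigma>\<bar>) z\<bar> \<le> C * (t * \<bar>\<sigma>\<bar>)" by (rule C(2)) (use True ts t in linarith)+
    also have "\<dots> \<le> C * t" using ts C(1) by (intro mult_left_mono) auto
    finally have k: "\<bar>wave_kernel q x (t * \<bar>\<sigma>\<bar>) z\<bar> \<le> C * t" .
    have zI: "z \<in> {x - t..x + t}" using True ts by auto
    have "\<bar>wave_kernel q x (t * \<bar>\<sigma>\<bar>) z\<bar> * \<bar>f z\<bar> \<le> (C * t) * M"
      using C(1) t by (intro mult_mono k M zI) auto
    then have "bump m \<sigma> * (\<bar>wave_kernel q x (t * \<bar>\<sigma>\<bar>) z\<bar> * \<bar>f z\<bar>) \<le> bump m \<sigma> * ((C * t) * M)"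
      by (rule mult_left_mono[OF _ bump_nonneg])
    then show ?thesis using True zI bump_nonneg[of m \<sigma>] by (simp add: H_def h_def abs_mult mult_ac)
  next
    case False
    then show ?thesis using C(1) M0 t bump_nonneg[of m \<sigma>] by (auto simp: H_def h_def bump_eq_0 indicator_def)
  qed
  have "integrable (lborel \<Otimes>\<^sub>M lborel) (\<lambda>p. H (fst p) (snd p))"
  proof (rule Bochner_Integration.integrable_bound)
    have "integrable lborel (indicator {x - t..x + t} :: real \<Rightarrow> real)"
      by (intro integrable_real_indicator) (auto simp: emeasure_lborel_Icc_eq)
    then show "integrable (lborel \<Otimes>\<^sub>M lborel) (\<lambda>p. bump m (fst p) * (C * t * M * indicator {x - t..x + t} (snd p)))"
      by (intro integrable_lborel_prod[of "bump m" "\<lambda>z. C * t * M * indicator {x - t..x + t} z"] integrable_bump m integrable_mult_right)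
    show "AE p in lborel \<Otimes>\<^sub>M lborel. norm (H (fst p) (snd p)) \<le> norm (bump m (fst p) * (C * t * M * indicator {x - t..x + t} (snd p)))"
      by (intro AE_I2) (simp only: real_norm_def, rule order_trans[OF H_bd abs_ge_self])
    show "(\<lambda>p. H (fst p) (snd p)) \<in> borel_measurable (lborel \<Otimes>\<^sub>M lborel)"
      unfolding H_def by (intro borel_measurable_times hm) measurable
  qed
  then have H_int': "integrable (lborel \<Otimes>\<^sub>M lborel) (case_prod H)" by (simp add: split_def)
  have in_z: "(LINT \<sigma>|lborel. H \<sigma> z) = B * (wave_corr q m t x z * f z)" for z
  proof -
    have "(LINT \<sigma>|lborel. H \<sigma> z) = (LINT \<sigma>|lborel. h \<sigma> z) * f z"
      unfolding H_def by simp
    also have "(LINT \<sigma>|lborel. h \<sigma> z) = B * wave_corr q m t x z"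
      unfolding wave_corr_def h_def B_def[symmetric] using B by simp
    finally show ?thesis by simp
  qed
  have C_int: "integrable lborel (\<lambda>z. wave_corr q m t x z * f z)"
    using lborel_pair.integrable_snd[OF H_int'] B unfolding in_z by simp
  have in_s: "(LINT z|lborel. H \<sigma> z) = bump m \<sigma> * (f x * cos (y * t * \<sigma>)) - (bump m \<sigma> * f (x + t * \<sigma>) + bump m \<sigma> * f (x - t * \<sigma>)) / 2" for \<sigma>
  proof (cases "\<bar>\<sigma>\<bar> < 1")
    case True
    \<comment> \<open>The wave part depends on t |\<sigma>| only; the cosine and the sum f(x + s) +
      f(x - s) are even in s, which restores \<sigma> itself.\<close>
    define s where "s = t * \<bar>\<sigma>\<bar>"
    have "s \<le> t" "0 \<le> s" using mult_left_mono[of "\<bar>\<sigma>\<bar>" 1 t] True t by (simp_all add: s_def)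
    then have s: "0 \<le> s" "s < x / 2" "\<bar>s\<bar> < x / 2" using t by linarith+
    have "(LINT z|lborel. H \<sigma> z) = (LINT z|lborel. bump m \<sigma> * ((if \<bar>z - x\<bar> < s then wave_kernel q x s z else 0) * f z))"
      unfolding H_def h_def s_def by (simp add: mult.assoc)
    also have "\<dots> = bump m \<sigma> * (LINT z|lborel. (if \<bar>z - x\<bar> < s then wave_kernel q x s z else 0) * f z)"
      by simp
    also have "(LINT z|lborel. (if \<bar>z - x\<bar> < s then wave_kernel q x s z else 0) * f z)
      = f x * cos (y * s) - (f (x + s) + f (x - s)) / 2"
      using wave_integral_substitution[OF x s(1,2) cf, of q] transmutation[OF x f f1 s(3)] by simp
    also have "cos (y * s) = cos (y * t * \<sigma>)"
      unfolding s_def using cos_abs_real[of "y * t * \<sigma>"] by (cases "\<sigma> \<ge> 0") (simp_all add: mult.assoc)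
    also have "f (x + s) + f (x - s) = f (x + t * \<sigma>) + f (x - t * \<sigma>)"
      unfolding s_def by (cases "\<sigma> \<ge> 0") simp_all
    finally show ?thesis by (simp add: field_simps)
  qed (simp add: H_def h_def bump_eq_0)
  have cos_int: "integrable lborel (\<lambda>\<sigma>. bump m \<sigma> * (f x * cos (y * t * \<sigma>)))"
    using integrable_mult_right[OF integrable_mult_cos[OF integrable_bump[OF m], of "y * t" 0], of "f x"]
    by (simp add: mult.left_commute)
  have "(LINT z|lborel. B * (wave_corr q m t x z * f z)) = (LINT \<sigma>|lborel. (LINT z|lborel. H \<sigma> z))"
    unfolding in_z[symmetric] by (rule lborel_pair.Fubini_integral[OF H_int'])
  also have "\<dots> = (LINT \<sigma>|lborel. bump m \<sigma> * (f x * cos (y * t * \<sigma>))) - (LINT \<sigma>|lborel. (bump m \<sigma> * f (x + t * \<sigma>) + bump m \<sigma> * f (x - t * \<sigma>)) / 2)"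
    unfolding in_s by (rule Bochner_Integration.integral_diff) (use cos_int P_int N_int in auto)
  also have "(LINT \<sigma>|lborel. (bump m \<sigma> * f (x + t * \<sigma>) + bump m \<sigma> * f (x - t * \<sigma>)) / 2) = (LINT \<sigma>|lborel. bump m \<sigma> * f (x + t * \<sigma>))"
    using P_int N_int N_val by simp
  also have "(LINT \<sigma>|lborel. bump m \<sigma> * (f x * cos (y * t * \<sigma>))) = f x * (LINT \<sigma>|lborel. bump m \<sigma> * cos (y * t * \<sigma>))"
    by (simp add: mult.left_commute)
  finally have C_val: "B * (LINT z|lborel. wave_corr q m t x z * f z)
     = f x * (LINT \<sigma>|lborel. bump m \<sigma> * cos (y * t * \<sigma>)) - (LINT \<sigma>|lborel. bump m \<sigma> * f (x + t * \<sigma>))" by simp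
  have eq: "avg_kernel q m t x z * f z = (1 / (t * B)) * (bump m ((z - x) / t) * f z) + wave_corr q m t x z * f z" for z
    unfolding avg_kernel_def B_def by (simp add: distrib_right)
  show "integrable lborel (\<lambda>z. avg_kernel q m t x z * f z)"
    unfolding eq by (intro Bochner_Integration.integrable_add integrable_mult_right S_int C_int)
  have "(LINT z|lborel. avg_kernel q m t x z * f z) = (1 / (t * B)) * (LINT z|lborel. bump m ((z - x) / t) * f z) + (LINT z|lborel. wave_corr q m t x z * f z)"
    unfolding eq using S_int C_int by simp
  also have "\<dots> = (1 / (t * B)) * (t * (LINT \<sigma>|lborel. bump m \<sigma> * f (x + t * \<sigma>))) + (B * (LINT z|lborel. wave_corr q m t x z * f z)) / B"
    unfolding S_val using B by simp
  also have "\<dots> = f x * (LINT \<sigma>|lborel. bump m \<sigma> * cos (y * t * \<sigma>)) / B"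
    unfolding C_val using B t by (simp add: diff_divide_distrib)
  finally show "(LINT z|lborel. avg_kernel q m t x z * f z) = f x * (LINT \<sigma>|lborel. bump m \<sigma> * cos (y * t * \<sigma>)) / bump_mass m"
    unfolding B_def .
qed

lemma avg_kernel_integrable:
  assumes x: "x > 0" and t: "0 < t" "t < x / 2" and m: "m > -1"
  shows "integrable lborel (avg_kernel q m t x)"
proof -
  have "integrable lborel (\<lambda>z. bump m (- x / t + (1 / t) * z))"
    by (rule lborel_integrable_real_affine[OF integrable_bump[OF m]]) (use t in simp)
  then have bi: "integrable lborel (\<lambda>z. bump m ((z - x) / t))"
    by (simp add: diff_divide_distrib)
  obtain C where C: "C \<ge> 0" "\<And>t z. 0 < t \<Longrightarrow> t < x / 2 \<Longrightarrow> \<bar>wave_corr q m t x z\<bar> \<le> C * t"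
    by (rule wave_corr_bound[OF x m, of q]) (rule that)
  have "integrable lborel (indicator {x - t..x + t} :: real \<Rightarrow> real)"
    by (intro integrable_real_indicator) (auto simp: emeasure_lborel_Icc_eq)
  then have i: "integrable lborel (\<lambda>z. C * t * indicator {x - t..x + t} z)" by (rule integrable_mult_right)
  have "integrable lborel (wave_corr q m t x)"
  proof (rule Bochner_Integration.integrable_bound[OF i])
    show "AE z in lborel. norm (wave_corr q m t x z) \<le> norm (C * t * indicator {x - t..x + t} z)"
    proof (rule AE_I2)
      fix z :: real
      show "norm (wave_corr q m t x z) \<le> norm (C * t * indicator {x - t..x + t} z)"
      proof (cases "\<bar>z - x\<bar> < t")
        case True
        then have "z \<in> {x - t..x + t}" by (auto simp: abs_less_iff)
        then show ?thesis using C(1) C(2)[OF t, of z] t by simp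
      next
        case False
        then show ?thesis using t by (simp add: wave_corr_eq_0)
      qed
    qed
  qed measurable
  then show ?thesis unfolding avg_kernel_def[abs_def]
    by (intro Bochner_Integration.integrable_add integrable_divide_zero bi) auto
qed

section \<open>Identification with the kernel of three Bessel functions\<close>

lemma has_real_derivative_psi_scaled:
  assumes "\<alpha> > -1" "y > 0" "z > 0"
  shows "((\<lambda>z. psi \<alpha> (y * z)) has_real_derivative y * dpsi \<alpha> (y * z)) (at z)"
    and "((\<lambda>z. y * dpsi \<alpha> (y * z)) has_real_derivative ((\<alpha>\<^sup>2 - 1/4) / z\<^sup>2 - y\<^sup>2) * psi \<alpha> (y * z)) (at z)"
proof -
  have yz: "y * z > 0" using assms by simp
  have l: "((\<lambda>z. y * z) has_real_derivative y) (at z)"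
    by (auto intro!: derivative_eq_intros)
  show "((\<lambda>z. psi \<alpha> (y * z)) has_real_derivative y * dpsi \<alpha> (y * z)) (at z)"
    by (rule DERIV_cong[OF DERIV_chain2[OF has_real_derivative_psi[OF assms(1) yz] l]]) simp
  have "y * (((\<alpha>\<^sup>2 - 1/4) / (y * z)\<^sup>2 - 1) * P * y) = ((\<alpha>\<^sup>2 - 1/4) / z\<^sup>2 - y\<^sup>2) * P" for P
  proof -
    have "y * ((Q / (y * z)\<^sup>2 - 1) * P * y) = (y\<^sup>2 * (Q / (y\<^sup>2 * z\<^sup>2)) - y\<^sup>2) * P" for Q
      by (simp add: power_mult_distrib power2_eq_square algebra_simps)
    moreover have "y\<^sup>2 * (Q / (y\<^sup>2 * z\<^sup>2)) = Q / z\<^sup>2" for Q using assms by simp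
    ultimately show ?thesis by simp
  qed
  then show "((\<lambda>z. y * dpsi \<alpha> (y * z)) has_real_derivative ((\<alpha>\<^sup>2 - 1/4) / z\<^sup>2 - y\<^sup>2) * psi \<alpha> (y * z)) (at z)"
    by (rule DERIV_cong[OF DERIV_cmult[OF DERIV_chain2[OF has_real_derivative_dpsi[OF assms(1) yz] l]]])
qed

text \<open>All powers of y cancel: the first Bessel factor gives y^\<mu>, the weight y^(1-\<mu>),
  and writing the other two through \<open>psi\<close> divides by y sqrt (x z). The value Gamma
  (\<mu> + 1) is inserted to match \<open>poisson_integral\<close>.\<close>

lemma bessel_triple_eq:
  assumes \<alpha>: "\<alpha> > -1" and \<mu>: "\<mu> > -1/2" and p: "x > 0" "t > 0" "z > 0" "y > 0"
  shows "bessel_J \<mu> (t * y) * bessel_J \<alpha> (x * y) * bessel_J \<alpha> (z * y) * y powr (1 - \<mu>)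
    = (t / 2) powr \<mu> / (sqrt (x * z) * Gamma (\<mu> + 1)) *
      ((psi \<alpha> (y * x) * (Gamma (\<mu> + 1) * bessel_entire \<mu> ((y * t)\<^sup>2 / 4))) * psi \<alpha> (y * z))"
proof -
  have G: "Gamma (\<mu> + 1) > 0" using \<mu> by (intro Gamma_real_pos) simp
  have J: "bessel_J \<alpha> (v * y) = psi \<alpha> (y * v) / sqrt (v * y)" if "v > 0" for v
    using psi_bessel_J[OF \<alpha>, of "v * y"] that p by (simp add: mult.commute)
  have "bessel_J \<mu> (t * y) = (t / 2 * y) powr \<mu> * bessel_entire \<mu> ((y * t)\<^sup>2 / 4)"
    using bessel_J_eq[of \<mu> "t * y"] \<mu> p by (simp add: mult.commute)
  also have "(t / 2 * y) powr \<mu> = (t / 2) powr \<mu> * y powr \<mu>" by (rule powr_mult)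
  finally have Jm: "bessel_J \<mu> (t * y) = (t / 2) powr \<mu> * y powr \<mu> * bessel_entire \<mu> ((y * t)\<^sup>2 / 4)" .
  have yy: "y powr \<mu> * y powr (1 - \<mu>) = y" using p by (simp add: powr_add[symmetric])
  have sq: "sqrt (x * y) * sqrt (z * y) = sqrt (x * z) * y"
    using p by (simp add: real_sqrt_mult)
  have "bessel_J \<mu> (t * y) * bessel_J \<alpha> (x * y) * bessel_J \<alpha> (z * y) * y powr (1 - \<mu>)
    = (t / 2) powr \<mu> * bessel_entire \<mu> ((y * t)\<^sup>2 / 4) * psi \<alpha> (y * x) * psi \<alpha> (y * z)
      * (y powr \<mu> * y powr (1 - \<mu>)) / (sqrt (x * y) * sqrt (z * y))"
    unfolding Jm J[OF p(1)] J[OF p(3)] by simp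
  also have "\<dots> = (t / 2) powr \<mu> * bessel_entire \<mu> ((y * t)\<^sup>2 / 4) * psi \<alpha> (y * x) * psi \<alpha> (y * z) / sqrt (x * z)"
    unfolding yy sq using p by simp
  finally show ?thesis using G by simp
qed

text \<open>Boundedness of \<open>psi\<close> of order \<mu> becomes decay once its power is divided
  out. For \<mu> > 1/2 the exponent is below -1, which gives the absolutely convergent branch of
  \<open>kernel\<close>.\<close>

lemma psi_bessel_entire_bounded:
  assumes "\<mu> > 1/2" "t > 0"
  obtains C where "C > 0" "\<And>y. y > 0 \<Longrightarrow> \<bar>bessel_entire \<mu> ((y * t)\<^sup>2 / 4)\<bar> \<le> C * y powr (- \<mu> - 1/2)"
proof -
  have "\<mu> > -1" using assms by simp
  obtain C where C: "C > 0" "\<And>s. s > 0 \<Longrightarrow> \<bar>psi \<mu> s\<bar> \<le> C * (1 + s powr min (\<mu> + 1/2) 0)"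
    "\<And>s. s > 0 \<Longrightarrow> \<bar>s * dpsi \<mu> s\<bar> \<le> C * (s + s powr min (\<mu> + 1/2) 0)"
    by (rule psi_bound[OF \<open>\<mu> > -1\<close>]) (rule that)
  define D where "D = 2 powr (-\<mu>) * t powr (\<mu> + 1/2)"
  have D: "D > 0" using assms by (simp add: D_def)
  show thesis
  proof (rule that[of "2 * C / D"])
    fix y :: real assume y: "y > 0"
    have "min (\<mu> + 1/2) 0 = 0" using assms by simp
    then have "\<bar>psi \<mu> (y * t)\<bar> \<le> 2 * C" using C(2)[of "y * t"] y assms by simp
    moreover have "psi \<mu> (y * t) = D * y powr (\<mu> + 1/2) * bessel_entire \<mu> ((y * t)\<^sup>2 / 4)"
      unfolding psi_def D_def using y assms by (simp add: powr_mult)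
    ultimately have "D * y powr (\<mu> + 1/2) * \<bar>bessel_entire \<mu> ((y * t)\<^sup>2 / 4)\<bar> \<le> 2 * C"
      using D by (simp add: abs_mult)
    then have "\<bar>bessel_entire \<mu> ((y * t)\<^sup>2 / 4)\<bar> \<le> 2 * C / (D * y powr (\<mu> + 1/2))"
      using D y by (simp add: pos_le_divide_eq mult.commute)
    also have "\<dots> = 2 * C / D * y powr (- (\<mu> + 1/2))"
      unfolding powr_minus divide_inverse by (simp add: mult_ac)
    also have "- (\<mu> + 1/2) = - \<mu> - 1/2" by simp
    finally show "\<bar>bessel_entire \<mu> ((y * t)\<^sup>2 / 4)\<bar> \<le> 2 * C / D * y powr (- \<mu> - 1/2)" .
  qed (use C D in simp)
qed

lemma set_integrable_powr_at_top:
  fixes c a :: real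
  assumes "c < -1" "a > 0"
  shows "set_integrable lborel {a..} (\<lambda>y. y powr c)"
  using has_integral_powr_to_inf[OF assms] by (rule has_integral_nonneg_lborel(1)) auto

text \<open>By \<open>avg_kernel_transform\<close> and \<open>poisson_integral\<close> the Hankel
  transform \<open>H\<close> of \<open>K\<close> is the factor isolated in
  \<open>bessel_triple_eq\<close>, so inversion at z evaluates the triple integral. The prefactor of
  \<open>kernel\<close> cancels (t/2)^\<mu> / Gamma (\<mu> + 1), and (x z)^(-\<alpha>) combines with
  1/sqrt (x z).\<close>

lemma kernel_eq_avg_kernel:
  assumes \<alpha>: "\<alpha> > -1" and \<mu>: "\<alpha> + \<beta> > -1/2" and x: "x > 0" and t: "0 < t" "t < x / 2"
    and z: "z > 0" "\<bar>z - x\<bar> \<noteq> t"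
  shows "kernel \<alpha> \<beta> t x z = (x * z) powr (- (\<alpha> + 1/2)) * avg_kernel (\<alpha>\<^sup>2 - 1/4) (\<alpha> + \<beta> - 1/2) t x z"
proof -
  define \<mu> where "\<mu> = \<alpha> + \<beta>"
  define m where "m = \<mu> - 1/2"
  define q where "q = \<alpha>\<^sup>2 - 1/4"
  define K where "K = avg_kernel q m t x"
  have m: "m > -1" and \<mu>': "\<mu> > -1/2" using \<mu> by (auto simp: m_def \<mu>_def)
  let ?b = "min (\<alpha> + 1/2) 0"
  note [measurable] = borel_measurable_psi[OF \<alpha>]
  have [measurable]: "K \<in> borel_measurable borel" unfolding K_def by measurable
  have [measurable]: "bessel_entire \<mu> \<in> borel_measurable borel"
    using continuous_bessel_entire[of \<mu> UNIV] \<mu>' by (intro borel_measurable_continuous_onI) auto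
  \<comment> \<open>The support stays above x/2, so the weight w^b is bounded on it, and integrals
    over the half-line and over the whole line agree.\<close>
  have K0: "K w = 0" if "w \<le> x / 2" for w
    unfolding K_def using that t x by (intro avg_kernel_eq_0) auto
  have K_int: "integrable lborel K" unfolding K_def by (rule avg_kernel_integrable[OF x t m])
  have K_int': "set_integrable lborel {0<..} (\<lambda>w. K w * (1 + w powr ?b))"
    unfolding set_integrable_def
  proof (rule Bochner_Integration.integrable_bound[OF integrable_mult_right[OF K_int, of "1 + (x / 2) powr ?b"]])
    show "AE w in lborel. norm (indicator {0<..} w *\<^sub>R (K w * (1 + w powr ?b))) \<le> norm ((1 + (x / 2) powr ?b) * K w)"
    proof (rule AE_I2)
      fix w :: real
      show "norm (indicator {0<..} w *\<^sub>R (K w * (1 + w powr ?b))) \<le> norm ((1 + (x / 2) powr ?b) * K w)"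
      proof (cases "w \<le> x / 2")
        case False
        then have "w powr ?b \<le> (x / 2) powr ?b" using x by (intro powr_mono2') auto
        then have "\<bar>K w\<bar> * (1 + w powr ?b) \<le> \<bar>K w\<bar> * (1 + (x / 2) powr ?b)" by (intro mult_left_mono) auto
        moreover have "\<bar>1 + v powr ?b\<bar> = 1 + v powr ?b" for v :: real by simp
        ultimately show ?thesis using False x by (simp add: abs_mult mult.commute indicator_def)
      qed (simp add: K0)
    qed
  qed measurable
  obtain \<delta> L where \<delta>0: "\<delta> > 0"
    "\<And>w. \<bar>w - z\<bar> < \<delta> \<Longrightarrow> \<bar>avg_kernel q m t x w - avg_kernel q m t x z\<bar> \<le> L * \<bar>w - z\<bar>"
    by (rule avg_kernel_Lipschitz[OF x t m z(2), of q]) (rule that)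
  note \<delta> = \<delta>0[folded K_def]
  define H where "H y = (LBINT w:{0<..}. K w * psi \<alpha> (y * w))" for y
  have H: "H y = psi \<alpha> (y * x) * (Gamma (\<mu> + 1) * bessel_entire \<mu> ((y * t)\<^sup>2 / 4))" if y: "y > 0" for y
  proof -
    have "H y = (LINT w|lborel. K w * psi \<alpha> (y * w))"
      unfolding H_def set_lebesgue_integral_def
    proof (rule Bochner_Integration.integral_cong[OF refl])
      fix w :: real
      show "indicator {0<..} w *\<^sub>R (K w * psi \<alpha> (y * w)) = K w * psi \<alpha> (y * w)"
        using K0[of w] x by (cases "w > 0") auto
    qed
    also have "\<dots> = psi \<alpha> (y * x) * (LINT \<sigma>|lborel. bump m \<sigma> * cos (y * t * \<sigma>)) / bump_mass m"
      unfolding K_def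
    proof (rule avg_kernel_transform(2)[OF x t m, where ?f1.0 = "\<lambda>z. y * dpsi \<alpha> (y * z)"])
      fix v :: real assume "v > 0"
      from has_real_derivative_psi_scaled[OF \<alpha> y this]
      show "((\<lambda>z. psi \<alpha> (y * z)) has_real_derivative y * dpsi \<alpha> (y * v)) (at v)"
        "((\<lambda>z. y * dpsi \<alpha> (y * z)) has_real_derivative (q / v\<^sup>2 - y\<^sup>2) * psi \<alpha> (y * v)) (at v)"
        unfolding q_def by auto
    qed measurable
    also have "\<dots> = psi \<alpha> (y * x) * (Gamma (m + 3/2) * bessel_entire (m + 1/2) ((y * t)\<^sup>2 / 4))"
      unfolding poisson_integral[OF m] using bump_mass_pos[OF m] by simp
    also have "m + 3/2 = \<mu> + 1" by (simp add: m_def)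
    also have "m + 1/2 = \<mu>" by (simp add: m_def)
    finally show ?thesis by simp
  qed
  define g where "g y = bessel_J \<mu> (t * y) * bessel_J \<alpha> (x * y) * bessel_J \<alpha> (z * y) * y powr (1 - \<mu>)" for y
  define D where "D = (t / 2) powr \<mu> / (sqrt (x * z) * Gamma (\<mu> + 1))"
  have g: "g y = D * (H y * psi \<alpha> (y * z))" if "y > 0" for y
    unfolding g_def D_def H[OF that] by (rule bessel_triple_eq[OF \<alpha> \<mu>' x t(1) z(1) that])
  have gR: "(LBINT y:{0<..R}. g y) = D * (LBINT y:{0<..R}. H y * psi \<alpha> (y * z))" for R
  proof -
    have "(LBINT y:{0<..R}. g y) = (LBINT y:{0<..R}. D * (H y * psi \<alpha> (y * z)))"
      by (rule set_lebesgue_integral_cong) (auto simp: g)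
    then show ?thesis by simp
  qed
  have "((\<lambda>R. LBINT y:{0<..R}. H y * psi \<alpha> (y * z)) \<longlongrightarrow> K z) at_top"
    unfolding H_def by (rule hankel_inversion[OF \<alpha> z(1) _ K_int' \<delta>]) measurable
  then have lim: "((\<lambda>R. LBINT y:{0<..R}. g y) \<longlongrightarrow> D * K z) at_top"
    unfolding gR by (intro tendsto_mult tendsto_const)
  \<comment> \<open>In this range \<open>kernel\<close> is a Lebesgue integral over the half-line.
    Absolute integrability lets dominated convergence identify it with the limit of truncated
    integrals.\<close>
  have full: "(LBINT y:{0<..}. g y) = D * K z" if \<mu>1: "\<mu> > 1/2"
  proof -
    \<comment> \<open>Equal to \<open>g\<close> for y > 0, but with measurability on the whole line
      visible from its form.\<close>
    define g' where "g' y = D * (psi \<alpha> (y * x) * (Gamma (\<mu> + 1) * bessel_entire \<mu> ((y * t)\<^sup>2 / 4)) * psi \<alpha> (y * z))" for y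
    have gg': "g y = g' y" if "y > 0" for y unfolding g'_def g[OF that] H[OF that] by simp
    have [measurable]: "g' \<in> borel_measurable borel" unfolding g'_def by measurable
    have i1: "set_integrable lborel {0<..1} g'"
    proof -
      have "set_integrable lborel {0<..1} (\<lambda>y. D * (H y * psi \<alpha> (y * z)))"
        unfolding H_def by (intro set_integrable_mult_right hankel_fubini(1)[OF \<alpha> z(1) _ K_int']) measurable
      then show ?thesis
        by (rule set_integrable_cong[THEN iffD1, rotated -1]) (auto simp: g gg'[symmetric])
    qed
    obtain C where C: "C > 0" "\<And>y w z. y > 0 \<Longrightarrow> w > 0 \<Longrightarrow> z > 0 \<Longrightarrow>
      \<bar>psi \<alpha> (y * w) * psi \<alpha> (y * z)\<bar> \<le> C * (1 + w powr ?b) * (1 + z powr ?b) * (1 + y powr ?b)\<^sup>2"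
      by (rule psi_product_bound[OF \<alpha>]) (rule that)
    obtain C' where C': "C' > 0" "\<And>y. y > 0 \<Longrightarrow> \<bar>bessel_entire \<mu> ((y * t)\<^sup>2 / 4)\<bar> \<le> C' * y powr (- \<mu> - 1/2)"
      by (rule psi_bessel_entire_bounded[OF \<mu>1 t(1)]) (rule that)
    define E where "E = \<bar>D\<bar> * Gamma (\<mu> + 1) * C' * (C * (1 + x powr ?b) * (1 + z powr ?b) * 2\<^sup>2)"
    have G: "Gamma (\<mu> + 1) > 0" using \<mu>1 by (intro Gamma_real_pos) simp
    have i2: "set_integrable lborel {1..} g'"
    proof (rule set_integrable_bound)
      show "set_integrable lborel {1..} (\<lambda>y. E * y powr (- \<mu> - 1/2))"
        using \<mu>1 by (intro set_integrable_mult_right set_integrable_powr_at_top) auto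
      show "AE y in lborel. y \<in> {1..} \<longrightarrow> norm (g' y) \<le> norm (E * y powr (- \<mu> - 1/2))"
      proof (intro AE_I2 impI)
        fix y :: real assume "y \<in> {1..}"
        then have y: "y \<ge> 1" "y > 0" by auto
        have yb: "y powr ?b \<le> 1" using powr_mono[of ?b 0 y] y by simp
        have "\<bar>psi \<alpha> (y * x) * psi \<alpha> (y * z)\<bar> \<le> C * (1 + x powr ?b) * (1 + z powr ?b) * (1 + y powr ?b)\<^sup>2"
          by (rule C(2)[OF y(2) x z(1)])
        also have "\<dots> \<le> C * (1 + x powr ?b) * (1 + z powr ?b) * 2\<^sup>2"
          using C(1) yb by (intro mult_left_mono power_mono) auto
        finally have 1: "\<bar>psi \<alpha> (y * x) * psi \<alpha> (y * z)\<bar> \<le> C * (1 + x powr ?b) * (1 + z powr ?b) * 2\<^sup>2" .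
        have "\<bar>g' y\<bar> = (\<bar>D\<bar> * Gamma (\<mu> + 1)) * (\<bar>bessel_entire \<mu> ((y * t)\<^sup>2 / 4)\<bar> * \<bar>psi \<alpha> (y * x) * psi \<alpha> (y * z)\<bar>)"
          unfolding g'_def using G by (simp add: abs_mult)
        also have "\<dots> \<le> (\<bar>D\<bar> * Gamma (\<mu> + 1)) * ((C' * y powr (- \<mu> - 1/2)) * (C * (1 + x powr ?b) * (1 + z powr ?b) * 2\<^sup>2))"
          using G C'(1) by (intro mult_left_mono mult_mono 1 C'(2)[OF y(2)]) auto
        also have "\<dots> = E * y powr (- \<mu> - 1/2)" unfolding E_def by (simp only: mult_ac)
        finally show "norm (g' y) \<le> norm (E * y powr (- \<mu> - 1/2))" unfolding real_norm_def by (rule order_trans[OF _ abs_ge_self])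
      qed
    qed (simp add: set_borel_measurable_def)
    have "set_integrable lborel ({0<..1} \<union> {1..}) g'"
      by (rule set_integrable_Un[OF i1 i2]) auto
    moreover have "{0<..1} \<union> {1..} = {0::real<..}" by auto
    ultimately have i: "set_integrable lborel {0<..} g'" by simp
    have "((\<lambda>R. LBINT y:{0<..R}. g' y) \<longlongrightarrow> (LBINT y:{0<..}. g' y)) at_top"
      unfolding set_lebesgue_integral_def
    proof (rule integral_dominated_convergence_at_top)
      show "integrable lborel (\<lambda>y. norm (indicator {0<..} y *\<^sub>R g' y))"
        using i unfolding set_integrable_def by (rule integrable_norm)
      show "\<forall>\<^sub>F R in at_top. AE y in lborel. norm (indicator {0<..R} y *\<^sub>R g' y) \<le> norm (indicator {0<..} y *\<^sub>R g' y)"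
        by (intro always_eventually allI AE_I2) (auto simp: indicator_def)
      show "AE y in lborel. ((\<lambda>R. indicator {0<..R} y *\<^sub>R g' y) \<longlongrightarrow> indicator {0<..} y *\<^sub>R g' y) at_top"
      proof (rule AE_I2)
        fix y :: real
        show "((\<lambda>R. indicator {0<..R} y *\<^sub>R g' y) \<longlongrightarrow> indicator {0<..} y *\<^sub>R g' y) at_top"
          by (rule tendsto_eventually, rule eventually_mono[OF eventually_ge_at_top[of y]])
            (auto simp: indicator_def)
      qed
    qed measurable
    moreover have "(LBINT y:{0<..R}. g' y) = (LBINT y:{0<..R}. g y)" for R
      by (rule set_lebesgue_integral_cong) (auto simp: gg')
    ultimately have "(LBINT y:{0<..}. g' y) = D * K z"
      using lim by (intro tendsto_unique[OF trivial_limit_at_top_linorder]) auto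
    moreover have "(LBINT y:{0<..}. g' y) = (LBINT y:{0<..}. g y)"
      by (rule set_lebesgue_integral_cong) (auto simp: gg')
    ultimately show ?thesis by simp
  qed
  have g_eq: "(\<lambda>y. bessel_J (\<alpha> + \<beta>) (t * y) * bessel_J \<alpha> (x * y) * bessel_J \<alpha> (z * y) * y powr (1 - \<alpha> - \<beta>)) = g"
    by (simp add: g_def[abs_def] \<mu>_def diff_diff_eq)
  have "\<mu> + 1 > 0" using \<mu>' by simp
  then have G: "Gamma (\<mu> + 1) \<noteq> 0" using Gamma_real_pos[of "\<mu> + 1"] by linarith
  have "kernel \<alpha> \<beta> t x z = 2 powr \<mu> * Gamma (\<mu> + 1) / (t powr \<mu> * (x * z) powr \<alpha>) * (D * K z)"
    unfolding kernel_def Let_def g_eq unfolding \<mu>_def[symmetric]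
    using full tendsto_Lim[OF trivial_limit_at_top_linorder lim] by simp
  also have "\<dots> = (2 powr \<mu> * (t / 2) powr \<mu> / t powr \<mu>) * (1 / ((x * z) powr \<alpha> * sqrt (x * z))) * K z"
    unfolding D_def using G by simp
  also have "2 powr \<mu> * (t / 2) powr \<mu> / t powr \<mu> = 1"
    using t by (simp add: powr_divide)
  also have "1 / ((x * z) powr \<alpha> * sqrt (x * z)) = (x * z) powr (- (\<alpha> + 1/2))"
  proof -
    have "(x * z) powr \<alpha> * sqrt (x * z) = (x * z) powr (\<alpha> + 1/2)"
      using x z by (simp add: powr_add powr_half_sqrt)
    then show ?thesis by (simp only: powr_minus divide_inverse mult_1)
  qed
  finally show ?thesis unfolding K_def q_def m_def \<mu>_def by simp
qed

section \<open>Almost everywhere convergence\<close>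

lemma lebesgue_differentiation_right:
  fixes f :: "real \<Rightarrow> real"
  assumes "\<And>a b. f integrable_on {a..b}"
  obtains N where "negligible N"
    "\<And>x. x \<notin> N \<Longrightarrow> ((\<lambda>h. integral {x..x + h} f / h) \<longlongrightarrow> f x) (at_right 0)"
proof -
  obtain N where N: "negligible N" "\<And>x e. \<lbrakk>x \<notin> N; 0 < e\<rbrakk> \<Longrightarrow>
      \<exists>d>0. \<forall>h. 0 < h \<and> h < d \<longrightarrow> norm (integral (cbox x (x + h *\<^sub>R One)) f /\<^sub>R h ^ DIM(real) - f x) < e"
    by (rule integrable_ccontinuous_explicit[of f]) (use assms in simp, rule that)
  show thesis
  proof (rule that[OF N(1)])
    fix x assume x: "x \<notin> N"
    show "((\<lambda>h. integral {x..x + h} f / h) \<longlongrightarrow> f x) (at_right 0)"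
    proof (rule tendstoI)
      fix e :: real assume "e > 0"
      from N(2)[OF x this] obtain d where d: "d > 0"
        "\<And>h. 0 < h \<Longrightarrow> h < d \<Longrightarrow> \<bar>integral {x..x + h} f / h - f x\<bar> < e"
        by (auto simp: divide_inverse mult.commute)
      show "\<forall>\<^sub>F h in at_right 0. dist (integral {x..x + h} f / h) (f x) < e"
        using eventually_at_right_real[OF d(1)] by eventually_elim (use d(2) in \<open>auto simp: dist_real_def\<close>)
    qed
  qed
qed

text \<open>Reflection x -> -x turns the one-sided statement into one for intervals to the left; the
  exceptional sets are united. The limit is twice f x because the interval of length 2h is divided
  by h only.\<close>

lemma lebesgue_differentiation:
  fixes f :: "real \<Rightarrow> real"
  assumes f: "\<And>a b. f integrable_on {a..b}"
  obtains N where "negligible N"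
    "\<And>x. x \<notin> N \<Longrightarrow> ((\<lambda>h. integral {x - h..x + h} f / h) \<longlongrightarrow> 2 * f x) (at_right 0)"
proof -
  obtain N where N: "negligible N"
    "\<And>x. x \<notin> N \<Longrightarrow> ((\<lambda>h. integral {x..x + h} f / h) \<longlongrightarrow> f x) (at_right 0)"
    by (rule lebesgue_differentiation_right[OF f]) (rule that)
  have "(\<lambda>x. f (- x)) integrable_on {a..b}" for a b
    using f[of "-b" "-a"] Henstock_Kurzweil_Integration.integrable_reflect_real[where f = f and a = "-b" and b = "-a"] by simp
  then obtain N' where N': "negligible N'"
    "\<And>x. x \<notin> N' \<Longrightarrow> ((\<lambda>h. integral {x..x + h} (\<lambda>x. f (- x)) / h) \<longlongrightarrow> f (- x)) (at_right 0)"
    by (rule lebesgue_differentiation_right) (rule that)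
  show thesis
  proof (rule that[of "N \<union> uminus ` N'"])
    have "negligible (uminus ` N')"
      by (rule negligible_differentiable_image_negligible[OF _ N'(1)])
        (auto intro!: differentiable_on_minus[where f = "\<lambda>x. x", simplified] differentiable_on_id[unfolded id_def] simp: differentiable_on_def)
    then show "negligible (N \<union> uminus ` N')" using N(1) by simp
    fix x assume x: "x \<notin> N \<union> uminus ` N'"
    then have "- x \<notin> N'" by force
    from N'(2)[OF this] have 1: "((\<lambda>h. integral {- x..- x + h} (\<lambda>x. f (- x)) / h) \<longlongrightarrow> f x) (at_right 0)" by simp
    have "integral {- x..- x + h} (\<lambda>x. f (- x)) = integral {x - h..x} f" for h
      using Henstock_Kurzweil_Integration.integral_reflect_real[where f = f and a = "x - h" and b = x] by simp
    with 1 have "((\<lambda>h. integral {x - h..x} f / h) \<longlongrightarrow> f x) (at_right 0)" by simp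
    from tendsto_add[OF this N(2), of x] x
    have "((\<lambda>h. integral {x - h..x} f / h + integral {x..x + h} f / h) \<longlongrightarrow> f x + f x) (at_right 0)" by simp
    then have "((\<lambda>h. integral {x - h..x} f / h + integral {x..x + h} f / h) \<longlongrightarrow> 2 * f x) (at_right 0)" by simp
    then show "((\<lambda>h. integral {x - h..x + h} f / h) \<longlongrightarrow> 2 * f x) (at_right 0)"
    proof (rule Lim_transform_eventually)
      show "\<forall>\<^sub>F h in at_right 0. integral {x - h..x} f / h + integral {x..x + h} f / h = integral {x - h..x + h} f / h"
        using eventually_at_right_less[of 0]
      proof eventually_elim
        case (elim h)
        then have "integral {x - h..x} f + integral {x..x + h} f = integral {x - h..x + h} f"
          by (intro Henstock_Kurzweil_Integration.integral_combine f) auto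
        then show ?case by (simp flip: add_divide_distrib)
      qed
    qed
  qed
qed

section \<open>Lebesgue points for p-th powers\<close>

lemma integrable_lebesgue_Icc: "integrable lebesgue (indicator {a..b} :: real \<Rightarrow> real)"
proof -
  have "{a..b} \<in> lmeasurable" using lmeasurable_cbox[of a b] by simp
  then show ?thesis
    by (intro integrable_real_indicator) (auto simp: fmeasurable_def)
qed

lemma add_powr_le:
  fixes a b p :: real
  assumes "a \<ge> 0" "b \<ge> 0" "p \<ge> 0"
  shows "(a + b) powr p \<le> 2 powr p * (a powr p + b powr p)"
proof -
  have "(a + b) powr p \<le> (2 * max a b) powr p" using assms by (intro powr_mono2) auto
  also have "\<dots> = 2 powr p * max a b powr p" by (rule powr_mult)
  also have "max a b powr p \<le> a powr p + b powr p" by (simp add: max_def)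
  finally show ?thesis by simp
qed

text \<open>Lebesgue's differentiation theorem applied to \<open>norm (g z - d) powr p\<close> for \<open>d\<close> in a countable
  dense set.\<close>
lemma lebesgue_points:
  fixes g :: "real \<Rightarrow> complex"
  assumes [measurable]: "g \<in> borel_measurable lebesgue" and p: "p \<ge> 1"
    and int: "\<And>a b. set_integrable lebesgue {a..b} (\<lambda>z. norm (g z) powr p)"
  shows "AE x in lebesgue. ((\<lambda>h. (LINT z:{x - h..x + h}|lebesgue. norm (g z - g x) powr p) / h) \<longlongrightarrow> 0) (at_right 0)"
proof -
  obtain D :: "complex set" where D: "countable D" "\<And>X. open X \<Longrightarrow> X \<noteq> {} \<Longrightarrow> \<exists>d\<in>D. d \<in> X"
    by (rule countable_dense_setE) (rule that)
  define u where "u d z = norm (g z - d) powr p" for d z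
  have const: "set_integrable lebesgue {a..b} (\<lambda>z. c)" for a b c :: real
    unfolding set_integrable_def by (intro integrable_scaleR_left integrable_lebesgue_Icc)
  have um[measurable]: "u d \<in> borel_measurable lebesgue" for d unfolding u_def by measurable
  have u_int: "set_integrable lebesgue {a..b} (u d)" for d a b
  proof (rule set_integrable_bound)
    show "set_integrable lebesgue {a..b} (\<lambda>z. 2 powr p * (norm (g z) powr p + norm d powr p))"
      by (intro set_integrable_mult_right set_integral_add(1) int const)
    show "AE z in lebesgue. z \<in> {a..b} \<longrightarrow> norm (u d z) \<le> norm (2 powr p * (norm (g z) powr p + norm d powr p))"
    proof (intro AE_I2 impI)
      fix z
      have "u d z \<le> (norm (g z) + norm d) powr p"
        unfolding u_def using p by (intro powr_mono2 norm_triangle_ineq4) auto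
      also have "\<dots> \<le> 2 powr p * (norm (g z) powr p + norm d powr p)"
        using p by (intro add_powr_le) auto
      finally show "norm (u d z) \<le> norm (2 powr p * (norm (g z) powr p + norm d powr p))"
        by (simp add: u_def)
    qed
    show "set_borel_measurable lebesgue {a..b} (u d)" unfolding set_borel_measurable_def
      by (intro borel_measurable_scaleR borel_measurable_indicator um) auto
  qed
  have AEd: "AE x in lebesgue. ((\<lambda>h. (LINT z:{x - h..x + h}|lebesgue. u d z) / h) \<longlongrightarrow> 2 * u d x) (at_right 0)" for d
  proof -
    have "u d integrable_on {a..b}" for a b by (rule set_lebesgue_integral_eq_integral(1)[OF u_int])
    then obtain N where N: "negligible N"
      "\<And>x. x \<notin> N \<Longrightarrow> ((\<lambda>h. integral {x - h..x + h} (u d) / h) \<longlongrightarrow> 2 * u d x) (at_right 0)"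
      by (rule lebesgue_differentiation) (rule that)
    have "N \<in> null_sets lebesgue" using N(1) by (simp add: negligible_iff_null_sets)
    then show ?thesis
    proof (rule AE_I')
      show "{x \<in> space lebesgue. \<not> ((\<lambda>h. (LINT z:{x - h..x + h}|lebesgue. u d z) / h) \<longlongrightarrow> 2 * u d x) (at_right 0)} \<subseteq> N"
        using N(2) by (auto simp: set_lebesgue_integral_eq_integral(2)[OF u_int])
    qed
  qed
  have "AE x in lebesgue. \<forall>d\<in>D. ((\<lambda>h. (LINT z:{x - h..x + h}|lebesgue. u d z) / h) \<longlongrightarrow> 2 * u d x) (at_right 0)"
    using D(1) AEd by (subst AE_ball_countable) auto
  then show ?thesis
  proof eventually_elim
    case (elim x)
    show ?case
    proof (rule tendstoI)
      fix e :: real assume e: "e > 0"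
      \<comment> \<open>The means are eventually dominated by a quantity with limit 2^p (2 u + 2 u),
        u = \<open>u d x\<close>. It suffices that u < e / (4 2^p), and \<open>r\<close> is the p-th
        root of that bound.\<close>
      define r where "r = (e / (4 * 2 powr p)) powr (1 / p)"
      have r: "r > 0" using e by (simp add: r_def)
      then obtain d where d: "d \<in> D" "d \<in> ball (g x) r" using D(2)[of "ball (g x) r"] by auto
      have ud: "u d x < e / (4 * 2 powr p)"
      proof -
        have "u d x < r powr p" unfolding u_def using d(2) p by (intro powr_less_mono2) (auto simp: dist_norm)
        also have "r powr p = e / (4 * 2 powr p)" unfolding r_def using p e by (simp add: powr_powr)
        finally show ?thesis .
      qed
      have "((\<lambda>h. 2 powr p * ((LINT z:{x - h..x + h}|lebesgue. u d z) / h + 2 * u d x)) \<longlongrightarrow> 2 powr p * (2 * u d x + 2 * u d x)) (at_right 0)"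
        using elim d(1) by (intro tendsto_mult tendsto_add tendsto_const) auto
      moreover have "2 powr p * (2 * u d x + 2 * u d x) < e" using ud by (simp add: field_simps)
      ultimately have "\<forall>\<^sub>F h in at_right 0. 2 powr p * ((LINT z:{x - h..x + h}|lebesgue. u d z) / h + 2 * u d x) < e"
        by (rule order_tendstoD(2))
      then show "\<forall>\<^sub>F h in at_right 0. dist ((LINT z:{x - h..x + h}|lebesgue. norm (g z - g x) powr p) / h) 0 < e"
        using eventually_at_right_less[of 0]
      proof eventually_elim
        case (elim h)
        let ?I = "{x - h..x + h}"
        have nn: "(LINT z:?I|lebesgue. u (g x) z) \<ge> 0"
          unfolding set_lebesgue_integral_def u_def by (intro Bochner_Integration.integral_nonneg) auto
        have "(LINT z:?I|lebesgue. u (g x) z) \<le> (LINT z:?I|lebesgue. 2 powr p * (u d z + u d x))"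
        proof (rule set_integral_mono)
          show "set_integrable lebesgue ?I (\<lambda>z. 2 powr p * (u d z + u d x))"
            by (intro set_integrable_mult_right set_integral_add(1) u_int const)
          fix z
          have "norm (g z - g x) \<le> norm (g z - d) + norm (g x - d)"
            using norm_triangle_ineq4[of "g z - d" "g x - d"] by simp
          then have "u (g x) z \<le> (norm (g z - d) + norm (g x - d)) powr p"
            unfolding u_def using p by (intro powr_mono2) auto
          also have "\<dots> \<le> 2 powr p * (u d z + u d x)"
            unfolding u_def using p by (intro add_powr_le) auto
          finally show "u (g x) z \<le> 2 powr p * (u d z + u d x)" .
        qed (rule u_int)
        also have "\<dots> = 2 powr p * ((LINT z:?I|lebesgue. u d z) + (LINT z:?I|lebesgue. u d x))"
          using u_int const by (simp add: set_integral_add(2))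
        also have "(LINT z:?I|lebesgue. u d x) = 2 * h * u d x"
          unfolding set_lebesgue_integral_def using elim by simp
        finally have "(LINT z:?I|lebesgue. u (g x) z) / h \<le> 2 powr p * ((LINT z:?I|lebesgue. u d z) + 2 * h * u d x) / h"
          using elim by (intro divide_right_mono) auto
        also have "\<dots> = 2 powr p * ((LINT z:?I|lebesgue. u d z) / h + 2 * u d x)"
        proof -
          have "P * (A + 2 * h * b) / h = P * (A / h + 2 * b)" for P A b
            using \<open>0 < h\<close> by (simp add: field_simps)
          then show ?thesis .
        qed
        finally show ?case using elim nn unfolding u_def by simp
      qed
    qed
  qed
qed

text \<open>Young's inequality with a large constant on the second term; the conjugate power of the bump is
  integrable exactly when \<open>1 / p < m + 1\<close>.\<close>
lemma bump_young:
  assumes "(m \<ge> 0 \<and> p = 1) \<or> (m > -1 \<and> p > 1 \<and> 1 / p < m + 1)" and e: "e > 0"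
  obtains W c where "integrable lborel W" "(LINT \<sigma>|lborel. W \<sigma>) \<le> e" "c \<ge> 0"
    "\<And>\<sigma> v. v \<ge> 0 \<Longrightarrow> bump m \<sigma> * v \<le> W \<sigma> + c * (v powr p * indicator {-1..1} \<sigma>)"
  using assms(1)
proof (elim disjE conjE)
  assume m: "m \<ge> 0" "p = 1"
  show thesis
  proof (rule that[of "\<lambda>_. 0" 1])
    fix \<sigma> v :: real assume v: "v \<ge> 0"
    show "bump m \<sigma> * v \<le> 0 + 1 * (v powr p * indicator {-1..1} \<sigma>)"
    proof (cases "\<bar>\<sigma>\<bar> < 1")
      case True
      then have "(1 - \<sigma>\<^sup>2) powr m \<le> 1 powr m"
        using m by (intro powr_mono2) (auto simp: abs_square_le_1)
      then have "bump m \<sigma> * v \<le> 1 * v" using True v by (intro mult_right_mono) (auto simp: bump_def)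
      then show ?thesis using True v m by (auto simp: indicator_def abs_less_iff)
    qed (use v in \<open>simp add: bump_eq_0\<close>)
  qed (use e in auto)
next
  assume m: "m > -1" "p > 1" "1 / p < m + 1"
  define q where "q = p / (p - 1)"
  have q: "q > 1" "1 / p + 1 / q = 1" using m(2) by (auto simp: q_def field_simps)
  have mq: "m * q > -1"
  proof -
    have "- m < 1 / q" using q(2) m(3) by linarith
    then show ?thesis using q(1) by (simp add: field_simps)
  qed
  define Z where "Z = bump_mass (m * q)"
  have Z: "Z > 0" unfolding Z_def by (rule bump_mass_pos[OF mq])
  \<comment> \<open>Rescaling in Young's inequality: this \<open>\<delta>\<close> makes the bump
    term integrate to exactly e, at the price of the factor (1/\<delta>)^p on v^p.\<close>
  define \<delta> where "\<delta> = (e * q / Z) powr (1 / q)"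
  have \<delta>: "\<delta> > 0" "\<delta> powr q = e * q / Z" using e q Z by (auto simp: \<delta>_def powr_powr)
  have bq: "bump m \<sigma> powr q = bump (m * q) \<sigma>" for \<sigma> by (simp add: bump_def powr_powr)
  show thesis
  proof (rule that[of "\<lambda>\<sigma>. \<delta> powr q / q * bump (m * q) \<sigma>" "(1 / \<delta>) powr p / p"])
    show "integrable lborel (\<lambda>\<sigma>. \<delta> powr q / q * bump (m * q) \<sigma>)"
      by (intro integrable_mult_right integrable_bump mq)
    show "(LINT \<sigma>|lborel. \<delta> powr q / q * bump (m * q) \<sigma>) \<le> e"
      using Z q e unfolding \<delta>(2) by (simp add: Z_def[unfolded bump_mass_def, symmetric])
    fix \<sigma> v :: real assume v: "v \<ge> 0"
    show "bump m \<sigma> * v \<le> \<delta> powr q / q * bump (m * q) \<sigma> + (1 / \<delta>) powr p / p * (v powr p * indicator {-1..1} \<sigma>)"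
    proof (cases "\<bar>\<sigma>\<bar> < 1")
      case True
      have "bump m \<sigma> * v = (v / \<delta>) * (\<delta> * bump m \<sigma>)" using \<delta> by simp
      also have "\<dots> \<le> (v / \<delta>) powr p / p + (\<delta> * bump m \<sigma>) powr q / q"
        using m(2) q v \<delta>(1) bump_nonneg[of m \<sigma>] by (intro Youngs_inequality) auto
      also have "(\<delta> * bump m \<sigma>) powr q = \<delta> powr q * bump (m * q) \<sigma>"
        unfolding bq[symmetric] by (rule powr_mult)
      also have "(v / \<delta>) powr p = (1 / \<delta>) powr p * v powr p"
        using powr_mult[of "1 / \<delta>" v p] by simp
      finally show ?thesis using True by (auto simp: indicator_def abs_less_iff)
    qed (use v m \<delta> in \<open>simp add: bump_eq_0\<close>)
  qed (use m in auto)
qed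

section \<open>The averaged kernel as an approximate identity\<close>

lemma integrable_lborel_imp_lebesgue:
  fixes f :: "real \<Rightarrow> real"
  assumes "integrable lborel f"
  shows "integrable lebesgue f" "integral\<^sup>L lebesgue f = integral\<^sup>L lborel f"
proof -
  have "f \<in> borel_measurable lborel" using assms by auto
  then show "integrable lebesgue f" "integral\<^sup>L lebesgue f = integral\<^sup>L lborel f"
    using assms by (simp_all add: integrable_completion integral_completion)
qed

lemma lebesgue_dilation:
  fixes f :: "real \<Rightarrow> real"
  assumes f: "integrable lborel f" and t: "t > 0"
  shows "integrable lebesgue (\<lambda>z. f ((z - x) / t))" "(LINT z|lebesgue. f ((z - x) / t)) = t * integral\<^sup>L lborel f"
proof -
  have i: "integrable lborel (\<lambda>z. f ((z - x) / t))"
    using lborel_integrable_real_affine[OF f, of "1 / t" "- x / t"] t by (simp add: diff_divide_distrib)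
  have "(LINT z|lborel. f ((z - x) / t)) = \<bar>t\<bar> *\<^sub>R (LINT z|lborel. f ((x + t * z - x) / t))"
    by (rule lborel_integral_real_affine) (use t in simp)
  then have "(LINT z|lborel. f ((z - x) / t)) = t * integral\<^sup>L lborel f" using t by simp
  then show "integrable lebesgue (\<lambda>z. f ((z - x) / t))" "(LINT z|lebesgue. f ((z - x) / t)) = t * integral\<^sup>L lborel f"
    using integrable_lborel_imp_lebesgue[OF i] by simp_all
qed

text \<open>For m < 0 the peaks of the dilated bump sit at the ends of the shrinking window, so no
  decreasing majorant centred at x is available. \<open>bump_young\<close> with v = |g z - g x|
  replaces it: one term is uniformly small, the other is a constant times the p-th power mean, which
  tends to 0 at x. The correction is of order t against a locally integrable function.\<close>

lemma avg_kernel_approximate_identity: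
  fixes g :: "real \<Rightarrow> complex"
  assumes x: "x > 0" and mp: "(m \<ge> 0 \<and> p = 1) \<or> (m > -1 \<and> p > 1 \<and> 1 / p < m + 1)"
    and gm: "g \<in> borel_measurable lebesgue"
    and gi: "set_integrable lebesgue {x / 2..3 * x / 2} (\<lambda>z. norm (g z) powr p)"
    and lp: "((\<lambda>h. (LINT z:{x - h..x + h}|lebesgue. norm (g z - g x) powr p) / h) \<longlongrightarrow> 0) (at_right 0)"
  shows "\<And>t. 0 < t \<Longrightarrow> t < x / 2 \<Longrightarrow> integrable lebesgue (\<lambda>z. of_real (avg_kernel q m t x z) * g z)"
    and "((\<lambda>t. LINT z|lebesgue. of_real (avg_kernel q m t x z) * g z) \<longlongrightarrow> g x) (at_right 0)"
proof -
  note [measurable] = gm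
  have m: "m > -1" and p: "p \<ge> 1" using mp by auto
  define B where "B = bump_mass m"
  have B: "B > 0" using bump_mass_pos[OF m] by (simp add: B_def)
  let ?J = "{x / 2..3 * x / 2}"
  have const: "set_integrable lebesgue {a..b} (\<lambda>z. c)" for a b c :: real
    unfolding set_integrable_def by (intro integrable_scaleR_left integrable_lebesgue_Icc)
  \<comment> \<open>Local p-integrability gives local integrability through v \<le> 1 + v^p; this is
    what the correction term is tested against.\<close>
  have gJ: "set_integrable lebesgue ?J (\<lambda>z. norm (g z))"
  proof (rule set_integrable_bound)
    show "set_integrable lebesgue ?J (\<lambda>z. 1 + norm (g z) powr p)"
      by (intro set_integral_add(1) const gi)
    show "AE z in lebesgue. z \<in> ?J \<longrightarrow> norm (norm (g z)) \<le> norm (1 + norm (g z) powr p)"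
    proof (intro AE_I2 impI)
      fix z
      have "norm (g z) \<le> 1 + norm (g z) powr p"
      proof (cases "norm (g z) \<le> 1")
        case True
        then show ?thesis using powr_ge_zero[of "norm (g z)" p] by linarith
      next
        case False
        then show ?thesis using powr_mono[OF p, of "norm (g z)"] by simp
      qed
      then show "norm (norm (g z)) \<le> norm (1 + norm (g z) powr p)" by simp
    qed
    show "set_borel_measurable lebesgue ?J (\<lambda>z. norm (g z))" unfolding set_borel_measurable_def
      by (intro borel_measurable_scaleR borel_measurable_indicator borel_measurable_norm gm) auto
  qed
  define G1 where "G1 = (LINT z:?J|lebesgue. norm (g z))"
  obtain C where C: "C \<ge> 0" "\<And>t z. 0 < t \<Longrightarrow> t < x / 2 \<Longrightarrow> \<bar>wave_corr q m t x z\<bar> \<le> C * t"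
    by (rule wave_corr_bound[OF x m, of q]) (rule that)
  define u where "u z = norm (g z - g x)" for z
  have um: "u \<in> borel_measurable lebesgue" unfolding u_def by measurable
  have up_int: "set_integrable lebesgue {x - t..x + t} (\<lambda>z. u z powr p)" if t: "0 < t" "t < x / 2" for t
  proof (rule set_integrable_bound)
    show "set_integrable lebesgue {x - t..x + t} (\<lambda>z. 2 powr p * (norm (g z) powr p + norm (g x) powr p))"
      by (intro set_integrable_mult_right set_integral_add(1) const set_integrable_subset[OF gi]) (use t in auto)
    show "AE z in lebesgue. z \<in> {x - t..x + t} \<longrightarrow> norm (u z powr p) \<le> norm (2 powr p * (norm (g z) powr p + norm (g x) powr p))"
    proof (intro AE_I2 impI)
      fix z
      have "u z powr p \<le> (norm (g z) + norm (g x)) powr p"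
        unfolding u_def using p by (intro powr_mono2 norm_triangle_ineq4) auto
      also have "\<dots> \<le> 2 powr p * (norm (g z) powr p + norm (g x) powr p)"
        using p by (intro add_powr_le) auto
      finally show "norm (u z powr p) \<le> norm (2 powr p * (norm (g z) powr p + norm (g x) powr p))" by simp
    qed
    show "set_borel_measurable lebesgue {x - t..x + t} (\<lambda>z. u z powr p)"
    proof -
      have "(\<lambda>z. u z powr p) \<in> borel_measurable lebesgue" unfolding u_def by measurable
      then show ?thesis unfolding set_borel_measurable_def
        by (intro borel_measurable_scaleR borel_measurable_indicator) auto
    qed
  qed
  have bm: "(\<lambda>z. bump m ((z - x) / t)) \<in> borel_measurable lebesgue" for t
    by (rule measurable_completion) measurable
  have cm: "wave_corr q m t x \<in> borel_measurable lebesgue" for t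
    by (rule measurable_completion) measurable
  have young: "integrable lebesgue (\<lambda>z. bump m ((z - x) / t) * u z) \<and>
      (LINT z|lebesgue. bump m ((z - x) / t) * u z) \<le> t * (e + c * ((LINT z:{x - t..x + t}|lebesgue. u z powr p) / t))"
    if t: "0 < t" "t < x / 2" and W: "integrable lborel W" "(LINT \<sigma>|lborel. W \<sigma>) \<le> e" "c \<ge> 0"
    "\<And>\<sigma> v. v \<ge> 0 \<Longrightarrow> bump m \<sigma> * v \<le> W \<sigma> + c * (v powr p * indicator {-1..1} \<sigma>)" for t W e c
  proof -
    have ii: "indicator {-1..1} ((z - x) / t) = (indicator {x - t..x + t} z :: real)" for z
    proof -
      have "(z - x) / t \<in> {-1..1} \<longleftrightarrow> z \<in> {x - t..x + t}" using t by (auto simp: field_simps)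
      then show ?thesis by (simp add: indicator_def)
    qed
    have bd: "bump m ((z - x) / t) * u z \<le> W ((z - x) / t) + c * (indicator {x - t..x + t} z *\<^sub>R u z powr p)" for z
      using W(4)[of "u z" "(z - x) / t"] unfolding ii by (simp add: u_def mult.commute)
    have ri: "integrable lebesgue (\<lambda>z. W ((z - x) / t) + c * (indicator {x - t..x + t} z *\<^sub>R u z powr p))"
      by (intro Bochner_Integration.integrable_add lebesgue_dilation(1) W(1) t(1) integrable_mult_right
        up_int[OF t, unfolded set_integrable_def])
    have nn: "bump m ((z - x) / t) * u z \<ge> 0" for z using bump_nonneg[of m "(z - x) / t"] by (simp add: u_def)
    have li: "integrable lebesgue (\<lambda>z. bump m ((z - x) / t) * u z)"
    proof (rule Bochner_Integration.integrable_bound[OF ri])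
      show "AE z in lebesgue. norm (bump m ((z - x) / t) * u z) \<le> norm (W ((z - x) / t) + c * (indicator {x - t..x + t} z *\<^sub>R u z powr p))"
        using order_trans[OF bd abs_ge_self] nn by (intro AE_I2) (simp only: real_norm_def abs_of_nonneg)
    qed (intro borel_measurable_times bm um)
    have "(LINT z|lebesgue. bump m ((z - x) / t) * u z) \<le> (LINT z|lebesgue. W ((z - x) / t) + c * (indicator {x - t..x + t} z *\<^sub>R u z powr p))"
      by (rule integral_mono[OF li ri bd])
    also have "\<dots> = t * integral\<^sup>L lborel W + c * (LINT z:{x - t..x + t}|lebesgue. u z powr p)"
      unfolding set_lebesgue_integral_def lebesgue_dilation(2)[OF W(1) t(1), of x, symmetric]
      using lebesgue_dilation(1)[OF W(1) t(1), of x] up_int[OF t, unfolded set_integrable_def]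
      by (subst Bochner_Integration.integral_add) auto
    also have "\<dots> \<le> t * e + c * (LINT z:{x - t..x + t}|lebesgue. u z powr p)"
      using W(2) t by simp
    also have "\<dots> = t * (e + c * ((LINT z:{x - t..x + t}|lebesgue. u z powr p) / t))"
      using t by (simp add: distrib_left)
    finally show ?thesis using li by simp
  qed
  have bu_int: "integrable lebesgue (\<lambda>z. bump m ((z - x) / t) * u z)" if t: "0 < t" "t < x / 2" for t
  proof -
    obtain W c where W: "integrable lborel W" "(LINT \<sigma>|lborel. W \<sigma>) \<le> 1" "c \<ge> 0"
      "\<And>\<sigma> v. v \<ge> 0 \<Longrightarrow> bump m \<sigma> * v \<le> W \<sigma> + c * (v powr p * indicator {-1..1} \<sigma>)"
      by (rule bump_young[OF mp zero_less_one]) (rule that)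
    from young[OF t W] show ?thesis by simp
  qed
  have bg_int: "integrable lebesgue (\<lambda>z. of_real (bump m ((z - x) / t)) * (g z - g x))" if t: "0 < t" "t < x / 2" for t
  proof (rule Bochner_Integration.integrable_bound[OF bu_int[OF t]])
    show "AE z in lebesgue. norm (of_real (bump m ((z - x) / t)) * (g z - g x)) \<le> norm (bump m ((z - x) / t) * u z)"
      by (intro AE_I2) (simp add: norm_mult u_def)
  qed (use bm in measurable)
  have b_int: "integrable lebesgue (\<lambda>z. of_real (bump m ((z - x) / t)) * g x)"
    "(LINT z|lebesgue. of_real (bump m ((z - x) / t)) * g x) = of_real (t * B) * g x" if t: "0 < t" for t
    using lebesgue_dilation[OF integrable_bump[OF m] t, of x] by (simp_all add: B_def bump_mass_def)
  have cg: "norm (of_real (wave_corr q m t x z) * g z) \<le> C * t * (indicator ?J z *\<^sub>R norm (g z))" if t: "0 < t" "t < x / 2" for t z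
  proof (cases "\<bar>z - x\<bar> < t")
    case True
    then have "z \<in> ?J" using t by auto
    then show ?thesis using mult_right_mono[OF C(2)[OF t, of z] norm_ge_zero[of "g z"]] by (simp add: norm_mult)
  next
    case False
    then show ?thesis using t C(1) by (simp add: wave_corr_eq_0)
  qed
  have c_int: "integrable lebesgue (\<lambda>z. of_real (wave_corr q m t x z) * g z)" if t: "0 < t" "t < x / 2" for t
  proof (rule Bochner_Integration.integrable_bound[OF integrable_mult_right[OF gJ[unfolded set_integrable_def], of "C * t"]])
    show "AE z in lebesgue. norm (of_real (wave_corr q m t x z) * g z) \<le> norm (C * t * (indicator ?J z *\<^sub>R norm (g z)))"
      unfolding real_norm_def by (intro AE_I2 order_trans[OF cg[OF t] abs_ge_self])
  qed (use cm in measurable)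
  \<comment> \<open>Splitting g z = (g z - g x) + g x: the dilated bump has mass t B, so the middle
    term integrates to exactly g x.\<close>
  have eq: "of_real (avg_kernel q m t x z) * g z = of_real (1 / (t * B)) * (of_real (bump m ((z - x) / t)) * (g z - g x))
      + of_real (1 / (t * B)) * (of_real (bump m ((z - x) / t)) * g x) + of_real (wave_corr q m t x z) * g z" for t z
    unfolding avg_kernel_def B_def by (simp add: algebra_simps)
  show "integrable lebesgue (\<lambda>z. of_real (avg_kernel q m t x z) * g z)" if t: "0 < t" "t < x / 2" for t
    unfolding eq by (intro Bochner_Integration.integrable_add integrable_mult_right bg_int b_int(1) c_int t)
  have diff: "(LINT z|lebesgue. of_real (avg_kernel q m t x z) * g z) - g x =
      of_real (1 / (t * B)) * (LINT z|lebesgue. of_real (bump m ((z - x) / t)) * (g z - g x))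
      + (LINT z|lebesgue. of_real (wave_corr q m t x z) * g z)" if t: "0 < t" "t < x / 2" for t
  proof -
    have "(LINT z|lebesgue. of_real (avg_kernel q m t x z) * g z) =
      of_real (1 / (t * B)) * (LINT z|lebesgue. of_real (bump m ((z - x) / t)) * (g z - g x))
      + of_real (1 / (t * B)) * (of_real (t * B) * g x) + (LINT z|lebesgue. of_real (wave_corr q m t x z) * g z)"
      unfolding eq b_int(2)[OF t(1), symmetric]
      using bg_int[OF t] b_int(1)[OF t(1)] c_int[OF t] by simp
    also have "of_real (1 / (t * B)) * (of_real (t * B) * g x) = g x"
      using t B by simp
    finally show ?thesis by simp
  qed
  have est: "norm ((LINT z|lebesgue. of_real (avg_kernel q m t x z) * g z) - g x)
      \<le> (e + c * ((LINT z:{x - t..x + t}|lebesgue. u z powr p) / t)) / B + C * G1 * t"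
    if t: "0 < t" "t < x / 2" and W: "integrable lborel W" "(LINT \<sigma>|lborel. W \<sigma>) \<le> e" "c \<ge> 0"
    "\<And>\<sigma> v. v \<ge> 0 \<Longrightarrow> bump m \<sigma> * v \<le> W \<sigma> + c * (v powr p * indicator {-1..1} \<sigma>)" for t W e c
  proof -
    let ?F = "e + c * ((LINT z:{x - t..x + t}|lebesgue. u z powr p) / t)"
    have "norm (LINT z|lebesgue. of_real (bump m ((z - x) / t)) * (g z - g x))
      \<le> (LINT z|lebesgue. norm (of_real (bump m ((z - x) / t)) * (g z - g x)))"
      by (rule integral_norm_bound)
    also have "\<dots> = (LINT z|lebesgue. bump m ((z - x) / t) * u z)"
      by (intro Bochner_Integration.integral_cong) (auto simp: norm_mult u_def bump_nonneg)
    also have "\<dots> \<le> t * ?F" using young[OF t W] by simp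
    finally have 1: "norm (LINT z|lebesgue. of_real (bump m ((z - x) / t)) * (g z - g x)) \<le> t * ?F" .
    have "norm (of_real (1 / (t * B)) * (LINT z|lebesgue. of_real (bump m ((z - x) / t)) * (g z - g x)))
      = 1 / (t * B) * norm (LINT z|lebesgue. of_real (bump m ((z - x) / t)) * (g z - g x))"
      unfolding norm_mult norm_of_real using t B by simp
    also have "\<dots> \<le> 1 / (t * B) * (t * ?F)" using 1 t B by (intro mult_left_mono) auto
    also have "\<dots> = ?F / B" using t by simp
    finally have 2: "norm (of_real (1 / (t * B)) * (LINT z|lebesgue. of_real (bump m ((z - x) / t)) * (g z - g x))) \<le> ?F / B" .
    have "norm (LINT z|lebesgue. of_real (wave_corr q m t x z) * g z) \<le> (LINT z|lebesgue. norm (of_real (wave_corr q m t x z) * g z))"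
      by (rule integral_norm_bound)
    also have "\<dots> \<le> (LINT z|lebesgue. C * t * (indicator ?J z *\<^sub>R norm (g z)))"
      by (rule integral_mono[OF integrable_norm[OF c_int[OF t]] integrable_mult_right[OF gJ[unfolded set_integrable_def]] cg[OF t]])
    also have "\<dots> = C * G1 * t" unfolding G1_def set_lebesgue_integral_def by simp
    finally show ?thesis unfolding diff[OF t] using 2 by (intro norm_triangle_le) linarith
  qed
  show "((\<lambda>t. LINT z|lebesgue. of_real (avg_kernel q m t x z) * g z) \<longlongrightarrow> g x) (at_right 0)"
  proof (rule tendstoI)
    fix \<epsilon> :: real assume \<epsilon>: "\<epsilon> > 0"
    \<comment> \<open>After division by B this contributes \<epsilon>/2, while the power mean and
      the correction vanish in the limit.\<close>
    define e where "e = \<epsilon> * B / 2"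
    have e: "e > 0" using \<epsilon> B by (simp add: e_def)
    obtain W c where W: "integrable lborel W" "(LINT \<sigma>|lborel. W \<sigma>) \<le> e" "c \<ge> 0"
      "\<And>\<sigma> v. v \<ge> 0 \<Longrightarrow> bump m \<sigma> * v \<le> W \<sigma> + c * (v powr p * indicator {-1..1} \<sigma>)"
      by (rule bump_young[OF mp e]) (rule that)
    have "((\<lambda>t. (e + c * ((LINT z:{x - t..x + t}|lebesgue. u z powr p) / t)) / B + C * G1 * t) \<longlongrightarrow> (e + c * 0) / B + C * G1 * 0) (at_right 0)"
      using lp B unfolding u_def by (intro tendsto_intros) auto
    moreover have "(e + c * 0) / B + C * G1 * 0 < \<epsilon>" using B \<epsilon> by (simp add: e_def)
    ultimately have "\<forall>\<^sub>F t in at_right 0. (e + c * ((LINT z:{x - t..x + t}|lebesgue. u z powr p) / t)) / B + C * G1 * t < \<epsilon>"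
      by (rule order_tendstoD(2))
    moreover have "\<forall>\<^sub>F t in at_right 0. t \<in> {0<..<x / 2}" by (rule eventually_at_right_real) (use x in simp)
    ultimately show "\<forall>\<^sub>F t in at_right 0. dist (LINT z|lebesgue. of_real (avg_kernel q m t x z) * g z) (g x) < \<epsilon>"
    proof eventually_elim
      case (elim t)
      then have t: "0 < t" "t < x / 2" by auto
      from est[OF t W] elim(1) show ?case by (simp add: dist_norm)
    qed
  qed
qed

section \<open>Passage to the measure \<open>mu\<close> and conclusion\<close>

lemma emeasure_mu_singleton:
  assumes "z > 0"
  shows "{z} \<in> sets (mu \<alpha>)" "emeasure (mu \<alpha>) {z} = 0"
proof -
  have s: "{z} \<in> sets (lebesgue_on {0<..})" using assms by (simp add: sets_restrict_space_iff)
  then show "{z} \<in> sets (mu \<alpha>)" by (simp add: mu_def)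
  have "{z} \<in> null_sets lebesgue" by (intro null_setsI) auto
  then have n: "{z} \<in> null_sets (lebesgue_on {0<..})" using assms by (simp add: null_sets_restrict_space)
  have pm: "(\<lambda>x. ennreal (x powr (2 * \<alpha> + 1))) \<in> borel_measurable (lebesgue_on {0<..})"
    by (intro measurable_restrict_space1 measurable_completion) measurable
  have "absolutely_continuous (lebesgue_on {0<..}) (mu \<alpha>)"
    unfolding mu_def by (rule absolutely_continuousI_density[OF pm])
  with n show "emeasure (mu \<alpha>) {z} = 0" unfolding absolutely_continuous_def by auto
qed

text \<open>The density z^(2\<alpha>+1) turns (x z)^(-\<alpha>-1/2) into x^(-\<alpha>-1/2)
  z^(\<alpha>+1/2), and the power of z is absorbed in g. The formula for g is asked only near x
  because the kernel vanishes elsewhere, so g may be a truncation with global measurability.\<close>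

lemma mu_kernel_integral:
  fixes f g :: "real \<Rightarrow> complex"
  assumes \<alpha>: "\<alpha> > -1" and \<mu>: "\<alpha> + \<beta> > -1/2" and x: "x > 0" and t: "0 < t" "t < x / 2"
    and int: "integrable lebesgue (\<lambda>z. of_real (avg_kernel (\<alpha>\<^sup>2 - 1/4) (\<alpha> + \<beta> - 1/2) t x z) * g z)"
    and g: "\<And>z. \<bar>z - x\<bar> < t \<Longrightarrow> g z = of_real (z powr (\<alpha> + 1/2)) * f z"
  shows "integrable (mu \<alpha>) (\<lambda>z. of_real (kernel \<alpha> \<beta> t x z) * f z)"
    and "M_op \<alpha> \<beta> t f x = of_real (x powr (- (\<alpha> + 1/2))) *
      (LINT z|lebesgue. of_real (avg_kernel (\<alpha>\<^sup>2 - 1/4) (\<alpha> + \<beta> - 1/2) t x z) * g z)"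
proof -
  let ?a = "\<alpha> + 1/2"
  define K where "K = avg_kernel (\<alpha>\<^sup>2 - 1/4) (\<alpha> + \<beta> - 1/2) t x"
  define F where "F z = of_real (x powr (- ?a)) * (of_real (K z) * g z)" for z
  define w where "w z = z powr (2 * \<alpha> + 1)" for z :: real
  \<comment> \<open>The integrand with the explicit kernel: measurable, and equal to the true one
    except perhaps at z = x - t and z = x + t, where \<open>kernel\<close> has not been
    computed.\<close>
  define Q where "Q z = (z powr (- (2 * \<alpha> + 1))) *\<^sub>R F z" for z
  let ?M = "lebesgue_on {0<..}"
  have Fi: "integrable lebesgue F" unfolding F_def K_def by (rule integrable_mult_right[OF int])
  then have Fm: "F \<in> borel_measurable lebesgue" by auto
  have K0: "K z = 0" if "\<bar>z - x\<bar> \<ge> t" for z unfolding K_def using that t by (simp add: avg_kernel_eq_0)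
  have pm: "(\<lambda>z. z powr c) \<in> borel_measurable ?M" for c :: real
    by (intro measurable_restrict_space1 measurable_completion) measurable
  have Qm: "Q \<in> borel_measurable ?M"
    unfolding Q_def by (intro borel_measurable_scaleR pm measurable_restrict_space1 Fm)
  have PQ: "of_real (kernel \<alpha> \<beta> t x z) * f z = Q z" if z: "z \<in> space (mu \<alpha>)" "z \<notin> {x - t, x + t}" for z
  proof -
    have zp: "z > 0" using z(1) by (simp add: mu_def)
    have zt: "\<bar>z - x\<bar> \<noteq> t" using z(2) by (auto simp: abs_if split: if_splits)
    have k: "kernel \<alpha> \<beta> t x z = (x * z) powr (- ?a) * K z"
      unfolding K_def by (rule kernel_eq_avg_kernel[OF \<alpha> \<mu> x t zp zt])
    show ?thesis
    proof (cases "\<bar>z - x\<bar> < t")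
      case True
      have e: "(x * z) powr (- ?a) = z powr (- (2 * \<alpha> + 1)) * x powr (- ?a) * z powr ?a"
      proof -
        have "z powr (- (2 * \<alpha> + 1)) * z powr ?a = z powr (- ?a)"
          by (simp add: powr_add[symmetric])
        then show ?thesis by (simp add: powr_mult mult_ac)
      qed
      show ?thesis unfolding k Q_def F_def g[OF True] e by (simp add: scaleR_conv_of_real mult_ac)
    next
      case False
      then show ?thesis using zt by (simp add: k Q_def F_def K0)
    qed
  qed
  have wQ: "w z *\<^sub>R Q z = F z" if "z > 0" for z
  proof -
    have "w z * z powr (- (2 * \<alpha> + 1)) = 1"
      unfolding w_def using that by (simp add: powr_add[symmetric])
    then show ?thesis unfolding Q_def by simp
  qed
  have mu: "mu \<alpha> = density ?M (\<lambda>z. ennreal (w z))" by (simp add: mu_def w_def)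
  have wm: "w \<in> borel_measurable ?M" unfolding w_def by (rule pm)
  have wn: "AE z in ?M. 0 \<le> w z" by (simp add: w_def)
  have F0: "indicator {0<..} z *\<^sub>R F z = F z" for z
    using K0[of z] t x by (cases "z > 0") (auto simp: F_def)
  have FiM: "integrable ?M F"
    using Fi by (subst integrable_restrict_space) (auto simp: F0)
  have QiF: "integrable ?M (\<lambda>z. w z *\<^sub>R Q z)"
    by (rule Bochner_Integration.integrable_cong[THEN iffD2, OF refl _ FiM]) (simp add: wQ)
  have Qi: "integrable (mu \<alpha>) Q"
    unfolding mu by (subst integrable_density[OF Qm wm wn]) (rule QiF)
  have X: "countable {x - t, x + t}" "\<And>z. z \<in> {x - t, x + t} \<Longrightarrow> emeasure (mu \<alpha>) {z} = 0"
    "\<And>z. z \<in> {x - t, x + t} \<Longrightarrow> {z} \<in> sets (mu \<alpha>)"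
    using emeasure_mu_singleton[of "x - t"] emeasure_mu_singleton[of "x + t"] t x by auto
  show "integrable (mu \<alpha>) (\<lambda>z. of_real (kernel \<alpha> \<beta> t x z) * f z)"
    by (rule integrable_discrete_difference[where X="{x - t, x + t}" and g=Q, THEN iffD2]) (use X PQ Qi in blast)+
  have "M_op \<alpha> \<beta> t f x = integral\<^sup>L (mu \<alpha>) Q"
    unfolding M_op_def
    by (rule integral_discrete_difference[where X="{x - t, x + t}"]) (use X PQ in blast)+
  also have "\<dots> = (LINT z|?M. w z *\<^sub>R Q z)"
    unfolding mu by (rule integral_density[OF Qm wm wn])
  also have "\<dots> = integral\<^sup>L ?M F"
    by (rule Bochner_Integration.integral_cong) (auto simp: wQ)
  also have "\<dots> = integral\<^sup>L lebesgue F"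
    by (subst integral_restrict_space) (auto simp: F0)
  also have "\<dots> = of_real (x powr (- ?a)) * (LINT z|lebesgue. of_real (K z) * g z)"
    unfolding F_def by simp
  finally show "M_op \<alpha> \<beta> t f x = of_real (x powr (- ?a)) *
      (LINT z|lebesgue. of_real (avg_kernel (\<alpha>\<^sup>2 - 1/4) (\<alpha> + \<beta> - 1/2) t x z) * g z)"
    unfolding K_def .
qed

text \<open>The integrability conjunct excludes a limit produced by the default value 0 of a
  non-integrable integral. It is asserted for small t with a threshold depending on x, because f is
  controlled on compact sets only.\<close>

theorem corollary1p11:
  fixes \<alpha> \<beta> p :: real and f :: "real \<Rightarrow> complex"
  assumes "\<alpha> > -1" and "\<alpha> + \<beta> > -1/2" and "1 < p"
    and "(\<alpha> + \<beta> \<ge> 1/2 \<and> locally_integrable f) \<or>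
         (\<alpha> + \<beta> < 1/2 \<and> 1 / p < \<alpha> + \<beta> + 1/2 \<and> locally_Lp p f)"
  shows "AE x in lebesgue_on {0<..}.
           (\<forall>\<^sub>F t in at_right 0. integrable (mu \<alpha>) (\<lambda>z. of_real (kernel \<alpha> \<beta> t x z) * f z)) \<and>
           ((\<lambda>t. M_op \<alpha> \<beta> t f x) \<longlongrightarrow> f x) (at_right 0)"
proof -
  define r where "r = (if \<alpha> + \<beta> \<ge> 1/2 then 1 else p)"
  let ?m = "\<alpha> + \<beta> - 1/2" and ?a = "\<alpha> + 1/2"
  have mr: "(?m \<ge> 0 \<and> r = 1) \<or> (?m > -1 \<and> r > 1 \<and> 1 / r < ?m + 1)"
    using assms by (auto simp: r_def)
  have r1: "r \<ge> 1" using assms(3) by (simp add: r_def)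
  have loc: "set_borel_measurable lebesgue K f \<and> set_integrable lebesgue K (\<lambda>z. norm (f z) powr r)"
    if K: "compact K" "K \<subseteq> {0<..}" for K
  proof (cases "\<alpha> + \<beta> \<ge> 1/2")
    case True
    then have "set_integrable lebesgue K f" using assms(4) K by (auto simp: locally_integrable_def)
    then show ?thesis using True set_integrable_norm[of lebesgue K f]
      by (simp add: r_def set_borel_measurable_def set_integrable_def borel_measurable_integrable)
  next
    case False
    then show ?thesis using assms(4) K by (auto simp: locally_Lp_def r_def)
  qed
  \<comment> \<open>A compact exhaustion: the truncations \<open>g n\<close> are measurable and
    r-integrable on the whole line, and there are countably many, so one null set serves them
    all.\<close>
  define K where "K n = {1 / (real n + 1)..real n + 1}" for n
  have K: "compact (K n)" "K n \<subseteq> {0<..}" for n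
  proof -
    have "1 / (real n + 1) > 0" by simp
    then show "compact (K n)" "K n \<subseteq> {0<..}" unfolding K_def using less_le_trans by (auto, blast)
  qed
  define g where "g n z = indicator (K n) z *\<^sub>R (of_real (z powr ?a) * f z)" for n z
  have gm: "g n \<in> borel_measurable lebesgue" for n
  proof -
    have "(\<lambda>z. complex_of_real (z powr ?a)) \<in> borel_measurable lebesgue"
      by (rule measurable_completion) measurable
    moreover have "(\<lambda>z. indicator (K n) z *\<^sub>R f z) \<in> borel_measurable lebesgue"
      using loc[OF K[of n]] by (simp add: set_borel_measurable_def)
    ultimately have "(\<lambda>z. of_real (z powr ?a) * (indicator (K n) z *\<^sub>R f z)) \<in> borel_measurable lebesgue"
      by (rule borel_measurable_times)
    moreover have "g n = (\<lambda>z. of_real (z powr ?a) * (indicator (K n) z *\<^sub>R f z))" by (simp add: g_def fun_eq_iff)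
    ultimately show ?thesis by simp
  qed
  have gi: "set_integrable lebesgue {c..d} (\<lambda>z. norm (g n z) powr r)" for n c d
  proof -
    have "continuous_on (K n) (\<lambda>z. (z powr ?a) powr r)"
      using K(2)[of n] by (intro continuous_intros) auto
    then have "bounded ((\<lambda>z. (z powr ?a) powr r) ` K n)"
      by (intro compact_imp_bounded compact_continuous_image K)
    then obtain C where C: "\<And>z. z \<in> K n \<Longrightarrow> (z powr ?a) powr r \<le> C"
      unfolding bounded_iff by auto
    have "integrable lebesgue (\<lambda>z. norm (g n z) powr r)"
    proof (rule Bochner_Integration.integrable_bound)
      show "integrable lebesgue (\<lambda>z. C * (indicator (K n) z *\<^sub>R norm (f z) powr r))"
        using loc[OF K[of n]] by (intro integrable_mult_right) (simp add: set_integrable_def)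
      show "(\<lambda>z. norm (g n z) powr r) \<in> borel_measurable lebesgue" using gm[of n] by measurable
      show "AE z in lebesgue. norm (norm (g n z) powr r) \<le> norm (C * (indicator (K n) z *\<^sub>R norm (f z) powr r))"
      proof (intro AE_I2)
        fix z
        show "norm (norm (g n z) powr r) \<le> norm (C * (indicator (K n) z *\<^sub>R norm (f z) powr r))"
        proof (cases "z \<in> K n")
          case True
          then have "norm (g n z) powr r = (z powr ?a) powr r * norm (f z) powr r"
            by (simp add: g_def norm_mult powr_mult)
          also have "\<dots> \<le> C * norm (f z) powr r" by (intro mult_right_mono C True) simp
          finally show ?thesis using True by simp
        qed (simp add: g_def)
      qed
    qed
    then show ?thesis unfolding set_integrable_def by (intro integrable_mult_indicator) auto
  qed
  have "AE x in lebesgue. \<forall>n. ((\<lambda>h. (LINT z:{x - h..x + h}|lebesgue. norm (g n z - g n x) powr r) / h) \<longlongrightarrow> 0) (at_right 0)"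
    by (subst AE_all_countable) (intro allI lebesgue_points gm r1 gi)
  then have "AE x in lebesgue_on {0<..}. \<forall>n. ((\<lambda>h. (LINT z:{x - h..x + h}|lebesgue. norm (g n z - g n x) powr r) / h) \<longlongrightarrow> 0) (at_right 0)"
    by (subst AE_restrict_space_iff) auto
  moreover have "AE x in lebesgue_on {0<..}. x > 0" by (rule AE_I2) simp
  ultimately show ?thesis
  proof eventually_elim
    case (elim x)
    have x: "x > 0" by (rule elim(2))
    \<comment> \<open>Large enough that \<open>K n\<close> contains the points from x/2 to 3x/2: the
      summand 2/x serves the left end, 3x/2 the right.\<close>
    obtain n :: nat where n: "2 / x + 3 * x / 2 \<le> real n" using real_arch_simple by blast
    have lower: "1 / (real n + 1) \<le> x / 2"
    proof -
      have "2 / x \<le> real n + 1" using n x by (smt (verit) divide_nonneg_pos)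
      then show ?thesis using x by (simp add: field_simps)
    qed
    have "2 / x > 0" using x by simp
    then have upper: "3 * x / 2 \<le> real n + 1" using n by linarith
    have gx: "g n z = of_real (z powr ?a) * f z" if "\<bar>z - x\<bar> < x / 2" for z
    proof -
      have "x / 2 \<le> z" "z \<le> 3 * x / 2" using that by linarith+
      then have "z \<in> K n" unfolding K_def using order_trans[OF lower] order_trans[OF _ upper] by simp
      then show ?thesis by (simp add: g_def)
    qed
    note approx = avg_kernel_approximate_identity[OF x mr gm[of n] gi spec[OF elim(1)], where q="\<alpha>\<^sup>2 - 1/4"]
    have ker: "integrable (mu \<alpha>) (\<lambda>z. of_real (kernel \<alpha> \<beta> t x z) * f z)"
      "M_op \<alpha> \<beta> t f x = of_real (x powr (- ?a)) * (LINT z|lebesgue. of_real (avg_kernel (\<alpha>\<^sup>2 - 1/4) ?m t x z) * g n z)"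
      if t: "0 < t" "t < x / 2" for t
      by (intro mu_kernel_integral[OF assms(1,2) x t approx(1)[OF t]] gx; use t in simp)+
    have ev: "\<forall>\<^sub>F t in at_right 0. t \<in> {0<..<x / 2}" by (rule eventually_at_right_real) (use x in simp)
    have "((\<lambda>t. of_real (x powr (- ?a)) * (LINT z|lebesgue. of_real (avg_kernel (\<alpha>\<^sup>2 - 1/4) ?m t x z) * g n z))
      \<longlongrightarrow> of_real (x powr (- ?a)) * g n x) (at_right 0)"
      by (intro tendsto_mult_left approx(2))
    moreover have "of_real (x powr (- ?a)) * g n x = f x"
    proof -
      have "x powr (- ?a) * x powr ?a = 1" using x by (simp add: powr_add[symmetric])
      then have "complex_of_real (x powr (- ?a)) * of_real (x powr ?a) = 1" by (metis of_real_mult of_real_1)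
      then show ?thesis using gx[of x] x by (simp add: mult.assoc[symmetric])
    qed
    ultimately have lim: "((\<lambda>t. of_real (x powr (- ?a)) * (LINT z|lebesgue. of_real (avg_kernel (\<alpha>\<^sup>2 - 1/4) ?m t x z) * g n z))
      \<longlongrightarrow> f x) (at_right 0)" by simp
    have "((\<lambda>t. M_op \<alpha> \<beta> t f x) \<longlongrightarrow> f x) (at_right 0)"
    proof (rule Lim_transform_eventually[OF lim])
      show "\<forall>\<^sub>F t in at_right 0. of_real (x powr (- ?a)) * (LINT z|lebesgue. of_real (avg_kernel (\<alpha>\<^sup>2 - 1/4) ?m t x z) * g n z)
          = M_op \<alpha> \<beta> t f x"
        using ev by eventually_elim (use ker(2) in auto)
    qed
    moreover have "\<forall>\<^sub>F t in at_right 0. integrable (mu \<alpha>) (\<lambda>z. of_real (kernel \<alpha> \<beta> t x z) * f z)"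
      using ev by eventually_elim (use ker(1) in auto)
    ultimately show ?case by blast
  qed
qed

end
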